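(* Let $\mathcal{C}$ be a premodel category equipped with a strong Quillen cylinder. Then: - any core left saturated and right saturated premodel structure on the underlying category of $\mathcal{C}$ that has the same left core as $\mathcal{C}$ is a left semi-model category (that is, there is a class of weak equivalences which together with its cofibrations and fibrations makes it a Spitzweck left semi-model category); - any core right saturated and left saturated premodel structure on the underlying category of $\mathcal{C}$ that has the same right core as $\mathcal{C}$ is a right semi-model category (that is, there is a class of weak equivalences which together with its cofibrations and fibrations makes it a Spitzweck right semi-model category).
   Context: Premodel category: a complete and cocomplete category with two weak factorization systems, (cofibrations, anodyne fibrations) and (anodyne cofibrations, fibrations), such that every anodyne cofibration is a cofibration. An object is cofibrant if the map from the initial object is a cofibration, fibrant if the map to the terminal object is a fibration. An acyclic cofibration is a cofibration with the left lifting property against all fibrations between fibrant objects; an acyclic fibration is a fibration with the right lifting property against all cofibrations between cofibrant objects. A core cofibration is a cofibration with cofibrant domain; a core fibration is a fibration with fibrant target. The left core is the full subcategory of cofibrant objects endowed with the classes of core cofibrations and of acyclic core cofibrations; the right core is the full subcategory of fibrant objects endowed with the classes of core fibrations and of acyclic core fibrations. Saturation: right saturated (resp. core right saturated) means all acyclic fibrations (resp. all acyclic core fibrations) are anodyne fibrations; left saturated (resp. core left saturated) means all acyclic cofibrations (resp. all acyclic core cofibrations) are anodyne cofibrations. Strong Quillen cylinder: for a natural transformation $\lambda : F \to G$ between left adjoint functors between premodel categories and an arrow $v : X \to Y$, let $\lambda \widehat{\otimes} v : F(Y)\coprod_{F(X)} G(X) \to G(Y)$ be the corner-product map. $\lambda$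 is called a cofibration if $\lambda\widehat{\otimes} i$ is a cofibration for every cofibration $i$ and $\lambda \widehat{\otimes} j$ is an anodyne cofibration for every anodyne cofibration $j$; it is called an anodyne cofibration if $\lambda \widehat{\otimes} i$ is an anodyne cofibration for every cofibration $i$. A strong Quillen cylinder on $\mathcal{C}$ is a left adjoint endofunctor $I:\mathcal{C}\to\mathcal{C}$ with natural transformations $\mathrm{Id}_{\mathcal{C}} \coprod \mathrm{Id}_{\mathcal{C}} \xrightarrow{i} I \to \mathrm{Id}_{\mathcal{C}}$ factoring the codiagonal, such that $i$ is a cofibration and the composite $\mathrm{Id}_{\mathcal{C}} \to I$ of $i$ with the first coproduct inclusion is an anodyne cofibration, both in this sense. Left semi-model category (in the sense of Spitzweck): a category with limits and colimits and classes of weak equivalences, cofibrations, fibrations such that: (1) weak equivalences satisfy 2-out-of-3 and all three classes are stable under retracts; (2) any map with cofibrant domain factors as a cofibration followed by a trivial fibration, and as a trivial cofibration followed by a fibration (trivial = also a weak equivalence); (3) a core cofibration $i$ has the left lifting property against a fibration $p$ whenever one of them is a weak equivalence; (4) fibrations are stable under pullback; (5) the initial object is cofibrant; and moreover (cofibrations, trivial fibrations) is a weak factorization system. Right semi-model category (in the sense of Spitzweck) is the categorical dual: factorizations in (2) for maps with fibrant target, lifting in (3) for a cofibration against a core fibration, cofibrations stable under pushout, terminal object fibrant, and (trivial cofibrations, fibrations) a weak factorization system. *)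

theory Defs
  imports Main
begin

unbundle cardinal_syntax

section \<open>Categories, functors, natural transformations\<close>

text \<open>Objects and arrows are carved out of two ambient types by carrier sets; the operations are
  unconstrained outside the carriers. Composition is in applicative order: \<open>g \<cdot> f\<close> is \<open>g\<close>
  after \<open>f\<close>.\<close>

record ('o, 'm) category =
  Obj :: "'o set"
  Arr :: "'m set"
  Dom :: "'m \<Rightarrow> 'o"
  Cod :: "'m \<Rightarrow> 'o"
  Ident :: "'o \<Rightarrow> 'm"
  Comp :: "'m \<Rightarrow> 'm \<Rightarrow> 'm"  (infixl \<open>\<cdot>\<index>\<close> 70)

definition Hom :: "('o, 'm) category \<Rightarrow> 'o \<Rightarrow> 'o \<Rightarrow> 'm set" where
  "Hom C X Y = {f \<in> Arr C. Dom C f = X \<and> Cod C f = Y}"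

definition is_category :: "('o, 'm) category \<Rightarrow> bool" where
  "is_category C \<longleftrightarrow>
     (\<forall>f \<in> Arr C. Dom C f \<in> Obj C \<and> Cod C f \<in> Obj C) \<and>
     (\<forall>X \<in> Obj C. Ident C X \<in> Hom C X X) \<and>
     (\<forall>X Y Z. \<forall>f \<in> Hom C X Y. \<forall>g \<in> Hom C Y Z. g \<cdot>\<^bsub>C\<^esub> f \<in> Hom C X Z) \<and>
     (\<forall>X Y. \<forall>f \<in> Hom C X Y. f \<cdot>\<^bsub>C\<^esub> Ident C X = f \<and> Ident C Y \<cdot>\<^bsub>C\<^esub> f = f) \<and>
     (\<forall>X Y Z U. \<forall>f \<in> Hom C X Y. \<forall>g \<in> Hom C Y Z. \<forall>h \<in> Hom C Z U.
        (h \<cdot>\<^bsub>C\<^esub> g) \<cdot>\<^bsub>C\<^esub> f = h \<cdot>\<^bsub>C\<^esub> (g \<cdot>\<^bsub>C\<^esub> f))"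

definition full_subcategory :: "('o, 'm) category \<Rightarrow> 'o set \<Rightarrow> ('o, 'm) category" where
  "full_subcategory C S =
     C\<lparr>Obj := Obj C \<inter> S, Arr := {f \<in> Arr C. Dom C f \<in> S \<and> Cod C f \<in> S}\<rparr>"

record ('o, 'm, 'p, 'n) functr =
  OMap :: "'o \<Rightarrow> 'p"
  AMap :: "'m \<Rightarrow> 'n"

definition is_functor ::
  "('o, 'm) category \<Rightarrow> ('p, 'n) category \<Rightarrow> ('o, 'm, 'p, 'n) functr \<Rightarrow> bool" where
  "is_functor C D F \<longleftrightarrow>
     is_category C \<and> is_category D \<and>
     (\<forall>X \<in> Obj C. OMap F X \<in> Obj D) \<and>
     (\<forall>X Y. \<forall>f \<in> Hom C X Y. AMap F f \<in> Hom D (OMap F X) (OMap F Y)) \<and>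
     (\<forall>X \<in> Obj C. AMap F (Ident C X) = Ident D (OMap F X)) \<and>
     (\<forall>X Y Z. \<forall>f \<in> Hom C X Y. \<forall>g \<in> Hom C Y Z.
        AMap F (g \<cdot>\<^bsub>C\<^esub> f) = AMap F g \<cdot>\<^bsub>D\<^esub> AMap F f)"

definition id_functor :: "('o, 'm, 'o, 'm) functr" where
  "id_functor = \<lparr>OMap = \<lambda>X. X, AMap = \<lambda>f. f\<rparr>"

definition is_nat_trans ::
  "('o, 'm) category \<Rightarrow> ('p, 'n) category \<Rightarrow> ('o, 'm, 'p, 'n) functr \<Rightarrow> ('o, 'm, 'p, 'n) functr
    \<Rightarrow> ('o \<Rightarrow> 'n) \<Rightarrow> bool" where
  "is_nat_trans C D F G \<tau> \<longleftrightarrow>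
     is_functor C D F \<and> is_functor C D G \<and>
     (\<forall>X \<in> Obj C. \<tau> X \<in> Hom D (OMap F X) (OMap G X)) \<and>
     (\<forall>X Y. \<forall>f \<in> Hom C X Y. AMap G f \<cdot>\<^bsub>D\<^esub> \<tau> X = \<tau> Y \<cdot>\<^bsub>D\<^esub> AMap F f)"

definition is_adjunction ::
  "('o, 'm) category \<Rightarrow> ('p, 'n) category \<Rightarrow> ('o, 'm, 'p, 'n) functr \<Rightarrow> ('p, 'n, 'o, 'm) functr
    \<Rightarrow> ('o \<Rightarrow> 'p \<Rightarrow> 'n \<Rightarrow> 'm) \<Rightarrow> bool" where
  "is_adjunction C D F G \<phi> \<longleftrightarrow>
     is_functor C D F \<and> is_functor D C G \<and>
     (\<forall>X \<in> Obj C. \<forall>Y \<in> Obj D. bij_betw (\<phi> X Y) (Hom D (OMap F X) Y) (Hom C X (OMap G Y))) \<and>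
     (\<forall>X X' Y Y'. \<forall>u \<in> Hom C X' X. \<forall>v \<in> Hom D Y Y'. \<forall>h \<in> Hom D (OMap F X) Y.
        \<phi> X' Y' (v \<cdot>\<^bsub>D\<^esub> h \<cdot>\<^bsub>D\<^esub> AMap F u) = AMap G v \<cdot>\<^bsub>C\<^esub> \<phi> X Y h \<cdot>\<^bsub>C\<^esub> u)"

definition is_left_adjoint ::
  "('o, 'm) category \<Rightarrow> ('p, 'n) category \<Rightarrow> ('o, 'm, 'p, 'n) functr \<Rightarrow> bool" where
  "is_left_adjoint C D F \<longleftrightarrow> (\<exists>G \<phi>. is_adjunction C D F G \<phi>)"


section \<open>Limits and colimits\<close>

definition is_cone ::
  "('p, 'n) category \<Rightarrow> ('o, 'm) category \<Rightarrow> ('p, 'n, 'o, 'm) functr \<Rightarrow> 'o \<Rightarrow> ('p \<Rightarrow> 'm) \<Rightarrow> bool" where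
  "is_cone J C D L \<pi> \<longleftrightarrow>
     L \<in> Obj C \<and>
     (\<forall>j \<in> Obj J. \<pi> j \<in> Hom C L (OMap D j)) \<and>
     (\<forall>j k. \<forall>a \<in> Hom J j k. AMap D a \<cdot>\<^bsub>C\<^esub> \<pi> j = \<pi> k)"

definition is_limit ::
  "('p, 'n) category \<Rightarrow> ('o, 'm) category \<Rightarrow> ('p, 'n, 'o, 'm) functr \<Rightarrow> 'o \<Rightarrow> ('p \<Rightarrow> 'm) \<Rightarrow> bool" where
  "is_limit J C D L \<pi> \<longleftrightarrow>
     is_cone J C D L \<pi> \<and>
     (\<forall>K \<rho>. is_cone J C D K \<rho> \<longrightarrow> (\<exists>!h. h \<in> Hom C K L \<and> (\<forall>j \<in> Obj J. \<pi> j \<cdot>\<^bsub>C\<^esub> h = \<rho> j)))"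

definition is_cocone ::
  "('p, 'n) category \<Rightarrow> ('o, 'm) category \<Rightarrow> ('p, 'n, 'o, 'm) functr \<Rightarrow> 'o \<Rightarrow> ('p \<Rightarrow> 'm) \<Rightarrow> bool" where
  "is_cocone J C D L \<iota> \<longleftrightarrow>
     L \<in> Obj C \<and>
     (\<forall>j \<in> Obj J. \<iota> j \<in> Hom C (OMap D j) L) \<and>
     (\<forall>j k. \<forall>a \<in> Hom J j k. \<iota> k \<cdot>\<^bsub>C\<^esub> AMap D a = \<iota> j)"

definition is_colimit ::
  "('p, 'n) category \<Rightarrow> ('o, 'm) category \<Rightarrow> ('p, 'n, 'o, 'm) functr \<Rightarrow> 'o \<Rightarrow> ('p \<Rightarrow> 'm) \<Rightarrow> bool" where
  "is_colimit J C D L \<iota> \<longleftrightarrow>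
     is_cocone J C D L \<iota> \<and>
     (\<forall>K \<rho>. is_cocone J C D K \<rho> \<longrightarrow> (\<exists>!h. h \<in> Hom C L K \<and> (\<forall>j \<in> Obj J. h \<cdot>\<^bsub>C\<^esub> \<iota> j = \<rho> j)))"

text \<open>Smallness is relative to a cardinal \<open>\<kappa>\<close>: an index category is small if it has fewer than
  \<open>\<kappa>\<close> arrows (hence fewer than \<open>\<kappa>\<close> objects). For an inaccessible \<open>\<kappa>\<close> this is smallness with respect
  to the Grothendieck universe of rank \<open>\<kappa>\<close>. It loses no generality to take the index categories
  inside the type carrying \<open>\<kappa>\<close>, since every category with fewer than \<open>\<kappa>\<close> arrows is isomorphic to
  one living there.\<close>

definition complete_category :: "'k rel \<Rightarrow> ('o, 'm) category \<Rightarrow> bool" where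
  "complete_category \<kappa> C \<longleftrightarrow>
     (\<forall>(J :: ('k, 'k) category) D. |Arr J| <o \<kappa> \<and> is_functor J C D \<longrightarrow> (\<exists>L \<pi>. is_limit J C D L \<pi>))"

definition cocomplete_category :: "'k rel \<Rightarrow> ('o, 'm) category \<Rightarrow> bool" where
  "cocomplete_category \<kappa> C \<longleftrightarrow>
     (\<forall>(J :: ('k, 'k) category) D. |Arr J| <o \<kappa> \<and> is_functor J C D \<longrightarrow> (\<exists>L \<iota>. is_colimit J C D L \<iota>))"

definition is_initial :: "('o, 'm) category \<Rightarrow> 'o \<Rightarrow> bool" where
  "is_initial C Z \<longleftrightarrow> Z \<in> Obj C \<and> (\<forall>X \<in> Obj C. \<exists>!f. f \<in> Hom C Z X)"

definition is_terminal :: "('o, 'm) category \<Rightarrow> 'o \<Rightarrow> bool" where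
  "is_terminal C T \<longleftrightarrow> T \<in> Obj C \<and> (\<forall>X \<in> Obj C. \<exists>!f. f \<in> Hom C X T)"

definition is_coproduct ::
  "('o, 'm) category \<Rightarrow> 'o \<Rightarrow> 'o \<Rightarrow> 'o \<Rightarrow> 'm \<Rightarrow> 'm \<Rightarrow> bool" where
  "is_coproduct C X Y S a b \<longleftrightarrow>
     a \<in> Hom C X S \<and> b \<in> Hom C Y S \<and>
     (\<forall>T. \<forall>u \<in> Hom C X T. \<forall>v \<in> Hom C Y T.
        \<exists>!h. h \<in> Hom C S T \<and> h \<cdot>\<^bsub>C\<^esub> a = u \<and> h \<cdot>\<^bsub>C\<^esub> b = v)"

text \<open>\<open>is_pushout C f g a b\<close>: the square \<open>a \<cdot> f = b \<cdot> g\<close> is a pushout of the span \<open>f, g\<close>.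
  \<open>is_pullback C f g a b\<close>: the square \<open>f \<cdot> a = g \<cdot> b\<close> is a pullback of the cospan \<open>f, g\<close>.\<close>

definition is_pushout :: "('o, 'm) category \<Rightarrow> 'm \<Rightarrow> 'm \<Rightarrow> 'm \<Rightarrow> 'm \<Rightarrow> bool" where
  "is_pushout C f g a b \<longleftrightarrow>
     (\<exists>X Y Z P. f \<in> Hom C X Y \<and> g \<in> Hom C X Z \<and> a \<in> Hom C Y P \<and> b \<in> Hom C Z P \<and>
        a \<cdot>\<^bsub>C\<^esub> f = b \<cdot>\<^bsub>C\<^esub> g \<and>
        (\<forall>T. \<forall>u \<in> Hom C Y T. \<forall>v \<in> Hom C Z T. u \<cdot>\<^bsub>C\<^esub> f = v \<cdot>\<^bsub>C\<^esub> g \<longrightarrow>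
           (\<exists>!h. h \<in> Hom C P T \<and> h \<cdot>\<^bsub>C\<^esub> a = u \<and> h \<cdot>\<^bsub>C\<^esub> b = v)))"

definition is_pullback :: "('o, 'm) category \<Rightarrow> 'm \<Rightarrow> 'm \<Rightarrow> 'm \<Rightarrow> 'm \<Rightarrow> bool" where
  "is_pullback C f g a b \<longleftrightarrow>
     (\<exists>X Y Z P. f \<in> Hom C Y X \<and> g \<in> Hom C Z X \<and> a \<in> Hom C P Y \<and> b \<in> Hom C P Z \<and>
        f \<cdot>\<^bsub>C\<^esub> a = g \<cdot>\<^bsub>C\<^esub> b \<and>
        (\<forall>T. \<forall>u \<in> Hom C T Y. \<forall>v \<in> Hom C T Z. f \<cdot>\<^bsub>C\<^esub> u = g \<cdot>\<^bsub>C\<^esub> v \<longrightarrow>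
           (\<exists>!h. h \<in> Hom C T P \<and> a \<cdot>\<^bsub>C\<^esub> h = u \<and> b \<cdot>\<^bsub>C\<^esub> h = v)))"


section \<open>Lifting, retracts, weak factorization systems\<close>

text \<open>\<open>i\<close> has the left lifting property against \<open>p\<close>.\<close>

definition lifts_against :: "('o, 'm) category \<Rightarrow> 'm \<Rightarrow> 'm \<Rightarrow> bool" where
  "lifts_against C i p \<longleftrightarrow>
     (\<forall>u \<in> Hom C (Dom C i) (Dom C p). \<forall>v \<in> Hom C (Cod C i) (Cod C p).
        p \<cdot>\<^bsub>C\<^esub> u = v \<cdot>\<^bsub>C\<^esub> i \<longrightarrow>
        (\<exists>h \<in> Hom C (Cod C i) (Dom C p). h \<cdot>\<^bsub>C\<^esub> i = u \<and> p \<cdot>\<^bsub>C\<^esub> h = v))"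

definition factors_as :: "('o, 'm) category \<Rightarrow> 'm \<Rightarrow> 'm set \<Rightarrow> 'm set \<Rightarrow> bool" where
  "factors_as C f L R \<longleftrightarrow>
     (\<exists>l \<in> L. \<exists>r \<in> R. \<exists>Z. l \<in> Hom C (Dom C f) Z \<and> r \<in> Hom C Z (Cod C f) \<and> f = r \<cdot>\<^bsub>C\<^esub> l)"

definition weak_factorization_system :: "('o, 'm) category \<Rightarrow> 'm set \<Rightarrow> 'm set \<Rightarrow> bool" where
  "weak_factorization_system C L R \<longleftrightarrow>
     L = {i \<in> Arr C. \<forall>p \<in> R. lifts_against C i p} \<and>
     R = {p \<in> Arr C. \<forall>i \<in> L. lifts_against C i p} \<and>
     (\<forall>f \<in> Arr C. factors_as C f L R)"

definition is_retract :: "('o, 'm) category \<Rightarrow> 'm \<Rightarrow> 'm \<Rightarrow> bool" where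
  "is_retract C f g \<longleftrightarrow>
     (\<exists>s \<in> Hom C (Dom C f) (Dom C g). \<exists>r \<in> Hom C (Dom C g) (Dom C f).
      \<exists>s' \<in> Hom C (Cod C f) (Cod C g). \<exists>r' \<in> Hom C (Cod C g) (Cod C f).
        r \<cdot>\<^bsub>C\<^esub> s = Ident C (Dom C f) \<and> r' \<cdot>\<^bsub>C\<^esub> s' = Ident C (Cod C f) \<and>
        g \<cdot>\<^bsub>C\<^esub> s = s' \<cdot>\<^bsub>C\<^esub> f \<and> f \<cdot>\<^bsub>C\<^esub> r = r' \<cdot>\<^bsub>C\<^esub> g)"

definition retract_closed :: "('o, 'm) category \<Rightarrow> 'm set \<Rightarrow> bool" where
  "retract_closed C K \<longleftrightarrow> (\<forall>f \<in> Arr C. \<forall>g \<in> K. is_retract C f g \<longrightarrow> f \<in> K)"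

definition two_out_of_three :: "('o, 'm) category \<Rightarrow> 'm set \<Rightarrow> bool" where
  "two_out_of_three C W \<longleftrightarrow>
     (\<forall>X Y Z. \<forall>f \<in> Hom C X Y. \<forall>g \<in> Hom C Y Z.
        (f \<in> W \<and> g \<in> W \<longrightarrow> g \<cdot>\<^bsub>C\<^esub> f \<in> W) \<and>
        (f \<in> W \<and> g \<cdot>\<^bsub>C\<^esub> f \<in> W \<longrightarrow> g \<in> W) \<and>
        (g \<in> W \<and> g \<cdot>\<^bsub>C\<^esub> f \<in> W \<longrightarrow> f \<in> W))"


section \<open>Premodel categories\<close>

text \<open>In the next four definitions \<open>K\<close> is the class of cofibrations, respectively fibrations.\<close>

definition cofibrant :: "('o, 'm) category \<Rightarrow> 'm set \<Rightarrow> 'o \<Rightarrow> bool" where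
  "cofibrant C K X \<longleftrightarrow> (\<exists>Z f. is_initial C Z \<and> f \<in> Hom C Z X \<and> f \<in> K)"

definition fibrant :: "('o, 'm) category \<Rightarrow> 'm set \<Rightarrow> 'o \<Rightarrow> bool" where
  "fibrant C K X \<longleftrightarrow> (\<exists>T f. is_terminal C T \<and> f \<in> Hom C X T \<and> f \<in> K)"

definition core_cofibs :: "('o, 'm) category \<Rightarrow> 'm set \<Rightarrow> 'm set" where
  "core_cofibs C K = {i \<in> K. cofibrant C K (Dom C i)}"

definition core_fibs :: "('o, 'm) category \<Rightarrow> 'm set \<Rightarrow> 'm set" where
  "core_fibs C K = {p \<in> K. fibrant C K (Cod C p)}"

text \<open>Cofibrations, anodyne cofibrations, fibrations and anodyne fibrations.\<close>

record 'm premodel_structure =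
  Cof :: "'m set"
  AnCof :: "'m set"
  Fib :: "'m set"
  AnFib :: "'m set"

definition premodel_category ::
  "'k rel \<Rightarrow> ('o, 'm) category \<Rightarrow> 'm premodel_structure \<Rightarrow> bool" where
  "premodel_category \<kappa> C M \<longleftrightarrow>
     is_category C \<and> complete_category \<kappa> C \<and> cocomplete_category \<kappa> C \<and>
     weak_factorization_system C (Cof M) (AnFib M) \<and>
     weak_factorization_system C (AnCof M) (Fib M) \<and>
     AnCof M \<subseteq> Cof M"

definition acyclic_cofibs :: "('o, 'm) category \<Rightarrow> 'm premodel_structure \<Rightarrow> 'm set" where
  "acyclic_cofibs C M =
     {i \<in> Cof M. \<forall>p \<in> Fib M. fibrant C (Fib M) (Dom C p) \<and> fibrant C (Fib M) (Cod C p)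
        \<longrightarrow> lifts_against C i p}"

definition acyclic_fibs :: "('o, 'm) category \<Rightarrow> 'm premodel_structure \<Rightarrow> 'm set" where
  "acyclic_fibs C M =
     {p \<in> Fib M. \<forall>i \<in> Cof M. cofibrant C (Cof M) (Dom C i) \<and> cofibrant C (Cof M) (Cod C i)
        \<longrightarrow> lifts_against C i p}"

definition left_core ::
  "('o, 'm) category \<Rightarrow> 'm premodel_structure \<Rightarrow> ('o, 'm) category \<times> 'm set \<times> 'm set" where
  "left_core C M =
     (full_subcategory C {X. cofibrant C (Cof M) X},
      core_cofibs C (Cof M),
      acyclic_cofibs C M \<inter> core_cofibs C (Cof M))"

definition right_core ::
  "('o, 'm) category \<Rightarrow> 'm premodel_structure \<Rightarrow> ('o, 'm) category \<times> 'm set \<times> 'm set" where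
  "right_core C M =
     (full_subcategory C {X. fibrant C (Fib M) X},
      core_fibs C (Fib M),
      acyclic_fibs C M \<inter> core_fibs C (Fib M))"

definition left_saturated :: "('o, 'm) category \<Rightarrow> 'm premodel_structure \<Rightarrow> bool" where
  "left_saturated C M \<longleftrightarrow> acyclic_cofibs C M \<subseteq> AnCof M"

definition core_left_saturated :: "('o, 'm) category \<Rightarrow> 'm premodel_structure \<Rightarrow> bool" where
  "core_left_saturated C M \<longleftrightarrow> acyclic_cofibs C M \<inter> core_cofibs C (Cof M) \<subseteq> AnCof M"

definition right_saturated :: "('o, 'm) category \<Rightarrow> 'm premodel_structure \<Rightarrow> bool" where
  "right_saturated C M \<longleftrightarrow> acyclic_fibs C M \<subseteq> AnFib M"

definition core_right_saturated :: "('o, 'm) category \<Rightarrow> 'm premodel_structure \<Rightarrow> bool" where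
  "core_right_saturated C M \<longleftrightarrow> acyclic_fibs C M \<inter> core_fibs C (Fib M) \<subseteq> AnFib M"


section \<open>Strong Quillen cylinders\<close>

text \<open>For \<open>\<tau> : F \<rightarrow> G\<close> and \<open>v : X \<rightarrow> Y\<close>, \<open>w\<close> is the corner-product map
  \<open>F Y +\<^bsub>F X\<^esub> G X \<rightarrow> G Y\<close>. The pushout is only determined up to isomorphism, so this is a relation,
  satisfied by the corner map out of any choice of pushout.\<close>

definition is_corner_product ::
  "('o, 'm) category \<Rightarrow> ('p, 'n) category \<Rightarrow> ('o, 'm, 'p, 'n) functr \<Rightarrow> ('o, 'm, 'p, 'n) functr
    \<Rightarrow> ('o \<Rightarrow> 'n) \<Rightarrow> 'm \<Rightarrow> 'n \<Rightarrow> bool" where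
  "is_corner_product C D F G \<tau> v w \<longleftrightarrow>
     (\<exists>X Y a b. v \<in> Hom C X Y \<and> is_pushout D (AMap F v) (\<tau> X) a b \<and>
        w \<in> Hom D (Cod D a) (OMap G Y) \<and>
        w \<cdot>\<^bsub>D\<^esub> a = \<tau> Y \<and> w \<cdot>\<^bsub>D\<^esub> b = AMap G v)"

definition cofibration_trans ::
  "('o, 'm) category \<Rightarrow> 'm premodel_structure \<Rightarrow> ('p, 'n) category \<Rightarrow> 'n premodel_structure
    \<Rightarrow> ('o, 'm, 'p, 'n) functr \<Rightarrow> ('o, 'm, 'p, 'n) functr \<Rightarrow> ('o \<Rightarrow> 'n) \<Rightarrow> bool" where
  "cofibration_trans C M D N F G \<tau> \<longleftrightarrow>
     (\<forall>v \<in> Cof M. \<forall>w. is_corner_product C D F G \<tau> v w \<longrightarrow> w \<in> Cof N) \<and>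
     (\<forall>v \<in> AnCof M. \<forall>w. is_corner_product C D F G \<tau> v w \<longrightarrow> w \<in> AnCof N)"

definition anodyne_cofibration_trans ::
  "('o, 'm) category \<Rightarrow> 'm premodel_structure \<Rightarrow> ('p, 'n) category \<Rightarrow> 'n premodel_structure
    \<Rightarrow> ('o, 'm, 'p, 'n) functr \<Rightarrow> ('o, 'm, 'p, 'n) functr \<Rightarrow> ('o \<Rightarrow> 'n) \<Rightarrow> bool" where
  "anodyne_cofibration_trans C M D N F G \<tau> \<longleftrightarrow>
     (\<forall>v \<in> Cof M. \<forall>w. is_corner_product C D F G \<tau> v w \<longrightarrow> w \<in> AnCof N)"

text \<open>\<open>S\<close> with inclusions \<open>s\<^sub>0, s\<^sub>1\<close> is a choice of the coproduct functor \<open>Id + Id\<close>; the equations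
  on \<open>p\<close> say that \<open>S \<rightarrow> I \<rightarrow> Id\<close> is the codiagonal. The functors \<open>Id\<close> and \<open>S\<close> are automatically left
  adjoints when binary products exist.\<close>

definition strong_quillen_cylinder ::
  "('o, 'm) category \<Rightarrow> 'm premodel_structure
    \<Rightarrow> ('o, 'm, 'o, 'm) functr \<Rightarrow> ('o \<Rightarrow> 'm) \<Rightarrow> ('o \<Rightarrow> 'm)
    \<Rightarrow> ('o, 'm, 'o, 'm) functr \<Rightarrow> ('o \<Rightarrow> 'm) \<Rightarrow> ('o \<Rightarrow> 'm) \<Rightarrow> bool" where
  "strong_quillen_cylinder C M S s\<^sub>0 s\<^sub>1 I i p \<longleftrightarrow>
     is_nat_trans C C id_functor S s\<^sub>0 \<and> is_nat_trans C C id_functor S s\<^sub>1 \<and>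
     (\<forall>X \<in> Obj C. is_coproduct C X X (OMap S X) (s\<^sub>0 X) (s\<^sub>1 X)) \<and>
     is_left_adjoint C C I \<and>
     is_nat_trans C C S I i \<and> is_nat_trans C C I id_functor p \<and>
     (\<forall>X \<in> Obj C. (p X \<cdot>\<^bsub>C\<^esub> i X) \<cdot>\<^bsub>C\<^esub> s\<^sub>0 X = Ident C X \<and> (p X \<cdot>\<^bsub>C\<^esub> i X) \<cdot>\<^bsub>C\<^esub> s\<^sub>1 X = Ident C X) \<and>
     cofibration_trans C M C M S I i \<and>
     anodyne_cofibration_trans C M C M id_functor I (\<lambda>X. i X \<cdot>\<^bsub>C\<^esub> s\<^sub>0 X)"


section \<open>Spitzweck semi-model categories\<close>

definition left_semi_model_category ::
  "'k rel \<Rightarrow> ('o, 'm) category \<Rightarrow> 'm set \<Rightarrow> 'm set \<Rightarrow> 'm set \<Rightarrow> bool" where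
  "left_semi_model_category \<kappa> C We Co Fi \<longleftrightarrow>
     is_category C \<and> complete_category \<kappa> C \<and> cocomplete_category \<kappa> C \<and>
     We \<subseteq> Arr C \<and> Co \<subseteq> Arr C \<and> Fi \<subseteq> Arr C \<and>
     two_out_of_three C We \<and>
     retract_closed C We \<and> retract_closed C Co \<and> retract_closed C Fi \<and>
     (\<forall>f \<in> Arr C. cofibrant C Co (Dom C f) \<longrightarrow>
        factors_as C f Co (Fi \<inter> We) \<and> factors_as C f (Co \<inter> We) Fi) \<and>
     (\<forall>i \<in> core_cofibs C Co. \<forall>p \<in> Fi. i \<in> We \<or> p \<in> We \<longrightarrow> lifts_against C i p) \<and>
     (\<forall>p g a b. p \<in> Fi \<and> is_pullback C p g a b \<longrightarrow> b \<in> Fi) \<and>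
     (\<forall>Z. is_initial C Z \<longrightarrow> cofibrant C Co Z) \<and>
     weak_factorization_system C Co (Fi \<inter> We)"

definition right_semi_model_category ::
  "'k rel \<Rightarrow> ('o, 'm) category \<Rightarrow> 'm set \<Rightarrow> 'm set \<Rightarrow> 'm set \<Rightarrow> bool" where
  "right_semi_model_category \<kappa> C We Co Fi \<longleftrightarrow>
     is_category C \<and> complete_category \<kappa> C \<and> cocomplete_category \<kappa> C \<and>
     We \<subseteq> Arr C \<and> Co \<subseteq> Arr C \<and> Fi \<subseteq> Arr C \<and>
     two_out_of_three C We \<and>
     retract_closed C We \<and> retract_closed C Co \<and> retract_closed C Fi \<and>
     (\<forall>f \<in> Arr C. fibrant C Fi (Cod C f) \<longrightarrow>
        factors_as C f (Co \<inter> We) Fi \<and> factors_as C f Co (Fi \<inter> We)) \<and>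
     (\<forall>i \<in> Co. \<forall>p \<in> core_fibs C Fi. i \<in> We \<or> p \<in> We \<longrightarrow> lifts_against C i p) \<and>
     (\<forall>i g a b. i \<in> Co \<and> is_pushout C i g a b \<longrightarrow> b \<in> Co) \<and>
     (\<forall>T. is_terminal C T \<longrightarrow> fibrant C Fi T) \<and>
     weak_factorization_system C (Co \<inter> We) Fi"

end

theory Submission
  imports Defs
begin

text \<open>A homotopy between maps \<open>X \<rightarrow> Z\<close> is a map \<open>I X \<rightarrow> Z\<close> on the cylinder. The corner conditions
  on the cylinder concern \<open>M\<close>, but the homotopies that matter have a cofibrant source, and for
  these the relevant corner maps are cofibrations of \<open>M\<close> with cofibrant domain. Hence they are
  cofibrations of \<open>N\<close> too; when they are anodyne in \<open>M\<close> they lie in the acyclic part of the common left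
  core, and core left saturation makes them anodyne in \<open>N\<close>
  (\<open>end_lifts_core\<close>). So homotopies starting from cofibrant objects extend along core cofibrations and
  lift along the fibrations of \<open>N\<close>, and on maps from a cofibrant to a fibrant object of
  \<open>N\<close> homotopy is an equivalence relation (\<open>homotopic_box\<close>).

  A map \<open>X \<rightarrow> Y\<close> of cofibrant objects is called a homotopy equivalence if it induces a bijection of
  homotopy classes of maps into every fibrant object of \<open>N\<close>, and an arbitrary map is a weak
  equivalence if some, equivalently every, map covering it between cofibrant resolutions is a
  homotopy equivalence. With this definition two-out-of-three and closure under retracts are formal.
  Two comparisons carry the rest.

  \<^item> A core cofibration of \<open>N\<close> is anodyne if and only if it is a homotopy equivalence
    (\<open>core_anodyne_hequiv\<close>, \<open>hequiv_anodyne\<close>). For the implication from right to left, fibrant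
    replacement reduces the claim to a cofibration between objects that are both cofibrant and
    fibrant. There Dold's argument exhibits the source as a strong deformation retract of the
    target (\<open>hequiv_fibrant_anodyne\<close>), and such an inclusion lifts against all fibrations.
    Composing with the fibrant replacement only shows that the original map is
    acyclic, and core left saturation then makes it anodyne.

  \<^item> A fibration of \<open>N\<close> is anodyne if and only if it is a weak equivalence (\<open>fib_weq_eq\<close>). A fibration
    \<open>f\<close> that is a weak equivalence lifts against core cofibrations: for a cofibrant replacement
    \<open>q\<close> of its source, \<open>f \<cdot> q\<close> factors as a core cofibration followed by an anodyne fibration; by
    two-out-of-three and the first comparison this cofibration is anodyne, so it lifts against \<open>f\<close>,
    and lifting problems for \<open>f\<close> reduce to lifting problems for the anodyne fibration. Hence \<open>f\<close> is an
    acyclic fibration, and right saturation makes it anodyne.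

  The statement about right semi-model categories is the one about left semi-model categories in the
  opposite category. The cylinder there is the right adjoint \<open>G\<close> of \<open>I\<close>, a functorial path object.
  To make this duality immediate, the corner conditions are restated as filling properties of maps
  out of \<open>I B\<close> (\<open>end_lifts\<close>); adjunction turns such fillers into maps into \<open>G X\<close>, and the
  conditions for \<open>G\<close> are literally those for \<open>I\<close> (\<open>quillen_cylinder_opposite\<close>).\<close>

section \<open>Arrows, opposites and lifting\<close>

locale ccat =
  fixes C :: "('o, 'm) category" (structure)
  assumes cat: "is_category C"
begin

lemma HomD [dest]: "f \<in> Hom C X Y \<Longrightarrow> f \<in> Arr C"
  by (simp add: Hom_def)

lemma dom_obj [simp]: "f \<in> Arr C \<Longrightarrow> Dom C f \<in> Obj C"
  using cat by (simp add: is_category_def)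

lemma cod_obj [simp]: "f \<in> Arr C \<Longrightarrow> Cod C f \<in> Obj C"
  using cat by (simp add: is_category_def)

lemma ident_hom: "X \<in> Obj C \<Longrightarrow> Ident C X \<in> Hom C X X"
  using cat by (simp add: is_category_def)

lemma ident_simps [simp]:
  assumes "X \<in> Obj C"
  shows "Ident C X \<in> Arr C" "Dom C (Ident C X) = X" "Cod C (Ident C X) = X"
  using ident_hom[OF assms] by (auto simp: Hom_def)

lemma comp_hom [intro]: "f \<in> Hom C X Y \<Longrightarrow> g \<in> Hom C Y Z \<Longrightarrow> g \<cdot> f \<in> Hom C X Z"
  using cat by (simp add: is_category_def)

lemma comp_simps [simp]:
  assumes "f \<in> Arr C" "g \<in> Arr C" "Cod C f = Dom C g"
  shows "g \<cdot> f \<in> Arr C" "Dom C (g \<cdot> f) = Dom C f" "Cod C (g \<cdot> f) = Cod C g"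
  using comp_hom[of f "Dom C f" "Cod C f" g "Cod C g"] assms by (auto simp: Hom_def)

lemma ident_right [simp]: "f \<in> Arr C \<Longrightarrow> Dom C f = X \<Longrightarrow> f \<cdot> Ident C X = f"
  using cat unfolding is_category_def Hom_def by blast

lemma ident_left [simp]: "f \<in> Arr C \<Longrightarrow> Cod C f = Y \<Longrightarrow> Ident C Y \<cdot> f = f"
  using cat unfolding is_category_def Hom_def by blast

lemma assoc:
  assumes "f \<in> Arr C" "g \<in> Arr C" "h \<in> Arr C" "Cod C f = Dom C g" "Cod C g = Dom C h"
  shows "(h \<cdot> g) \<cdot> f = h \<cdot> (g \<cdot> f)"
proof -
  have "f \<in> Hom C (Dom C f) (Cod C f)" "g \<in> Hom C (Cod C f) (Cod C g)"
    "h \<in> Hom C (Cod C g) (Cod C h)"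
    using assms by (auto simp: Hom_def)
  then show ?thesis
    using cat unfolding is_category_def by blast
qed

text \<open>The form in which an equation between composites has to be supplied to the simplifier once
  composites are associated to the right.\<close>

lemma extend:
  assumes "a \<cdot> b = c" "a \<in> Arr C" "b \<in> Arr C" "Cod C b = Dom C a" "x \<in> Arr C" "Cod C x = Dom C b"
  shows "a \<cdot> (b \<cdot> x) = c \<cdot> x"
  using assoc[of x b a] assms by simp

lemma liftsE:
  assumes "lifts_against C i p" "i \<in> Hom C A B" "p \<in> Hom C X Y" "u \<in> Hom C A X" "v \<in> Hom C B Y"
    "p \<cdot> u = v \<cdot> i"
  obtains h where "h \<in> Hom C B X" "h \<cdot> i = u" "p \<cdot> h = v"
proof -
  have "u \<in> Hom C (Dom C i) (Dom C p)" "v \<in> Hom C (Cod C i) (Cod C p)"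
    "Cod C i = B" "Dom C p = X"
    using assms by (auto simp: Hom_def)
  then show ?thesis
    using assms(1,6) that unfolding lifts_against_def by blast
qed

lemma liftsI:
  assumes "i \<in> Hom C A B" "p \<in> Hom C X Y"
    and "\<And>u v. u \<in> Hom C A X \<Longrightarrow> v \<in> Hom C B Y \<Longrightarrow> p \<cdot> u = v \<cdot> i \<Longrightarrow>
           \<exists>h \<in> Hom C B X. h \<cdot> i = u \<and> p \<cdot> h = v"
  shows "lifts_against C i p"
proof -
  have "Dom C i = A" "Cod C i = B" "Dom C p = X" "Cod C p = Y"
    using assms by (auto simp: Hom_def)
  then show ?thesis
    using assms(3) unfolding lifts_against_def by simp
qed

lemma hom_objs: "f \<in> Hom C X Y \<Longrightarrow> X \<in> Obj C \<and> Y \<in> Obj C"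
  by (auto simp: Hom_def)

lemma initial_unique:
  "is_initial C Z \<Longrightarrow> f \<in> Hom C Z X \<Longrightarrow> g \<in> Hom C Z X \<Longrightarrow> f = g"
  using hom_objs[of f Z X] unfolding is_initial_def by blast

lemma terminal_unique:
  "is_terminal C Z \<Longrightarrow> f \<in> Hom C X Z \<Longrightarrow> g \<in> Hom C X Z \<Longrightarrow> f = g"
  using hom_objs[of f X Z] unfolding is_terminal_def by blast

end

definition opposite :: "('o, 'm) category \<Rightarrow> ('o, 'm) category" where
  "opposite C = \<lparr>Obj = Obj C, Arr = Arr C, Dom = Cod C, Cod = Dom C, Ident = Ident C,
                 Comp = (\<lambda>g f. f \<cdot>\<^bsub>C\<^esub> g)\<rparr>"

lemma opposite_simps [simp]:
  "Obj (opposite C) = Obj C" "Arr (opposite C) = Arr C" "Dom (opposite C) = Cod C"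
  "Cod (opposite C) = Dom C" "Ident (opposite C) = Ident C"
  "g \<cdot>\<^bsub>opposite C\<^esub> f = f \<cdot>\<^bsub>C\<^esub> g" "opposite (opposite C) = C"
  by (simp_all add: opposite_def)

lemma Hom_opposite [simp]: "Hom (opposite C) X Y = Hom C Y X"
  by (auto simp: Hom_def)

lemma is_category_opposite: "is_category C \<Longrightarrow> is_category (opposite C)"
proof -
  assume c: "is_category C"
  interpret ccat C by unfold_locales (rule c)
  show "is_category (opposite C)"
    unfolding is_category_def by (auto simp: Hom_def assoc)
qed

lemma is_functor_opposite:
  "is_functor C D F \<Longrightarrow> is_functor (opposite C) (opposite D) F"
  unfolding is_functor_def by (auto simp: is_category_opposite)

lemma is_initial_opposite [simp]: "is_initial (opposite C) X \<longleftrightarrow> is_terminal C X"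
  by (simp add: is_initial_def is_terminal_def)

lemma is_terminal_opposite [simp]: "is_terminal (opposite C) X \<longleftrightarrow> is_initial C X"
  by (simp add: is_initial_def is_terminal_def)

lemma lifts_against_opposite [simp]:
  "lifts_against (opposite C) i p \<longleftrightarrow> lifts_against C p i"
  unfolding lifts_against_def by (auto; metis)

lemma factors_as_opposite [simp]: "factors_as (opposite C) f L R \<longleftrightarrow> factors_as C f R L"
  unfolding factors_as_def by auto

lemma weak_factorization_system_opposite [simp]:
  "weak_factorization_system (opposite C) L R \<longleftrightarrow> weak_factorization_system C R L"
  unfolding weak_factorization_system_def by auto

lemma is_retract_oppositeI: "is_retract C f g \<Longrightarrow> is_retract (opposite C) f g"
proof -
  assume "is_retract C f g"
  then obtain s r s' r' where
    "s \<in> Hom C (Dom C f) (Dom C g)" "r \<in> Hom C (Dom C g) (Dom C f)"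
    "s' \<in> Hom C (Cod C f) (Cod C g)" "r' \<in> Hom C (Cod C g) (Cod C f)"
    "r \<cdot>\<^bsub>C\<^esub> s = Ident C (Dom C f)" "r' \<cdot>\<^bsub>C\<^esub> s' = Ident C (Cod C f)"
    "g \<cdot>\<^bsub>C\<^esub> s = s' \<cdot>\<^bsub>C\<^esub> f" "f \<cdot>\<^bsub>C\<^esub> r = r' \<cdot>\<^bsub>C\<^esub> g"
    unfolding is_retract_def by auto
  then show ?thesis
    unfolding is_retract_def
    by (intro bexI[of _ r'] bexI[of _ s'] bexI[of _ r] bexI[of _ s]) simp_all
qed

lemma is_retract_opposite: "is_retract (opposite C) f g \<longleftrightarrow> is_retract C f g"
  using is_retract_oppositeI[of C] is_retract_oppositeI[of "opposite C"] by auto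

lemma retract_closed_opposite [simp]: "retract_closed (opposite C) K \<longleftrightarrow> retract_closed C K"
  by (simp add: retract_closed_def is_retract_opposite)

lemma two_out_of_three_oppositeI:
  assumes "two_out_of_three C W" shows "two_out_of_three (opposite C) W"
  unfolding two_out_of_three_def opposite_simps Hom_opposite
proof (intro allI ballI)
  fix X Y Z f g assume fg: "f \<in> Hom C Y X" "g \<in> Hom C Z Y"
  show "(f \<in> W \<and> g \<in> W \<longrightarrow> f \<cdot>\<^bsub>C\<^esub> g \<in> W) \<and> (f \<in> W \<and> f \<cdot>\<^bsub>C\<^esub> g \<in> W \<longrightarrow> g \<in> W) \<and>
      (g \<in> W \<and> f \<cdot>\<^bsub>C\<^esub> g \<in> W \<longrightarrow> f \<in> W)"
    using assms[unfolded two_out_of_three_def, THEN spec[of _ Z], THEN spec[of _ Y],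
        THEN spec[of _ X], THEN bspec, OF fg(2), THEN bspec, OF fg(1)] by satx
qed

lemma two_out_of_three_opposite [simp]: "two_out_of_three (opposite C) W \<longleftrightarrow> two_out_of_three C W"
  using two_out_of_three_oppositeI[of C W] two_out_of_three_oppositeI[of "opposite C" W]
  unfolding opposite_simps by satx

lemma cofibrant_opposite [simp]: "cofibrant (opposite C) K X \<longleftrightarrow> fibrant C K X"
  by (simp add: cofibrant_def fibrant_def)

lemma fibrant_opposite [simp]: "fibrant (opposite C) K X \<longleftrightarrow> cofibrant C K X"
  by (simp add: cofibrant_def fibrant_def)

lemma core_cofibs_opposite [simp]: "core_cofibs (opposite C) K = core_fibs C K"
  by (simp add: core_cofibs_def core_fibs_def)

lemma is_pushout_opposite [simp]: "is_pushout (opposite C) f g a b \<longleftrightarrow> is_pullback C f g a b"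
  by (simp add: is_pushout_def is_pullback_def)

lemma is_pullback_opposite [simp]: "is_pullback (opposite C) f g a b \<longleftrightarrow> is_pushout C f g a b"
  by (simp add: is_pushout_def is_pullback_def)

lemma is_cocone_opposite [simp]: "is_cocone (opposite J) (opposite C) D L k \<longleftrightarrow> is_cone J C D L k"
  by (auto simp: is_cocone_def is_cone_def)

lemma is_cone_opposite [simp]: "is_cone (opposite J) (opposite C) D L k \<longleftrightarrow> is_cocone J C D L k"
  by (auto simp: is_cocone_def is_cone_def)

lemma is_colimit_opposite: "is_colimit (opposite J) (opposite C) D L k \<longleftrightarrow> is_limit J C D L k"
  by (simp add: is_colimit_def is_limit_def)

lemma is_limit_opposite: "is_limit (opposite J) (opposite C) D L k \<longleftrightarrow> is_colimit J C D L k"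
  by (simp add: is_colimit_def is_limit_def)

lemma cocomplete_opposite:
  fixes \<kappa> :: "'k rel"
  assumes "complete_category \<kappa> C" shows "cocomplete_category \<kappa> (opposite C)"
  unfolding cocomplete_category_def
proof (intro allI impI)
  fix J :: "('k, 'k) category" and D
  assume "|Arr J| <o \<kappa> \<and> is_functor J (opposite C) D"
  then have "|Arr (opposite J)| <o \<kappa> \<and> is_functor (opposite J) C D"
    using is_functor_opposite[of J "opposite C" D] by simp
  then obtain L k where "is_limit (opposite J) C D L k"
    using assms unfolding complete_category_def by blast
  then show "\<exists>L k. is_colimit J (opposite C) D L k"
    using is_limit_opposite[of J "opposite C"] by auto
qed

lemma complete_opposite:
  fixes \<kappa> :: "'k rel"
  assumes "cocomplete_category \<kappa> C" shows "complete_category \<kappa> (opposite C)"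
  unfolding complete_category_def
proof (intro allI impI)
  fix J :: "('k, 'k) category" and D
  assume "|Arr J| <o \<kappa> \<and> is_functor J (opposite C) D"
  then have "|Arr (opposite J)| <o \<kappa> \<and> is_functor (opposite J) C D"
    using is_functor_opposite[of J "opposite C" D] by simp
  then obtain L k where "is_colimit (opposite J) C D L k"
    using assms unfolding cocomplete_category_def by blast
  then show "\<exists>L k. is_limit J (opposite C) D L k"
    using is_colimit_opposite[of J "opposite C"] by auto
qed

definition opposite_structure :: "'m premodel_structure \<Rightarrow> 'm premodel_structure" where
  "opposite_structure M = \<lparr>Cof = Fib M, AnCof = AnFib M, Fib = Cof M, AnFib = AnCof M\<rparr>"

lemma opposite_structure_simps [simp]:
  "Cof (opposite_structure M) = Fib M" "AnCof (opposite_structure M) = AnFib M"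
  "Fib (opposite_structure M) = Cof M" "AnFib (opposite_structure M) = AnCof M"
  by (simp_all add: opposite_structure_def)

lemma anodyne_fibs_subset:
  assumes "weak_factorization_system C K AF" "weak_factorization_system C AK F" "AK \<subseteq> K"
  shows "AF \<subseteq> F"
  using assms unfolding weak_factorization_system_def by blast

lemma premodel_opposite:
  assumes "premodel_category \<kappa> C M" shows "premodel_category \<kappa> (opposite C) (opposite_structure M)"
  using assms anodyne_fibs_subset[of C "Cof M" "AnFib M" "AnCof M" "Fib M"]
  by (simp add: premodel_category_def is_category_opposite cocomplete_opposite complete_opposite)

lemma acyclic_cofibs_opposite [simp]:
  "acyclic_cofibs (opposite C) (opposite_structure M) = acyclic_fibs C M"
  by (auto simp: acyclic_cofibs_def acyclic_fibs_def)

lemma acyclic_fibs_opposite [simp]: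
  "acyclic_fibs (opposite C) (opposite_structure M) = acyclic_cofibs C M"
  by (auto simp: acyclic_cofibs_def acyclic_fibs_def)

lemma right_semi_model_opposite:
  assumes "left_semi_model_category \<kappa> (opposite C) W Fi Co"
  shows "right_semi_model_category \<kappa> C W Co Fi"
proof -
  note l = assms[unfolded left_semi_model_category_def opposite_simps two_out_of_three_opposite
      retract_closed_opposite cofibrant_opposite factors_as_opposite core_cofibs_opposite
      lifts_against_opposite is_pullback_opposite is_initial_opposite
      weak_factorization_system_opposite]
  have "is_category C" "complete_category \<kappa> C" "cocomplete_category \<kappa> C"
    using is_category_opposite[of "opposite C"] complete_opposite[of \<kappa> "opposite C"]
      cocomplete_opposite[of \<kappa> "opposite C"] l by simp_all
  moreover have "\<forall>i \<in> Co. \<forall>p \<in> core_fibs C Fi. i \<in> W \<or> p \<in> W \<longrightarrow> lifts_against C i p"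
    using l by blast
  ultimately show ?thesis
    unfolding right_semi_model_category_def using l by (intro conjI) (elim conjE; assumption)+
qed

section \<open>Closure properties of weak factorization systems\<close>

context ccat
begin

lemma ccat_opposite: "ccat (opposite C)"
  by unfold_locales (rule is_category_opposite[OF cat])

lemma pushout_homs:
  assumes "is_pushout C f g a b"
  shows "f \<in> Hom C (Dom C f) (Cod C f)" "g \<in> Hom C (Dom C f) (Cod C g)"
    "a \<in> Hom C (Cod C f) (Cod C a)" "b \<in> Hom C (Cod C g) (Cod C a)" "a \<cdot> f = b \<cdot> g"
  using assms unfolding is_pushout_def by (elim exE conjE; simp add: Hom_def)+

lemma pushout_univ:
  assumes "is_pushout C f g a b" "u \<in> Hom C (Cod C f) T" "v \<in> Hom C (Cod C g) T" "u \<cdot> f = v \<cdot> g"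
  shows "\<exists>!h. h \<in> Hom C (Cod C a) T \<and> h \<cdot> a = u \<and> h \<cdot> b = v"
proof -
  from assms(1) obtain X' Y' Z' P where h: "f \<in> Hom C X' Y'" "g \<in> Hom C X' Z'"
    "a \<in> Hom C Y' P" "b \<in> Hom C Z' P" "a \<cdot> f = b \<cdot> g"
    and univ: "\<forall>T. \<forall>u \<in> Hom C Y' T. \<forall>v \<in> Hom C Z' T. u \<cdot> f = v \<cdot> g \<longrightarrow>
           (\<exists>!h. h \<in> Hom C P T \<and> h \<cdot> a = u \<and> h \<cdot> b = v)"
    unfolding is_pushout_def by (elim exE conjE)
  have o: "Cod C f = Y'" "Cod C g = Z'" "Cod C a = P"
    using h(1-3) by (simp_all add: Hom_def)
  show ?thesis
    using univ[THEN spec, THEN bspec, THEN bspec, THEN mp] assms(2-4) unfolding o .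
qed

lemma pushout_ex:
  assumes "is_pushout C f g a b" "u \<in> Hom C (Cod C f) T" "v \<in> Hom C (Cod C g) T" "u \<cdot> f = v \<cdot> g"
  obtains h where "h \<in> Hom C (Cod C a) T" "h \<cdot> a = u" "h \<cdot> b = v"
  using pushout_univ[OF assms] by (elim ex1E conjE)

lemma pushout_eq:
  assumes po: "is_pushout C f g a b" and h: "h \<in> Hom C (Cod C a) T" and k: "k \<in> Hom C (Cod C a) T"
    and e: "h \<cdot> a = k \<cdot> a" "h \<cdot> b = k \<cdot> b"
  shows "h = k"
proof -
  note t = pushout_homs[OF po]
  have "(h \<cdot> a) \<cdot> f = (h \<cdot> b) \<cdot> g"
    using t h by (simp add: Hom_def assoc)
  from pushout_univ[OF po comp_hom[OF t(3) h] comp_hom[OF t(4) h] this]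
  show ?thesis
    by (rule ex1E) (use h k e in metis)
qed

context
  fixes L R
  assumes wfs: "weak_factorization_system C L R"
begin

lemmas wfs_eqs = conjunct1[OF wfs[unfolded weak_factorization_system_def]]
  conjunct1[OF conjunct2[OF wfs[unfolded weak_factorization_system_def]]]

lemma wfs_arr: "f \<in> L \<Longrightarrow> f \<in> Arr C" "f \<in> R \<Longrightarrow> f \<in> Arr C"
  by (drule subsetD[OF equalityD1[OF wfs_eqs(1)]], blast)
    (drule subsetD[OF equalityD1[OF wfs_eqs(2)]], blast)

lemma wfs_lifts: "i \<in> L \<Longrightarrow> p \<in> R \<Longrightarrow> lifts_against C i p"
  by (drule subsetD[OF equalityD1[OF wfs_eqs(1)]]) blast

lemma wfs_leftI: "i \<in> Arr C \<Longrightarrow> (\<And>p. p \<in> R \<Longrightarrow> lifts_against C i p) \<Longrightarrow> i \<in> L"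
  by (rule subsetD[OF equalityD2[OF wfs_eqs(1)]]) blast

lemma wfs_factor:
  assumes "f \<in> Hom C X Y"
  obtains l r Z where "l \<in> L" "r \<in> R" "l \<in> Hom C X Z" "r \<in> Hom C Z Y" "f = r \<cdot> l"
proof -
  have f: "f \<in> Arr C" "Dom C f = X" "Cod C f = Y"
    using assms by (auto simp: Hom_def)
  have "\<forall>f \<in> Arr C. factors_as C f L R"
    using wfs unfolding weak_factorization_system_def by (elim conjE)
  with f(1) have "factors_as C f L R" by (rule bspec[rotated])
  then show ?thesis
    using that unfolding factors_as_def f by blast
qed

lemma wfs_ident:
  assumes X: "X \<in> Obj C"
  shows "Ident C X \<in> L"
proof (rule wfs_leftI)
  fix p assume "p \<in> R"
  then have p: "p \<in> Hom C (Dom C p) (Cod C p)"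
    using wfs_arr(2) by (simp add: Hom_def)
  show "lifts_against C (Ident C X) p"
  proof (rule liftsI[OF ident_hom[OF X] p])
    fix u v assume "u \<in> Hom C X (Dom C p)" "v \<in> Hom C X (Cod C p)" "p \<cdot> u = v \<cdot> Ident C X"
    then show "\<exists>h\<in>Hom C X (Dom C p). h \<cdot> Ident C X = u \<and> p \<cdot> h = v"
      by (intro bexI[of _ u]) (auto simp: Hom_def)
  qed
qed (use X in simp)

lemma wfs_comp:
  assumes "f \<in> L" "g \<in> L" "f \<in> Hom C X Y" "g \<in> Hom C Y Z"
  shows "g \<cdot> f \<in> L"
proof (rule wfs_leftI)
  fix p assume p: "p \<in> R"
  then have ph: "p \<in> Hom C (Dom C p) (Cod C p)"
    using wfs_arr(2) by (simp add: Hom_def)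
  show "lifts_against C (g \<cdot> f) p"
  proof (rule liftsI[OF comp_hom[OF assms(3,4)] ph])
    fix u v assume u: "u \<in> Hom C X (Dom C p)" and v: "v \<in> Hom C Z (Cod C p)"
      and e: "p \<cdot> u = v \<cdot> (g \<cdot> f)"
    then have "p \<cdot> u = (v \<cdot> g) \<cdot> f"
      using assms by (simp add: Hom_def assoc)
    from liftsE[OF wfs_lifts[OF assms(1) p] assms(3) ph u comp_hom[OF assms(4) v] this]
    obtain h where h: "h \<in> Hom C Y (Dom C p)" "h \<cdot> f = u" "p \<cdot> h = v \<cdot> g" .
    from liftsE[OF wfs_lifts[OF assms(2) p] assms(4) ph h(1) v h(3)]
    obtain k where k: "k \<in> Hom C Z (Dom C p)" "k \<cdot> g = h" "p \<cdot> k = v" .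
    have "k \<cdot> (g \<cdot> f) = u"
      using k h(2) assms by (auto simp: Hom_def simp flip: assoc)
    with k show "\<exists>h\<in>Hom C Z (Dom C p). h \<cdot> (g \<cdot> f) = u \<and> p \<cdot> h = v"
      by blast
  qed
qed (use assms in \<open>auto simp: Hom_def\<close>)

lemma wfs_pushout:
  assumes "f \<in> L" and po: "is_pushout C f g a b"
  shows "b \<in> L"
proof (rule wfs_leftI)
  note t = pushout_homs[OF po]
  show "b \<in> Arr C" using t(4) by (rule HomD)
  fix p assume p: "p \<in> R"
  then have ph: "p \<in> Hom C (Dom C p) (Cod C p)"
    using wfs_arr(2) by (simp add: Hom_def)
  show "lifts_against C b p"
  proof (rule liftsI[OF t(4) ph])
    fix u v assume u: "u \<in> Hom C (Cod C g) (Dom C p)" and v: "v \<in> Hom C (Cod C a) (Cod C p)"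
      and e: "p \<cdot> u = v \<cdot> b"
    have "p \<cdot> (u \<cdot> g) = (v \<cdot> a) \<cdot> f"
      using u v ph t extend[OF e] by (simp add: Hom_def assoc)
    from liftsE[OF wfs_lifts[OF assms(1) p] t(1) ph comp_hom[OF t(2) u] comp_hom[OF t(3) v] this]
    obtain k where k: "k \<in> Hom C (Cod C f) (Dom C p)" "k \<cdot> f = u \<cdot> g" "p \<cdot> k = v \<cdot> a" .
    from pushout_ex[OF po k(1) u k(2)] obtain m where
      m: "m \<in> Hom C (Cod C a) (Dom C p)" "m \<cdot> a = k" "m \<cdot> b = u" .
    have "(p \<cdot> m) \<cdot> a = v \<cdot> a" "(p \<cdot> m) \<cdot> b = v \<cdot> b"
      using m k u v ph t e by (simp_all add: Hom_def assoc)
    with pushout_eq[OF po comp_hom[OF m(1) ph] v] have "p \<cdot> m = v" .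
    with m show "\<exists>h\<in>Hom C (Cod C a) (Dom C p). h \<cdot> b = u \<and> p \<cdot> h = v"
      by blast
  qed
qed

lemma wfs_retract: "retract_closed C L"
  unfolding retract_closed_def
proof (intro ballI impI)
  fix f g assume f: "f \<in> Arr C" and g: "g \<in> L" and r: "is_retract C f g"
  then have g': "g \<in> Arr C" using wfs_arr by blast
  from r obtain s r s' r' where
    h: "s \<in> Hom C (Dom C f) (Dom C g)" "r \<in> Hom C (Dom C g) (Dom C f)"
      "s' \<in> Hom C (Cod C f) (Cod C g)" "r' \<in> Hom C (Cod C g) (Cod C f)"
      and eq: "r \<cdot> s = Ident C (Dom C f)" "r' \<cdot> s' = Ident C (Cod C f)"
        "g \<cdot> s = s' \<cdot> f" "f \<cdot> r = r' \<cdot> g"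
    unfolding is_retract_def by auto
  show "f \<in> L"
  proof (rule wfs_leftI[OF f])
    fix p assume p: "p \<in> R"
    then have ph: "p \<in> Hom C (Dom C p) (Cod C p)"
      using wfs_arr(2) by (simp add: Hom_def)
    show "lifts_against C f p"
    proof (rule liftsI[of _ "Dom C f" "Cod C f", OF _ ph])
      show "f \<in> Hom C (Dom C f) (Cod C f)" using f by (simp add: Hom_def)
      fix u v assume u: "u \<in> Hom C (Dom C f) (Dom C p)" and v: "v \<in> Hom C (Cod C f) (Cod C p)"
        and e: "p \<cdot> u = v \<cdot> f"
      have gh: "g \<in> Hom C (Dom C g) (Cod C g)" using g' by (simp add: Hom_def)
      have "p \<cdot> (u \<cdot> r) = (v \<cdot> r') \<cdot> g"
        using u v ph h f g' eq(4) extend[OF e] by (simp add: Hom_def assoc)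
      from liftsE[OF wfs_lifts[OF g p] gh ph comp_hom[OF h(2) u] comp_hom[OF h(4) v] this]
      obtain k where k: "k \<in> Hom C (Cod C g) (Dom C p)" "k \<cdot> g = u \<cdot> r" "p \<cdot> k = v \<cdot> r'" .
      have "(k \<cdot> s') \<cdot> f = u"
        using u k(1) h f g' eq(1) extend[OF k(2)] by (simp add: Hom_def assoc flip: eq(3))
      moreover have "p \<cdot> (k \<cdot> s') = v"
        using v k(1) h f g' ph eq(2) extend[OF k(3)] by (simp add: Hom_def assoc)
      ultimately show "\<exists>h\<in>Hom C (Cod C f) (Dom C p). h \<cdot> f = u \<and> p \<cdot> h = v"
        using comp_hom[OF h(3) k(1)] by blast
    qed
  qed
qed

end

lemma wfs_right:
  assumes "weak_factorization_system C L R"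
  shows wfs_right_ident: "X \<in> Obj C \<Longrightarrow> Ident C X \<in> R"
    and wfs_right_comp: "f \<in> R \<Longrightarrow> g \<in> R \<Longrightarrow> f \<in> Hom C X Y \<Longrightarrow> g \<in> Hom C Y Z \<Longrightarrow> g \<cdot> f \<in> R"
    and wfs_right_pullback: "q \<in> R \<Longrightarrow> is_pullback C q g a b \<Longrightarrow> b \<in> R"
    and wfs_right_retract: "retract_closed C R"
proof -
  interpret op: ccat "opposite C" by (rule ccat_opposite)
  have w: "weak_factorization_system (opposite C) R L" using assms by simp
  show "X \<in> Obj C \<Longrightarrow> Ident C X \<in> R" using op.wfs_ident[OF w] by simp
  show "f \<in> R \<Longrightarrow> g \<in> R \<Longrightarrow> f \<in> Hom C X Y \<Longrightarrow> g \<in> Hom C Y Z \<Longrightarrow> g \<cdot> f \<in> R"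
    using op.wfs_comp[OF w, of g f] by simp
  show "q \<in> R \<Longrightarrow> is_pullback C q g a b \<Longrightarrow> b \<in> R"
    using op.wfs_pushout[OF w, of q g a b] by simp
  show "retract_closed C R" using op.wfs_retract[OF w] by simp
qed

end

section \<open>Finite colimits from cocompleteness\<close>

lemma cocomplete_initial:
  fixes \<kappa> :: "'k rel" and C :: "('o, 'm) category"
  assumes "Cinfinite \<kappa>" "is_category C" "cocomplete_category \<kappa> C"
  shows "\<exists>Z. is_initial C Z"
proof -
  define J :: "('k, 'k) category" where
    "J = \<lparr>Obj = {}, Arr = {}, Dom = id, Cod = id, Ident = id, Comp = (\<lambda>g f. f)\<rparr>"
  define D :: "('k, 'k, 'o, 'm) functr" where "D = \<lparr>OMap = undefined, AMap = undefined\<rparr>"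
  have J: "Obj J = {}" "Arr J = {}" "\<And>X Y. Hom J X Y = {}"
    by (auto simp: J_def Hom_def)
  have "|Arr J| <o \<kappa>"
    unfolding J using assms(1)
    by (intro finite_ordLess_infinite) (auto simp: cinfinite_def card_of_well_order_on card_order_on_well_order_on Field_card_of)
  moreover have "is_functor J C D"
    using assms(2) by (auto simp: is_functor_def is_category_def J)
  ultimately obtain L k where "is_colimit J C D L k"
    using assms(3) unfolding cocomplete_category_def by blast
  then show ?thesis
    unfolding is_colimit_def is_cocone_def is_initial_def J by (simp add: Ball_def) blast
qed

lemma cocomplete_pushout:
  fixes \<kappa> :: "'k rel" and C :: "('o, 'm) category" (structure)
  assumes "Cinfinite \<kappa>" "is_category C" "cocomplete_category \<kappa> C"
    and f: "f \<in> Hom C X Y" and g: "g \<in> Hom C X Z"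
  shows "\<exists>a b. is_pushout C f g a b"
proof -
  interpret ccat C by unfold_locales (rule assms(2))
  have inf: "infinite (UNIV :: 'k set)"
    using assms(1) by (auto simp: cinfinite_def intro: finite_subset)
  obtain n :: "nat \<Rightarrow> 'k" where n: "inj n"
    using infinite_countable_subset[OF inf] by auto
  obtain k0 k1 k2 k3 k4 :: 'k where d: "distinct [k0, k1, k2, k3, k4]"
  proof -
    have "distinct (map n [0, 1, 2, 3, 4])"
      using n by (simp add: inj_eq)
    then show ?thesis using that[of "n 0" "n 1" "n 2" "n 3" "n 4"] by simp
  qed
  then have "k1 \<noteq> k0" "k2 \<noteq> k0" "k2 \<noteq> k1" "k4 \<noteq> k3"
    by auto
  note d = d this
  \<comment> \<open>The walking span: \<open>k0, k1, k2\<close> are the objects and their identities, \<open>k3 : k0 \<rightarrow> k1\<close> and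
    \<open>k4 : k0 \<rightarrow> k2\<close> the two legs.\<close>
  define J :: "('k, 'k) category" where
    "J = \<lparr>Obj = {k0, k1, k2}, Arr = {k0, k1, k2, k3, k4},
          Dom = (\<lambda>x. if x = k3 \<or> x = k4 then k0 else x),
          Cod = (\<lambda>x. if x = k3 then k1 else if x = k4 then k2 else x),
          Ident = id, Comp = (\<lambda>v u. if v \<in> {k0, k1, k2} then u else v)\<rparr>"
  define D where "D = \<lparr>OMap = (\<lambda>x. if x = k0 then X else if x = k1 then Y else Z),
      AMap = (\<lambda>x. if x = k3 then f else if x = k4 then g else
                 Ident C (if x = k0 then X else if x = k1 then Y else Z))\<rparr>"
  have J: "Obj J = {k0, k1, k2}" "Arr J = {k0, k1, k2, k3, k4}"
    by (auto simp: J_def)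
  have hJ: "u \<in> Hom J x y \<longleftrightarrow> u \<in> {k0, k1, k2} \<and> x = u \<and> y = u \<or> u = k3 \<and> x = k0 \<and> y = k1
      \<or> u = k4 \<and> x = k0 \<and> y = k2" for u x y
    using d by (auto simp: J_def Hom_def)
  have obj: "x \<in> Obj J" "y \<in> Obj J" if "u \<in> Hom J x y" for u x y
    using that by (auto simp: hJ J)
  have ident: "x \<in> Hom J x x" if "x \<in> Obj J" for x
    using that by (auto simp: hJ J)
  have unitl: "y \<cdot>\<^bsub>J\<^esub> u = u" if "y \<in> Obj J" for u y
    using that by (auto simp: J_def)
  have unitr: "v \<cdot>\<^bsub>J\<^esub> y = v" if "v \<in> Hom J y z" for v y z
    using that d unfolding hJ by (elim disjE conjE; simp add: J_def) auto
  have comp: "v = y \<and> z = y \<or> u = y \<and> x = y" if "u \<in> Hom J x y" "v \<in> Hom J y z" for u v x y z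
    using that d unfolding hJ by (elim disjE conjE; simp)
  have cJ: "is_category J"
    unfolding is_category_def
  proof (intro conjI ballI allI)
    fix u assume "u \<in> Arr J"
    then have "u \<in> Hom J (Dom J u) (Cod J u)" by (simp add: Hom_def)
    from obj[OF this] show "Dom J u \<in> Obj J" "Cod J u \<in> Obj J" .
  next
    fix x assume "x \<in> Obj J"
    from ident[OF this] show "Ident J x \<in> Hom J x x" by (simp add: J_def)
  next
    fix x y z u v assume u: "u \<in> Hom J x y" and v: "v \<in> Hom J y z"
    from comp[OF this] show "v \<cdot>\<^bsub>J\<^esub> u \<in> Hom J x z"
      using u v unitl[OF obj(2)[OF u]] unitr[OF v] by (elim disjE) auto
  next
    fix x y u assume u: "u \<in> Hom J x y"
    show "u \<cdot>\<^bsub>J\<^esub> Ident J x = u" "Ident J y \<cdot>\<^bsub>J\<^esub> u = u"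
      using unitr[OF u] unitl[OF obj(2)[OF u], of u] by (simp_all add: J_def)
  next
    fix x y z w u v t assume u: "u \<in> Hom J x y" and v: "v \<in> Hom J y z" and t: "t \<in> Hom J z w"
    from comp[OF v t] show "(t \<cdot>\<^bsub>J\<^esub> v) \<cdot>\<^bsub>J\<^esub> u = t \<cdot>\<^bsub>J\<^esub> (v \<cdot>\<^bsub>J\<^esub> u)"
    proof (elim disjE conjE)
      assume "t = z" then show ?thesis using unitl[OF obj(2)[OF v]] by simp
    next
      assume "v = z" "y = z"
      then show ?thesis using unitl[OF obj(2)[OF u], of u] unitr[OF t] by simp
    qed
  qed
  have o: "X \<in> Obj C" "Y \<in> Obj C" "Z \<in> Obj C"
    using f g by (auto simp: Hom_def)
  have Dob: "OMap D x \<in> Obj C" for x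
    using o by (simp add: D_def)
  have Did: "AMap D x = Ident C (OMap D x)" if "x \<in> Obj J" for x
    using that d by (auto simp: J D_def)
  have Darr: "AMap D u \<in> Hom C (OMap D x) (OMap D y)" if u: "u \<in> Hom J x y" for u x y
  proof -
    have "u \<in> Obj J \<and> x = u \<and> y = u \<or> u = k3 \<and> x = k0 \<and> y = k1 \<or> u = k4 \<and> x = k0 \<and> y = k2"
      using u by (auto simp: hJ J)
    then show ?thesis
    proof (elim disjE conjE)
      assume "u \<in> Obj J" "x = u" "y = u"
      then show ?thesis using Did[of u] ident_hom[OF Dob, of u] by simp
    next
      assume "u = k3" "x = k0" "y = k1"
      then show ?thesis using d f by (simp add: D_def)
    next
      assume "u = k4" "x = k0" "y = k2"
      then show ?thesis using d g by (simp add: D_def)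
    qed
  qed
  have D: "is_functor J C D"
    unfolding is_functor_def
  proof (intro conjI ballI allI)
    fix x assume "x \<in> Obj J"
    then show "AMap D (Ident J x) = Ident C (OMap D x)"
      using Did by (simp add: J_def)
  next
    fix x y z u v assume u: "u \<in> Hom J x y" and v: "v \<in> Hom J y z"
    from comp[OF this] show "AMap D (v \<cdot>\<^bsub>J\<^esub> u) = AMap D v \<cdot> AMap D u"
    proof (elim disjE conjE)
      assume "v = y" "z = y"
      then show ?thesis
        using unitl[OF obj(2)[OF u], of u] Darr[OF u] Did[OF obj(2)[OF u]] by (auto simp: Hom_def)
    next
      assume "u = y" "x = y"
      then show ?thesis
        using unitr[OF v] Darr[OF v] Did[OF obj(2)[OF u]] by (auto simp: Hom_def)
    qed
  qed (use cJ assms(2) Dob Darr in auto)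
  have "|Arr J| <o \<kappa>"
    unfolding J using assms(1)
    by (intro finite_ordLess_infinite) (auto simp: cinfinite_def card_of_well_order_on card_order_on_well_order_on Field_card_of)
  with D obtain P k where P: "is_colimit J C D P k"
    using assms(3) unfolding cocomplete_category_def by blast
  have k: "k k0 \<in> Hom C X P" "k k1 \<in> Hom C Y P" "k k2 \<in> Hom C Z P"
    "k k1 \<cdot> f = k k0" "k k2 \<cdot> g = k k0"
  proof -
    have "\<forall>j\<in>Obj J. k j \<in> Hom C (OMap D j) P"
      and a: "\<And>x y u. u \<in> Hom J x y \<Longrightarrow> k y \<cdot> AMap D u = k x"
      using P unfolding is_colimit_def is_cocone_def by auto
    then show "k k0 \<in> Hom C X P" "k k1 \<in> Hom C Y P" "k k2 \<in> Hom C Z P"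
      using d by (auto simp: J D_def)
    show "k k1 \<cdot> f = k k0" "k k2 \<cdot> g = k k0"
      using a[of k3 k0 k1] a[of k4 k0 k2] d by (auto simp: hJ D_def)
  qed
  have univ: "\<exists>!h. h \<in> Hom C P T \<and> h \<cdot> k k1 = u \<and> h \<cdot> k k2 = v"
    if u: "u \<in> Hom C Y T" and v: "v \<in> Hom C Z T" and e: "u \<cdot> f = v \<cdot> g" for T u v
  proof -
    define m where "m = (\<lambda>x. if x = k0 then u \<cdot> f else if x = k1 then u else v)"
    have m: "m j \<in> Hom C (OMap D j) T" if "j \<in> Obj J" for j
      using that u v comp_hom[OF f u] by (auto simp: J D_def m_def)
    have "m y \<cdot> AMap D a = m x" if a: "a \<in> Hom J x y" for a x y
    proof -
      have "a \<in> Obj J \<and> x = a \<and> y = a \<or> a = k3 \<and> x = k0 \<and> y = k1 \<or> a = k4 \<and> x = k0 \<and> y = k2"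
        using a by (auto simp: hJ J)
      then show ?thesis
      proof (elim disjE conjE)
        assume "a \<in> Obj J" "x = a" "y = a"
        then show ?thesis using Did[of a] m[of a] by (simp add: Hom_def)
      next
        assume "a = k3" "x = k0" "y = k1"
        then show ?thesis using d by (simp add: D_def m_def)
      next
        assume "a = k4" "x = k0" "y = k2"
        then show ?thesis using d e by (simp add: D_def m_def)
      qed
    qed
    then have "is_cocone J C D T m"
      unfolding is_cocone_def using m u by (simp add: Hom_def) auto
    then have ex: "\<exists>!h. h \<in> Hom C P T \<and> (\<forall>j \<in> Obj J. h \<cdot> k j = m j)"
      using P unfolding is_colimit_def by blast
    have eq: "(\<forall>j \<in> Obj J. h \<cdot> k j = m j) \<longleftrightarrow> h \<cdot> k k1 = u \<and> h \<cdot> k k2 = v"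
      if "h \<in> Hom C P T" for h
    proof -
      have "h \<cdot> k k0 = h \<cdot> k k1 \<cdot> f"
        using that k f by (simp add: Hom_def assoc)
      then show ?thesis using d by (auto simp: J m_def)
    qed
    show ?thesis
      using ex by (simp add: eq cong: conj_cong)
  qed
  have "k k1 \<cdot> f = k k2 \<cdot> g" using k by simp
  then show ?thesis
    unfolding is_pushout_def using f g k(2,3) univ by blast
qed

section \<open>Cylinder functors in lifting form\<close>

text \<open>The lifting property of the corner map of \<open>v : A \<rightarrow> B\<close> against \<open>q\<close>, with the map out of the
  corner spelled out as maps \<open>g b\<close> on \<open>B\<close> at the ends \<open>b \<in> T\<close> and a map \<open>H\<close> on \<open>I A\<close>. No colimit is
  mentioned, which is what makes the property self-dual under an adjunction. Taking \<open>T = UNIV\<close> gives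
  the corner with \<open>Id + Id \<rightarrow> I\<close>, and \<open>T = {False}\<close> the corner with the first end \<open>Id \<rightarrow> I\<close>.\<close>
definition end_lifts ::
  "('o, 'm) category \<Rightarrow> ('o, 'm, 'o, 'm) functr \<Rightarrow> (bool \<Rightarrow> 'o \<Rightarrow> 'm) \<Rightarrow> bool set \<Rightarrow> 'm \<Rightarrow> 'm \<Rightarrow> bool" where
  "end_lifts C I e T v q \<longleftrightarrow>
     (\<forall>g H K. (\<forall>b \<in> T. g b \<in> Hom C (Cod C v) (Dom C q)) \<longrightarrow>
        H \<in> Hom C (OMap I (Dom C v)) (Dom C q) \<longrightarrow> K \<in> Hom C (OMap I (Cod C v)) (Cod C q) \<longrightarrow>
        (\<forall>b \<in> T. g b \<cdot>\<^bsub>C\<^esub> v = H \<cdot>\<^bsub>C\<^esub> e b (Dom C v)) \<longrightarrow>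
        (\<forall>b \<in> T. q \<cdot>\<^bsub>C\<^esub> g b = K \<cdot>\<^bsub>C\<^esub> e b (Cod C v)) \<longrightarrow> q \<cdot>\<^bsub>C\<^esub> H = K \<cdot>\<^bsub>C\<^esub> AMap I v \<longrightarrow>
        (\<exists>L \<in> Hom C (OMap I (Cod C v)) (Dom C q).
           (\<forall>b \<in> T. L \<cdot>\<^bsub>C\<^esub> e b (Cod C v) = g b) \<and> L \<cdot>\<^bsub>C\<^esub> AMap I v = H \<and> q \<cdot>\<^bsub>C\<^esub> L = K))"

text \<open>A strong Quillen cylinder in lifting form. The right adjoint is part of the data
  because it is the cylinder functor of the opposite structure.\<close>
definition quillen_cylinder ::
  "('o, 'm) category \<Rightarrow> 'm premodel_structure \<Rightarrow> ('o, 'm, 'o, 'm) functr \<Rightarrow> ('o, 'm, 'o, 'm) functr \<Rightarrow>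
    ('o \<Rightarrow> 'o \<Rightarrow> 'm \<Rightarrow> 'm) \<Rightarrow> (bool \<Rightarrow> 'o \<Rightarrow> 'm) \<Rightarrow> ('o \<Rightarrow> 'm) \<Rightarrow> bool" where
  "quillen_cylinder C M I G \<phi> e r \<longleftrightarrow>
     is_adjunction C C I G \<phi> \<and> (\<forall>b. is_nat_trans C C id_functor I (e b)) \<and>
     is_nat_trans C C I id_functor r \<and> (\<forall>X \<in> Obj C. \<forall>b. r X \<cdot>\<^bsub>C\<^esub> e b X = Ident C X) \<and>
     (\<forall>v \<in> Cof M. \<forall>q \<in> AnFib M. end_lifts C I e UNIV v q) \<and>
     (\<forall>v \<in> AnCof M. \<forall>q \<in> Fib M. end_lifts C I e UNIV v q) \<and>
     (\<forall>v \<in> Cof M. \<forall>q \<in> Fib M. end_lifts C I e {False} v q)"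

locale endofunctor = ccat C for C :: "('o, 'm) category" (structure) +
  fixes I :: "('o, 'm, 'o, 'm) functr"
  assumes I: "is_functor C C I"
begin

lemma I_obj [simp]: "X \<in> Obj C \<Longrightarrow> OMap I X \<in> Obj C"
  using I by (simp add: is_functor_def)

lemma I_hom [intro]: "f \<in> Hom C X Y \<Longrightarrow> AMap I f \<in> Hom C (OMap I X) (OMap I Y)"
  using I by (simp add: is_functor_def)

lemma I_simps [simp]:
  assumes "f \<in> Arr C"
  shows "AMap I f \<in> Arr C" "Dom C (AMap I f) = OMap I (Dom C f)" "Cod C (AMap I f) = OMap I (Cod C f)"
  using I_hom[of f "Dom C f" "Cod C f"] assms by (simp_all add: Hom_def)

lemma I_comp:
  assumes "f \<in> Arr C" "g \<in> Arr C" "Cod C f = Dom C g"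
  shows "AMap I (g \<cdot> f) = AMap I g \<cdot> AMap I f"
proof -
  have "f \<in> Hom C (Dom C f) (Cod C f)" "g \<in> Hom C (Cod C f) (Cod C g)"
    using assms by (simp_all add: Hom_def)
  then show ?thesis using I unfolding is_functor_def by blast
qed

lemma I_ident [simp]: "X \<in> Obj C \<Longrightarrow> AMap I (Ident C X) = Ident C (OMap I X)"
  using I by (simp add: is_functor_def)

end

locale ends = endofunctor +
  fixes e :: "bool \<Rightarrow> 'a \<Rightarrow> 'b"
  assumes e: "is_nat_trans C C id_functor I (e b)"
begin

lemma e_hom: "X \<in> Obj C \<Longrightarrow> e b X \<in> Hom C X (OMap I X)"
  using e[of b] by (simp add: is_nat_trans_def id_functor_def)

lemma e_simps [simp]:
  assumes "X \<in> Obj C"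
  shows "e b X \<in> Arr C" "Dom C (e b X) = X" "Cod C (e b X) = OMap I X"
  using e_hom[OF assms] by (simp_all add: Hom_def)

lemma e_nat:
  assumes "f \<in> Arr C" "Dom C f = X"
  shows "AMap I f \<cdot> e b X = e b (Cod C f) \<cdot> f"
proof -
  have "f \<in> Hom C X (Cod C f)" using assms by (simp add: Hom_def)
  then show ?thesis using e[of b] unfolding is_nat_trans_def id_functor_def by simp
qed

lemma e_nat_extend:
  assumes "f \<in> Arr C" "Dom C f = X" "x \<in> Arr C" "Cod C x = X"
  shows "AMap I f \<cdot> (e b X \<cdot> x) = e b (Cod C f) \<cdot> (f \<cdot> x)"
  using extend[OF e_nat[OF assms(1,2)]] assms by (auto simp: assoc)

lemma end_liftsI:
  assumes "v \<in> Hom C A B" "q \<in> Hom C X Y"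
    and "\<And>g H K. (\<And>b. b \<in> T \<Longrightarrow> g b \<in> Hom C B X) \<Longrightarrow> H \<in> Hom C (OMap I A) X \<Longrightarrow>
      K \<in> Hom C (OMap I B) Y \<Longrightarrow> (\<And>b. b \<in> T \<Longrightarrow> g b \<cdot> v = H \<cdot> e b A) \<Longrightarrow>
      (\<And>b. b \<in> T \<Longrightarrow> q \<cdot> g b = K \<cdot> e b B) \<Longrightarrow> q \<cdot> H = K \<cdot> AMap I v \<Longrightarrow>
      \<exists>L \<in> Hom C (OMap I B) X. (\<forall>b \<in> T. L \<cdot> e b B = g b) \<and> L \<cdot> AMap I v = H \<and> q \<cdot> L = K"
  shows "end_lifts C I e T v q"
proof -
  have o: "Dom C v = A" "Cod C v = B" "Dom C q = X" "Cod C q = Y"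
    using assms(1,2) by (simp_all add: Hom_def)
  show ?thesis
    unfolding end_lifts_def o by (intro allI impI, rule assms(3)) blast+
qed

lemma end_liftsE:
  assumes "end_lifts C I e T v q" "v \<in> Hom C A B" "q \<in> Hom C X Y"
    and "\<And>b. b \<in> T \<Longrightarrow> g b \<in> Hom C B X" "H \<in> Hom C (OMap I A) X" "K \<in> Hom C (OMap I B) Y"
    and "\<And>b. b \<in> T \<Longrightarrow> g b \<cdot> v = H \<cdot> e b A" "\<And>b. b \<in> T \<Longrightarrow> q \<cdot> g b = K \<cdot> e b B"
    and "q \<cdot> H = K \<cdot> AMap I v"
  obtains L where "L \<in> Hom C (OMap I B) X" "\<forall>b \<in> T. L \<cdot> e b B = g b"
    "L \<cdot> AMap I v = H" "q \<cdot> L = K"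
proof -
  have o: "Dom C v = A" "Cod C v = B" "Dom C q = X" "Cod C q = Y"
    using assms(2,3) by (simp_all add: Hom_def)
  have "\<exists>L \<in> Hom C (OMap I B) X. (\<forall>b \<in> T. L \<cdot> e b B = g b) \<and> L \<cdot> AMap I v = H \<and> q \<cdot> L = K"
    using assms(1)[unfolded end_lifts_def o, THEN spec, THEN spec, THEN spec, THEN mp, THEN mp,
        THEN mp, THEN mp, THEN mp, THEN mp] assms(4-9) by blast
  then show ?thesis using that by blast
qed

definition end_compatible :: "bool set \<Rightarrow> 'b \<Rightarrow> 'a \<Rightarrow> (bool \<Rightarrow> 'b) \<Rightarrow> 'b \<Rightarrow> bool" where
  "end_compatible T v Q g H \<longleftrightarrow> (\<forall>b \<in> T. g b \<in> Hom C (Cod C v) Q) \<and>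
     H \<in> Hom C (OMap I (Dom C v)) Q \<and> (\<forall>b \<in> T. g b \<cdot> v = H \<cdot> e b (Dom C v))"

text \<open>The corner object of \<open>v : A \<rightarrow> B\<close> glues a copy of \<open>B\<close> (included by \<open>a b\<close>) to \<open>I A\<close> (included by
  \<open>c\<close>) at each end \<open>b \<in> T\<close>; \<open>w\<close> is the comparison map to \<open>I B\<close>. Existence and uniqueness of
  factorizations are separate conjuncts, as the two are used separately.\<close>
definition is_end_corner :: "bool set \<Rightarrow> 'b \<Rightarrow> 'a \<Rightarrow> (bool \<Rightarrow> 'b) \<Rightarrow> 'b \<Rightarrow> 'b \<Rightarrow> bool" where
  "is_end_corner T v P a c w \<longleftrightarrow> end_compatible T v P a c \<and>
     (\<forall>Q g H. end_compatible T v Q g H \<longrightarrow> (\<exists>h \<in> Hom C P Q. (\<forall>b \<in> T. h \<cdot> a b = g b) \<and> h \<cdot> c = H)) \<and>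
     (\<forall>Q. \<forall>h \<in> Hom C P Q. \<forall>k \<in> Hom C P Q.
        (\<forall>b \<in> T. h \<cdot> a b = k \<cdot> a b) \<longrightarrow> h \<cdot> c = k \<cdot> c \<longrightarrow> h = k) \<and>
     w \<in> Hom C P (OMap I (Cod C v)) \<and> (\<forall>b \<in> T. w \<cdot> a b = e b (Cod C v)) \<and> w \<cdot> c = AMap I v"

lemma corner_homs:
  assumes "is_end_corner T v P a c w" "v \<in> Hom C A B"
  shows "b \<in> T \<Longrightarrow> a b \<in> Hom C B P" "c \<in> Hom C (OMap I A) P" "b \<in> T \<Longrightarrow> a b \<cdot> v = c \<cdot> e b A"
    "w \<in> Hom C P (OMap I B)" "b \<in> T \<Longrightarrow> w \<cdot> a b = e b B" "w \<cdot> c = AMap I v"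
proof -
  have o: "Dom C v = A" "Cod C v = B" using assms(2) by (simp_all add: Hom_def)
  show "b \<in> T \<Longrightarrow> a b \<in> Hom C B P" "c \<in> Hom C (OMap I A) P" "b \<in> T \<Longrightarrow> a b \<cdot> v = c \<cdot> e b A"
    "w \<in> Hom C P (OMap I B)" "b \<in> T \<Longrightarrow> w \<cdot> a b = e b B" "w \<cdot> c = AMap I v"
    using assms(1) unfolding is_end_corner_def end_compatible_def o by blast+
qed

lemma corner_ex:
  assumes "is_end_corner T v P a c w" "v \<in> Hom C A B"
    and "\<And>b. b \<in> T \<Longrightarrow> g b \<in> Hom C B Q" "H \<in> Hom C (OMap I A) Q"
    and "\<And>b. b \<in> T \<Longrightarrow> g b \<cdot> v = H \<cdot> e b A"
  obtains h where "h \<in> Hom C P Q" "\<forall>b \<in> T. h \<cdot> a b = g b" "h \<cdot> c = H"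
proof -
  have o: "Dom C v = A" "Cod C v = B" using assms(2) by (simp_all add: Hom_def)
  have "end_compatible T v Q g H" using assms unfolding end_compatible_def o by blast
  then show ?thesis using assms(1) that unfolding is_end_corner_def by blast
qed

lemma corner_eq:
  assumes "is_end_corner T v P a c w" "h \<in> Hom C P Q" "k \<in> Hom C P Q"
    and "\<And>b. b \<in> T \<Longrightarrow> h \<cdot> a b = k \<cdot> a b" "h \<cdot> c = k \<cdot> c"
  shows "h = k"
  using assms unfolding is_end_corner_def by blast

text \<open>Maps out of the corner object are compatible families, so a lifting problem for \<open>w\<close> is the
  same thing as a filling problem in the sense of \<open>end_lifts\<close>.\<close>
lemma corner_lifts_iff:
  assumes cor: "is_end_corner T v P a c w" and v: "v \<in> Hom C A B" and q: "q \<in> Hom C X Y"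
  shows "lifts_against C w q \<longleftrightarrow> end_lifts C I e T v q"
proof -
  note t = corner_homs[OF cor v]
  have o: "A \<in> Obj C" "B \<in> Obj C" using hom_objs[OF v] by auto
  have "end_lifts C I e T v q" if l: "lifts_against C w q"
  proof -
    show "end_lifts C I e T v q"
    proof (rule end_liftsI[OF v q])
      fix g H K
      assume g: "\<And>b. b \<in> T \<Longrightarrow> g b \<in> Hom C B X" and H: "H \<in> Hom C (OMap I A) X"
        and K: "K \<in> Hom C (OMap I B) Y"
        and eq: "\<And>b. b \<in> T \<Longrightarrow> g b \<cdot> v = H \<cdot> e b A" "\<And>b. b \<in> T \<Longrightarrow> q \<cdot> g b = K \<cdot> e b B"
          "q \<cdot> H = K \<cdot> AMap I v"
      obtain h where h: "h \<in> Hom C P X" "\<forall>b \<in> T. h \<cdot> a b = g b" "h \<cdot> c = H"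
        using corner_ex[OF cor v g H eq(1)] .
      have "q \<cdot> h = K \<cdot> w"
      proof (rule corner_eq[OF cor comp_hom[OF h(1) q] comp_hom[OF t(4) K]])
        show "(q \<cdot> h) \<cdot> a b = (K \<cdot> w) \<cdot> a b" if "b \<in> T" for b
          using that h q K t(1,5)[OF that] t(4) eq(2)[OF that] by (simp add: Hom_def assoc)
        show "(q \<cdot> h) \<cdot> c = (K \<cdot> w) \<cdot> c"
          using h q K t(2,4,6) eq(3) by (simp add: Hom_def assoc)
      qed
      from liftsE[OF l t(4) q h(1) K this]
      obtain L where L: "L \<in> Hom C (OMap I B) X" "L \<cdot> w = h" "q \<cdot> L = K" .
      have "L \<cdot> e b B = g b" if b: "b \<in> T" for b
        using L(1) t(1,5)[OF b] t(4) h(2)[rule_format, OF b] extend[OF L(2), of "a b"] by (simp add: Hom_def)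
      moreover have "L \<cdot> AMap I v = H"
        using L(1) t(2,4,6) h(3) extend[OF L(2), of c] by (simp add: Hom_def)
      ultimately show "\<exists>L \<in> Hom C (OMap I B) X. (\<forall>b \<in> T. L \<cdot> e b B = g b) \<and> L \<cdot> AMap I v = H \<and> q \<cdot> L = K"
        using L by blast
    qed
  qed
  moreover have "lifts_against C w q" if l: "end_lifts C I e T v q"
  proof -
    show "lifts_against C w q"
    proof (rule liftsI[OF t(4) q])
      fix u k assume u: "u \<in> Hom C P X" and k: "k \<in> Hom C (OMap I B) Y" and eq: "q \<cdot> u = k \<cdot> w"
      obtain L where L: "L \<in> Hom C (OMap I B) X" "\<forall>b \<in> T. L \<cdot> e b B = u \<cdot> a b"
        "L \<cdot> AMap I v = u \<cdot> c" "q \<cdot> L = k"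
      proof (rule end_liftsE[OF l v q _ comp_hom[OF t(2) u] k, of "\<lambda>b. u \<cdot> a b"])
        show "u \<cdot> a b \<in> Hom C B X" if "b \<in> T" for b using comp_hom[OF t(1)[OF that] u] .
        show "u \<cdot> a b \<cdot> v = u \<cdot> c \<cdot> e b A" if "b \<in> T" for b
          using that t(1,3)[OF that] t(2) u v o by (simp add: Hom_def assoc)
        show "q \<cdot> (u \<cdot> a b) = k \<cdot> e b B" if "b \<in> T" for b
          using that t(1,5)[OF that] t(4) k u q extend[OF eq, of "a b"] by (simp add: Hom_def assoc)
        show "q \<cdot> (u \<cdot> c) = k \<cdot> AMap I v"
          using t(2,4,6) k u q extend[OF eq, of c] by (simp add: Hom_def assoc)
      qed (use that in blast)
      have "L \<cdot> w = u"
      proof (rule corner_eq[OF cor comp_hom[OF t(4) L(1)] u])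
        show "(L \<cdot> w) \<cdot> a b = u \<cdot> a b" if "b \<in> T" for b
          using that t(1,5)[OF that] t(4) L(1) L(2)[rule_format, OF that] by (simp add: Hom_def assoc)
        show "(L \<cdot> w) \<cdot> c = u \<cdot> c"
          using t(2,4,6) L(1,3) by (simp add: Hom_def assoc)
      qed
      with L show "\<exists>h \<in> Hom C (OMap I B) X. h \<cdot> w = u \<and> q \<cdot> h = k" by blast
    qed
  qed
  ultimately show ?thesis by blast
qed

text \<open>Gluing the copies of \<open>B\<close> one after the other makes \<open>c\<close> a composite of pushouts of \<open>v\<close>, so
  \<open>c\<close> stays in the left class. This is how corner objects are later seen to be cofibrant.\<close>
lemma corner_exists:
  assumes wfs: "weak_factorization_system C L R"
    and po: "\<And>f g X Y Z. f \<in> Hom C X Y \<Longrightarrow> g \<in> Hom C X Z \<Longrightarrow> \<exists>a b. is_pushout C f g a b"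
    and T: "T = {False} \<or> T = UNIV" and vL: "v \<in> L" and v: "v \<in> Hom C A B"
  obtains P a c w where "is_end_corner T v P a c w" "c \<in> L"
proof -
  have o [simp]: "A \<in> Obj C" "B \<in> Obj C" "Dom C v = A" "Cod C v = B" "v \<in> Arr C"
    using hom_objs[OF v] v by (auto simp: Hom_def)
  obtain a0 c0 where p0: "is_pushout C v (e False A) a0 c0"
    using po[OF v e_hom[OF o(1), of False]] by blast
  define P0 where "P0 = Cod C a0"
  have t0: "a0 \<in> Hom C B P0" "c0 \<in> Hom C (OMap I A) P0" "a0 \<cdot> v = c0 \<cdot> e False A"
    using pushout_homs[OF p0] by (simp_all add: P0_def)
  have c0L: "c0 \<in> L" using wfs_pushout[OF wfs vL p0] .
  obtain w0 where w0: "w0 \<in> Hom C P0 (OMap I B)" "w0 \<cdot> a0 = e False B" "w0 \<cdot> c0 = AMap I v"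
    using pushout_ex[OF p0, of "e False B" "OMap I B" "AMap I v"] e_hom[of B False] I_hom[OF v] e_nat[of v A False]
    by (auto simp: P0_def)
  from T show ?thesis
  proof
    assume T: "T = {False}"
    have "is_end_corner T v P0 (\<lambda>_. a0) c0 w0"
      unfolding is_end_corner_def end_compatible_def T
    proof (intro conjI allI impI ballI)
      fix Q g H
      assume "(\<forall>b\<in>{False}. g b \<in> Hom C (Cod C v) Q) \<and> H \<in> Hom C (OMap I (Dom C v)) Q \<and>
        (\<forall>b\<in>{False}. g b \<cdot> v = H \<cdot> e b (Dom C v))"
      then show "\<exists>h\<in>Hom C P0 Q. (\<forall>b\<in>{False}. h \<cdot> a0 = g b) \<and> h \<cdot> c0 = H"
        using pushout_ex[OF p0, of "g False" Q H] by (auto simp: P0_def)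
    next
      fix Q h k
      assume "h \<in> Hom C P0 Q" "k \<in> Hom C P0 Q" "\<forall>b\<in>{False}. h \<cdot> a0 = k \<cdot> a0" "h \<cdot> c0 = k \<cdot> c0"
      then show "h = k"
        using pushout_eq[OF p0, of h Q k] unfolding P0_def by blast
    qed (use t0 w0 in simp_all)
    then show ?thesis using that c0L by blast
  next
    assume T: "T = UNIV"
    obtain a1 c1 where p1: "is_pushout C v (c0 \<cdot> e True A) a1 c1"
      using po[OF v comp_hom[OF e_hom[OF o(1), of True] t0(2)]] by blast
    define P where "P = Cod C a1"
    have t1: "a1 \<in> Hom C B P" "c1 \<in> Hom C P0 P" "a1 \<cdot> v = c1 \<cdot> (c0 \<cdot> e True A)"
      using pushout_homs[OF p1] t0 by (simp_all add: P_def Hom_def)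
    have cL: "c1 \<cdot> c0 \<in> L"
      using wfs_comp[OF wfs c0L wfs_pushout[OF wfs vL p1] t0(2) t1(2)] .
    have cod: "Cod C (c0 \<cdot> e True A) = P0" using t0 by (simp add: Hom_def)
    obtain w where w: "w \<in> Hom C P (OMap I B)" "w \<cdot> a1 = e True B" "w \<cdot> c1 = w0"
    proof (rule pushout_ex[OF p1, of "e True B" "OMap I B" w0])
      show "e True B \<cdot> v = w0 \<cdot> (c0 \<cdot> e True A)"
        using w0 t0 extend[OF w0(3), of "e True A"] by (simp add: Hom_def e_nat)
    qed (use w0 t0 e_hom[of B True] that in \<open>auto simp: P_def Hom_def\<close>)
    define a where "a = (\<lambda>b. if b then a1 else c1 \<cdot> a0)"
    have "is_end_corner T v P a (c1 \<cdot> c0) w"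
      unfolding is_end_corner_def end_compatible_def T
    proof (intro conjI allI impI ballI)
      fix b show "a b \<in> Hom C (Cod C v) P"
        using t0 t1 by (auto simp: a_def)
      show "a b \<cdot> v = c1 \<cdot> c0 \<cdot> e b (Dom C v)"
        using t0 t1 by (cases b) (simp_all add: a_def Hom_def assoc)
      show "w \<cdot> a b = e b (Cod C v)"
        using t0 t1 w w0 extend[OF w(3), of a0] by (cases b) (simp_all add: a_def Hom_def)
    next
      show "c1 \<cdot> c0 \<in> Hom C (OMap I (Dom C v)) P" using t0 t1 by auto
      show "w \<in> Hom C P (OMap I (Cod C v))" using w by simp
      show "w \<cdot> (c1 \<cdot> c0) = AMap I v"
        using t0 t1 w w0 extend[OF w(3), of c0] by (simp add: Hom_def)
    next
      fix Q g H
      assume gH: "(\<forall>b\<in>UNIV. g b \<in> Hom C (Cod C v) Q) \<and> H \<in> Hom C (OMap I (Dom C v)) Q \<and>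
        (\<forall>b\<in>UNIV. g b \<cdot> v = H \<cdot> e b (Dom C v))"
      then have g: "g b \<in> Hom C B Q" "g b \<cdot> v = H \<cdot> e b A" for b by simp_all
      from gH have H: "H \<in> Hom C (OMap I A) Q" by simp
      obtain h where h: "h \<in> Hom C P0 Q" "h \<cdot> a0 = g False" "h \<cdot> c0 = H"
        using pushout_ex[OF p0, of "g False" Q H] g[of False] H by (auto simp: P0_def)
      obtain k where k: "k \<in> Hom C P Q" "k \<cdot> a1 = g True" "k \<cdot> c1 = h"
      proof (rule pushout_ex[OF p1, of "g True" Q h])
        show "g True \<cdot> v = h \<cdot> (c0 \<cdot> e True A)"
          using h t0 g(2)[of True] extend[OF h(3), of "e True A"] by (simp add: Hom_def)
      qed (use g[of True] h cod that in \<open>auto simp: P_def\<close>)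
      have "k \<cdot> a b = g b" for b
        using k h t0 t1 extend[OF k(3), of a0] by (cases b) (simp_all add: a_def Hom_def)
      moreover have "k \<cdot> (c1 \<cdot> c0) = H"
        using k h t0 t1 extend[OF k(3), of c0] by (simp add: Hom_def)
      ultimately show "\<exists>h\<in>Hom C P Q. (\<forall>b\<in>UNIV. h \<cdot> a b = g b) \<and> h \<cdot> (c1 \<cdot> c0) = H"
        using k(1) by blast
    next
      fix Q h k
      assume h: "h \<in> Hom C P Q" and k: "k \<in> Hom C P Q"
        and eq: "\<forall>b\<in>UNIV. h \<cdot> a b = k \<cdot> a b" "h \<cdot> (c1 \<cdot> c0) = k \<cdot> (c1 \<cdot> c0)"
      have 1: "h \<cdot> a1 = k \<cdot> a1" "h \<cdot> (c1 \<cdot> a0) = k \<cdot> (c1 \<cdot> a0)"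
        using eq(1)[THEN bspec, of True] eq(1)[THEN bspec, of False] by (simp_all add: a_def)
      have "h \<cdot> c1 = k \<cdot> c1"
      proof (rule pushout_eq[OF p0])
        show "h \<cdot> c1 \<in> Hom C (Cod C a0) Q" "k \<cdot> c1 \<in> Hom C (Cod C a0) Q"
          using comp_hom[OF t1(2) h] comp_hom[OF t1(2) k] by (simp_all add: P0_def)
        show "h \<cdot> c1 \<cdot> a0 = k \<cdot> c1 \<cdot> a0" "h \<cdot> c1 \<cdot> c0 = k \<cdot> c1 \<cdot> c0"
          using 1 eq(2) t0 t1 h k by (simp_all add: Hom_def assoc)
      qed
      then show "h = k"
        using pushout_eq[OF p1 _ _ 1(1)] h k by (simp add: P_def)
    qed
    then show ?thesis using that cL by blast
  qed
qed

end

section \<open>Adjunctions and duality of cylinders\<close>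

locale adjunction = endofunctor +
  fixes G :: "('a, 'b, 'a, 'b) functr" and \<phi> :: "'a \<Rightarrow> 'a \<Rightarrow> 'b \<Rightarrow> 'b"
  assumes adj: "is_adjunction C C I G \<phi>"
begin

sublocale G: endofunctor C G
  using adj by unfold_locales (simp add: is_adjunction_def)

lemma phi_bij: "X \<in> Obj C \<Longrightarrow> Y \<in> Obj C \<Longrightarrow>
    bij_betw (\<phi> X Y) (Hom C (OMap I X) Y) (Hom C X (OMap G Y))"
  using adj by (simp add: is_adjunction_def)

lemma phi_hom:
  assumes "h \<in> Hom C (OMap I X) Y" "X \<in> Obj C" shows "\<phi> X Y h \<in> Hom C X (OMap G Y)"
  using bij_betwE[OF phi_bij[of X Y]] assms hom_objs by blast

lemma phi_inj:
  assumes "\<phi> X Y h = \<phi> X Y k" "h \<in> Hom C (OMap I X) Y" "k \<in> Hom C (OMap I X) Y" "X \<in> Obj C"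
  shows "h = k"
  using bij_betw_imp_inj_on[OF phi_bij[of X Y]] assms hom_objs by (metis inj_onD)

lemma phi_nat:
  assumes "u \<in> Hom C X' X" "v \<in> Hom C Y Y'" "h \<in> Hom C (OMap I X) Y"
  shows "\<phi> X' Y' (v \<cdot> h \<cdot> AMap I u) = AMap G v \<cdot> \<phi> X Y h \<cdot> u"
  using adj assms unfolding is_adjunction_def by blast

lemma phi_pre:
  assumes u: "u \<in> Hom C X' X" and h: "h \<in> Hom C (OMap I X) Y"
  shows "\<phi> X' Y (h \<cdot> AMap I u) = \<phi> X Y h \<cdot> u"
  using phi_nat[OF u ident_hom h] hom_objs[OF h] hom_objs[OF u] phi_hom[OF h] h u
  by (simp add: Hom_def)

lemma phi_post:
  assumes v: "v \<in> Hom C Y Y'" and h: "h \<in> Hom C (OMap I X) Y" and X: "X \<in> Obj C"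
  shows "\<phi> X Y' (v \<cdot> h) = AMap G v \<cdot> \<phi> X Y h"
  using phi_nat[OF ident_hom[OF X] v h] hom_objs[OF h] hom_objs[OF v] phi_hom[OF h] h v X
  by (simp add: Hom_def assoc)

definition psi :: "'a \<Rightarrow> 'a \<Rightarrow> 'b \<Rightarrow> 'b" where
  "psi X Y = inv_into (Hom C (OMap I X) Y) (\<phi> X Y)"

lemma psi:
  assumes "h \<in> Hom C X (OMap G Y)" "Y \<in> Obj C"
  shows psi_hom: "psi X Y h \<in> Hom C (OMap I X) Y" and phi_psi: "\<phi> X Y (psi X Y h) = h"
proof -
  have "h \<in> \<phi> X Y ` Hom C (OMap I X) Y"
    using phi_bij[of X Y] assms hom_objs[OF assms(1)] by (simp add: bij_betw_def)
  then show "psi X Y h \<in> Hom C (OMap I X) Y" "\<phi> X Y (psi X Y h) = h"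
    unfolding psi_def by (rule inv_into_into, rule f_inv_into_f)
qed

lemma psi_phi:
  assumes "h \<in> Hom C (OMap I X) Y" "X \<in> Obj C"
  shows "psi X Y (\<phi> X Y h) = h"
  using phi_inj[OF phi_psi psi_hom assms(1,2)] phi_hom[OF assms] hom_objs[OF assms(1)] by blast

lemma I_initial: "is_initial C Z \<Longrightarrow> is_initial C (OMap I Z)"
  unfolding is_initial_def
proof (intro conjI ballI)
  fix X assume Z: "Z \<in> Obj C \<and> (\<forall>X\<in>Obj C. \<exists>!f. f \<in> Hom C Z X)" and X: "X \<in> Obj C"
  then obtain f where f: "f \<in> Hom C Z (OMap G X)" "\<And>g. g \<in> Hom C Z (OMap G X) \<Longrightarrow> g = f"
    using G.I_obj[OF X] by blast
  show "\<exists>!f. f \<in> Hom C (OMap I Z) X"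
  proof (rule ex1I)
    show "psi Z X f \<in> Hom C (OMap I Z) X" using psi_hom[OF f(1) X] .
    fix g assume g: "g \<in> Hom C (OMap I Z) X"
    show "g = psi Z X f" using psi_phi[OF g] f(2)[OF phi_hom[OF g]] Z by simp
  qed
qed simp

lemma adjunction_opposite: "is_adjunction (opposite C) (opposite C) G I (\<lambda>Y X. psi X Y)"
  unfolding is_adjunction_def
proof (intro conjI allI ballI)
  show "is_functor (opposite C) (opposite C) G" "is_functor (opposite C) (opposite C) I"
    using is_functor_opposite[OF G.I] is_functor_opposite[OF I] .
  fix X Y assume "X \<in> Obj (opposite C)" "Y \<in> Obj (opposite C)"
  then show "bij_betw (psi Y X) (Hom (opposite C) (OMap G X) Y) (Hom (opposite C) X (OMap I Y))"
    using bij_betw_inv_into[OF phi_bij] by (simp add: psi_def)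
next
  fix X X' Y Y' u v h
  assume "u \<in> Hom (opposite C) X' X" "v \<in> Hom (opposite C) Y Y'" "h \<in> Hom (opposite C) (OMap G X) Y"
  then have u: "u \<in> Hom C X X'" and v: "v \<in> Hom C Y' Y" and h: "h \<in> Hom C Y (OMap G X)" by simp_all
  have o: "X \<in> Obj C" "X' \<in> Obj C" "Y' \<in> Obj C" "Y \<in> Obj C" using hom_objs u v by blast+
  have k: "psi Y X h \<in> Hom C (OMap I Y) X" using psi_hom[OF h o(1)] .
  have "\<phi> Y' X' (u \<cdot> psi Y X h \<cdot> AMap I v) = AMap G u \<cdot> h \<cdot> v"
    using phi_nat[OF v u k] phi_psi[OF h o(1)] by simp
  then have "psi Y' X' (AMap G u \<cdot> h \<cdot> v) = u \<cdot> psi Y X h \<cdot> AMap I v"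
    using psi_phi[of "u \<cdot> psi Y X h \<cdot> AMap I v" Y' X'] comp_hom[OF I_hom[OF v] comp_hom[OF k u]] o
    by simp
  then show "psi Y' X' (v \<cdot>\<^bsub>opposite C\<^esub> h \<cdot>\<^bsub>opposite C\<^esub> AMap G u) =
      AMap I v \<cdot>\<^bsub>opposite C\<^esub> psi Y X h \<cdot>\<^bsub>opposite C\<^esub> u"
    using u v h k o by (simp add: Hom_def assoc)
qed

end

locale adjoint_ends = ends + adjunction
begin

text \<open>The evaluation of the path object \<open>G Y\<close> at the end \<open>b\<close>, that is, the mate of \<open>e b\<close> under
  the adjunction: the end inclusion of \<open>G Y\<close> followed by the counit \<open>I (G Y) \<rightarrow> Y\<close>.\<close>
definition coends :: "bool \<Rightarrow> 'a \<Rightarrow> 'b" where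
  "coends b Y = psi (OMap G Y) Y (Ident C (OMap G Y)) \<cdot> e b (OMap G Y)"

lemma counit_hom:
  "Y \<in> Obj C \<Longrightarrow> psi (OMap G Y) Y (Ident C (OMap G Y)) \<in> Hom C (OMap I (OMap G Y)) Y"
  by (rule psi_hom[OF ident_hom]) simp_all

lemma coends_hom: "Y \<in> Obj C \<Longrightarrow> coends b Y \<in> Hom C (OMap G Y) Y"
  unfolding coends_def by (rule comp_hom[OF e_hom counit_hom]) simp_all

text \<open>Evaluating the transpose of a homotopy at an end restricts the homotopy to that end. This
  identity translates every filling condition between \<open>I\<close> and \<open>G\<close>.\<close>
lemma coends_phi:
  assumes h: "h \<in> Hom C (OMap I X) Y" and X: "X \<in> Obj C"
  shows "coends b Y \<cdot> \<phi> X Y h = h \<cdot> e b X"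
proof -
  have Y: "Y \<in> Obj C" using hom_objs[OF h] by simp
  note f = phi_hom[OF h X] and c = counit_hom[OF Y]
  let ?c = "psi (OMap G Y) Y (Ident C (OMap G Y))"
  have "\<phi> X Y (?c \<cdot> AMap I (\<phi> X Y h)) = \<phi> X Y h"
    using phi_pre[OF f c] phi_psi[OF ident_hom[OF G.I_obj[OF Y]] Y] f by (simp add: Hom_def)
  then have eq: "?c \<cdot> AMap I (\<phi> X Y h) = h"
    by (rule phi_inj[OF _ comp_hom[OF I_hom[OF f] c] h X])
  have "coends b Y \<cdot> \<phi> X Y h = ?c \<cdot> (AMap I (\<phi> X Y h) \<cdot> e b X)"
    unfolding coends_def using c f X Y by (simp add: Hom_def assoc e_nat)
  also have "\<dots> = h \<cdot> e b X"
    using c f X Y by (intro extend[OF eq]) (simp_all add: Hom_def)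
  finally show ?thesis .
qed

lemma coends_nat: "is_nat_trans (opposite C) (opposite C) id_functor G (coends b)"
  unfolding is_nat_trans_def
proof (intro conjI ballI allI)
  show "is_functor (opposite C) (opposite C) id_functor"
    using is_category_opposite[OF cat]
    by (simp add: is_functor_def id_functor_def)
  show "is_functor (opposite C) (opposite C) G" using is_functor_opposite[OF G.I] .
  fix X assume "X \<in> Obj (opposite C)"
  then show "coends b X \<in> Hom (opposite C) (OMap id_functor X) (OMap G X)"
    using coends_hom by (simp add: id_functor_def)
next
  fix X Y f assume "f \<in> Hom (opposite C) X Y"
  then have f: "f \<in> Hom C Y X" by simp
  have o: "X \<in> Obj C" "Y \<in> Obj C" using hom_objs[OF f] by auto
  let ?c = "psi (OMap G Y) Y (Ident C (OMap G Y))"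
  note c = counit_hom[OF o(2)]
  have gf: "\<phi> (OMap G Y) X (f \<cdot> ?c) = AMap G f"
    using phi_post[OF f c] phi_psi[OF ident_hom[OF G.I_obj[OF o(2)]] o(2)] f o by (simp add: Hom_def)
  have "coends b X \<cdot> AMap G f = f \<cdot> ?c \<cdot> e b (OMap G Y)"
    using coends_phi[OF comp_hom[OF c f], of b] gf o by simp
  also have "\<dots> = f \<cdot> coends b Y"
    unfolding coends_def using f c o by (simp add: Hom_def assoc)
  finally show "AMap G f \<cdot>\<^bsub>opposite C\<^esub> coends b X =
      coends b Y \<cdot>\<^bsub>opposite C\<^esub> AMap id_functor f"
    by (simp add: id_functor_def)
qed

sublocale op: ends "opposite C" G coends
  using is_category_opposite[OF cat] is_functor_opposite[OF G.I] coends_nat by unfold_locales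

text \<open>Transposition exchanges the roles of the two boundary maps: the part \<open>H : I A \<rightarrow> X\<close> on the
  cylinder becomes a map \<open>A \<rightarrow> G X\<close>, which is the base of the dual filling problem, and the base
  \<open>K : I B \<rightarrow> Y\<close> becomes the part \<open>B \<rightarrow> G Y\<close> on the dual cylinder. The transpose of a filler is a filler.\<close>
lemma end_lifts_opposite:
  assumes l: "end_lifts C I e T v q" and v: "v \<in> Arr C" and q: "q \<in> Arr C"
  shows "end_lifts (opposite C) G coends T q v"
proof -
  obtain A B X Y where v: "v \<in> Hom C A B" and q: "q \<in> Hom C X Y"
    using v q by (auto simp: Hom_def)
  have o: "A \<in> Obj C" "B \<in> Obj C" "X \<in> Obj C" "Y \<in> Obj C" using hom_objs v q by blast+
  show ?thesis
  proof (rule op.end_liftsI)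
    show "q \<in> Hom (opposite C) Y X" "v \<in> Hom (opposite C) B A" using v q by simp_all
    fix g H K
    assume "\<And>b. b \<in> T \<Longrightarrow> g b \<in> Hom (opposite C) X B"
      "H \<in> Hom (opposite C) (OMap G Y) B" "K \<in> Hom (opposite C) (OMap G X) A"
      "\<And>b. b \<in> T \<Longrightarrow> g b \<cdot>\<^bsub>opposite C\<^esub> q = H \<cdot>\<^bsub>opposite C\<^esub> coends b Y"
      "\<And>b. b \<in> T \<Longrightarrow> v \<cdot>\<^bsub>opposite C\<^esub> g b = K \<cdot>\<^bsub>opposite C\<^esub> coends b X"
      "v \<cdot>\<^bsub>opposite C\<^esub> H = K \<cdot>\<^bsub>opposite C\<^esub> AMap G q"
    then have g: "\<And>b. b \<in> T \<Longrightarrow> g b \<in> Hom C B X" and H: "H \<in> Hom C B (OMap G Y)"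
      and K: "K \<in> Hom C A (OMap G X)"
      and eq: "\<And>b. b \<in> T \<Longrightarrow> q \<cdot> g b = coends b Y \<cdot> H" "\<And>b. b \<in> T \<Longrightarrow> g b \<cdot> v = coends b X \<cdot> K"
        "H \<cdot> v = AMap G q \<cdot> K" by simp_all
    note H' = psi_hom[OF H o(4)] phi_psi[OF H o(4)]
    note K' = psi_hom[OF K o(3)] phi_psi[OF K o(3)]
    obtain L where L: "L \<in> Hom C (OMap I B) X" "\<forall>b \<in> T. L \<cdot> e b B = g b"
      "L \<cdot> AMap I v = psi A X K" "q \<cdot> L = psi B Y H"
    proof (rule end_liftsE[OF l v q g K'(1) H'(1)])
      show "g b \<cdot> v = psi A X K \<cdot> e b A" if "b \<in> T" for b
        using eq(2)[OF that] coends_phi[OF K'(1) o(1), of b] K'(2) by simp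
      show "q \<cdot> g b = psi B Y H \<cdot> e b B" if "b \<in> T" for b
        using eq(1)[OF that] coends_phi[OF H'(1) o(2), of b] H'(2) by simp
      have "\<phi> A Y (q \<cdot> psi A X K) = \<phi> A Y (psi B Y H \<cdot> AMap I v)"
        using phi_post[OF q K'(1) o(1)] phi_pre[OF v H'(1)] eq(3) H'(2) K'(2) by simp
      then show "q \<cdot> psi A X K = psi B Y H \<cdot> AMap I v"
        by (rule phi_inj[OF _ comp_hom[OF K'(1) q] comp_hom[OF I_hom[OF v] H'(1)] o(1)])
    qed (use that in blast)+
    have "\<phi> B X L \<in> Hom C B (OMap G X)" using phi_hom[OF L(1) o(2)] .
    moreover have "coends b X \<cdot> \<phi> B X L = g b" if "b \<in> T" for b
      using coends_phi[OF L(1) o(2), of b] L(2) that by simp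
    moreover have "AMap G q \<cdot> \<phi> B X L = H"
      using phi_post[OF q L(1) o(2)] L(4) H'(2) by simp
    moreover have "\<phi> B X L \<cdot> v = K"
      using phi_pre[OF v L(1)] L(3) K'(2) by simp
    ultimately show "\<exists>L\<in>Hom (opposite C) (OMap G X) B. (\<forall>b\<in>T. L \<cdot>\<^bsub>opposite C\<^esub> coends b X = g b) \<and>
        L \<cdot>\<^bsub>opposite C\<^esub> AMap G q = H \<and> v \<cdot>\<^bsub>opposite C\<^esub> L = K"
      by (intro bexI[of _ "\<phi> B X L"]) simp_all
  qed
qed

end

locale cylinder = adjoint_ends +
  fixes r :: "'a \<Rightarrow> 'b"
  assumes r: "is_nat_trans C C I id_functor r"
    and re: "X \<in> Obj C \<Longrightarrow> r X \<cdot> e b X = Ident C X"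
begin

lemma r_hom: "X \<in> Obj C \<Longrightarrow> r X \<in> Hom C (OMap I X) X"
  using r by (simp add: is_nat_trans_def id_functor_def)

lemma r_nat: "f \<in> Hom C X Y \<Longrightarrow> r Y \<cdot> AMap I f = f \<cdot> r X"
  using r by (simp add: is_nat_trans_def id_functor_def)

lemma coretraction_nat: "is_nat_trans (opposite C) (opposite C) G id_functor (\<lambda>Y. \<phi> Y Y (r Y))"
  unfolding is_nat_trans_def
proof (intro conjI ballI allI)
  show "is_functor (opposite C) (opposite C) id_functor"
    using is_category_opposite[OF cat] by (simp add: is_functor_def id_functor_def)
  show "is_functor (opposite C) (opposite C) G" using is_functor_opposite[OF G.I] .
  fix X assume "X \<in> Obj (opposite C)"
  then show "\<phi> X X (r X) \<in> Hom (opposite C) (OMap G X) (OMap id_functor X)"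
    using phi_hom[OF r_hom] by (simp add: id_functor_def)
next
  fix X Y f assume "f \<in> Hom (opposite C) X Y"
  then have f: "f \<in> Hom C Y X" by simp
  have o: "X \<in> Obj C" "Y \<in> Obj C" using hom_objs[OF f] by auto
  have "\<phi> X X (r X) \<cdot> f = AMap G f \<cdot> \<phi> Y Y (r Y)"
    using phi_pre[OF f r_hom[OF o(1)]] phi_post[OF f r_hom[OF o(2)] o(2)] r_nat[OF f] by simp
  then show "AMap id_functor f \<cdot>\<^bsub>opposite C\<^esub> \<phi> X X (r X) =
      \<phi> Y Y (r Y) \<cdot>\<^bsub>opposite C\<^esub> AMap G f"
    by (simp add: id_functor_def)
qed

end

lemma quillen_cylinder_opposite:
  assumes c: "is_category C" and M: "premodel_category \<kappa> C M" and q: "quillen_cylinder C M I G \<phi> e r"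
  shows "\<exists>\<phi>' e' r'. quillen_cylinder (opposite C) (opposite_structure M) G I \<phi>' e' r'"
proof -
  interpret cylinder C I e G \<phi> r
    using c q unfolding quillen_cylinder_def is_adjunction_def
    by unfold_locales (auto simp: is_adjunction_def)
  have arr: "f \<in> Arr C" if "f \<in> Cof M \<or> f \<in> AnCof M \<or> f \<in> Fib M \<or> f \<in> AnFib M" for f
    using M that wfs_arr unfolding premodel_category_def by blast
  have "quillen_cylinder (opposite C) (opposite_structure M) G I (\<lambda>Y X. psi X Y) coends
      (\<lambda>Y. \<phi> Y Y (r Y))"
    unfolding quillen_cylinder_def
  proof (intro conjI allI ballI)
    show "is_adjunction (opposite C) (opposite C) G I (\<lambda>Y X. psi X Y)"
      by (rule adjunction_opposite)
    show "is_nat_trans (opposite C) (opposite C) id_functor G (coends b)" for b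
      by (rule coends_nat)
    show "is_nat_trans (opposite C) (opposite C) G id_functor (\<lambda>Y. \<phi> Y Y (r Y))"
      by (rule coretraction_nat)
    show "\<phi> X X (r X) \<cdot>\<^bsub>opposite C\<^esub> coends b X = Ident (opposite C) X" if "X \<in> Obj (opposite C)" for X b
      using that coends_phi[OF r_hom, of X b] re[of X b] by simp
  next
    fix v p assume "v \<in> Cof (opposite_structure M)" "p \<in> AnFib (opposite_structure M)"
    then show "end_lifts (opposite C) G coends UNIV v p"
      using q arr by (intro end_lifts_opposite) (auto simp: quillen_cylinder_def)
  next
    fix v p assume "v \<in> AnCof (opposite_structure M)" "p \<in> Fib (opposite_structure M)"
    then show "end_lifts (opposite C) G coends UNIV v p"
      using q arr by (intro end_lifts_opposite) (auto simp: quillen_cylinder_def)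
  next
    fix v p assume "v \<in> Cof (opposite_structure M)" "p \<in> Fib (opposite_structure M)"
    then show "end_lifts (opposite C) G coends {False} v p"
      using q arr by (intro end_lifts_opposite) (auto simp: quillen_cylinder_def)
  qed
  then show ?thesis by blast
qed

section \<open>Cylinders given by corner-product maps\<close>
lemma coproduct_ex:
  assumes "is_coproduct C X Y S a b" "u \<in> Hom C X T" "v \<in> Hom C Y T"
  obtains h where "h \<in> Hom C S T" "h \<cdot>\<^bsub>C\<^esub> a = u" "h \<cdot>\<^bsub>C\<^esub> b = v"
proof -
  have "\<exists>!h. h \<in> Hom C S T \<and> h \<cdot>\<^bsub>C\<^esub> a = u \<and> h \<cdot>\<^bsub>C\<^esub> b = v"
    using assms unfolding is_coproduct_def by blast
  then show ?thesis using that by (elim ex1E conjE)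
qed

lemma (in ccat) coproduct_eq:
  assumes s: "is_coproduct C X Y S a b" and h: "h \<in> Hom C S T" "k \<in> Hom C S T"
    and eq: "h \<cdot> a = k \<cdot> a" "h \<cdot> b = k \<cdot> b"
  shows "h = k"
proof -
  have ab: "a \<in> Hom C X S" "b \<in> Hom C Y S" using s unfolding is_coproduct_def by blast+
  have "\<exists>!m. m \<in> Hom C S T \<and> m \<cdot> a = h \<cdot> a \<and> m \<cdot> b = h \<cdot> b"
    using s comp_hom[OF ab(1) h(1)] comp_hom[OF ab(2) h(1)] unfolding is_coproduct_def by blast
  then show ?thesis by (rule ex1E) (use h eq in metis)
qed

lemma nat_trans_comp:
  assumes "is_nat_trans C C F G s" "is_nat_trans C C G H t"
  shows "is_nat_trans C C F H (\<lambda>X. t X \<cdot>\<^bsub>C\<^esub> s X)"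
proof -
  have f: "is_functor C C F" "is_functor C C G" "is_functor C C H"
    and c: "is_category C" using assms by (auto simp: is_nat_trans_def is_functor_def)
  interpret ccat C by unfold_locales (rule c)
  interpret F: endofunctor C F by unfold_locales (rule f)
  interpret G: endofunctor C G by unfold_locales (rule f)
  interpret H: endofunctor C H by unfold_locales (rule f)
  have s: "s X \<in> Hom C (OMap F X) (OMap G X)" and t: "t X \<in> Hom C (OMap G X) (OMap H X)"
    if "X \<in> Obj C" for X
    using assms that by (simp_all add: is_nat_trans_def)
  show ?thesis
    unfolding is_nat_trans_def
  proof (intro conjI ballI allI f)
    fix X assume "X \<in> Obj C"
    then show "t X \<cdot>\<^bsub>C\<^esub> s X \<in> Hom C (OMap F X) (OMap H X)" using s t by blast
  next
    fix X Y f assume f: "f \<in> Hom C X Y"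
    then have o: "X \<in> Obj C" "Y \<in> Obj C" using hom_objs by blast+
    have n: "AMap G f \<cdot>\<^bsub>C\<^esub> s X = s Y \<cdot>\<^bsub>C\<^esub> AMap F f" "AMap H f \<cdot>\<^bsub>C\<^esub> t X = t Y \<cdot>\<^bsub>C\<^esub> AMap G f"
      using assms f by (simp_all add: is_nat_trans_def)
    show "AMap H f \<cdot>\<^bsub>C\<^esub> (t X \<cdot>\<^bsub>C\<^esub> s X) = t Y \<cdot>\<^bsub>C\<^esub> s Y \<cdot>\<^bsub>C\<^esub> AMap F f"
      using s[OF o(1)] s[OF o(2)] t[OF o(1)] t[OF o(2)] f n(1) extend[OF n(2), of "s X"]
      by (simp add: Hom_def assoc)
  qed
qed

text \<open>The pushout in a corner-product map is an end corner: a map out of \<open>S B = B + B\<close> is a pair of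
  maps on \<open>B\<close>, and compatibility on \<open>S A\<close> can be tested on the two summands \<open>A\<close>.\<close>
lemma strong_quillen_cylinder_lifts:
  assumes c: "is_category C" and M: "premodel_category \<kappa> C M"
    and po: "\<And>f g X Y Z. f \<in> Hom C X Y \<Longrightarrow> g \<in> Hom C X Z \<Longrightarrow> \<exists>a b. is_pushout C f g a b"
    and cyl: "strong_quillen_cylinder C M S s0 s1 I i p"
  shows "\<exists>G \<phi> e. quillen_cylinder C M I G \<phi> e p"
proof -
  interpret ccat C by unfold_locales (rule c)
  define s where "s = (\<lambda>b. if b then s1 else s0)"
  define e where "e = (\<lambda>b X. i X \<cdot>\<^bsub>C\<^esub> s b X)"
  have nat: "is_nat_trans C C id_functor S (s b)" "is_nat_trans C C S I i"
    "is_nat_trans C C I id_functor p" for b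
    using cyl by (simp_all add: strong_quillen_cylinder_def s_def)
  have cop: "is_coproduct C X X (OMap S X) (s False X) (s True X)" if "X \<in> Obj C" for X
    using cyl that by (simp add: strong_quillen_cylinder_def s_def)
  have enat: "is_nat_trans C C id_functor I (e b)" for b
    using nat_trans_comp[OF nat(1,2)] by (simp add: e_def)
  have I: "is_functor C C I" using nat(2) by (simp add: is_nat_trans_def)
  obtain G \<phi> where G: "is_adjunction C C I G \<phi>"
    using cyl by (auto simp: strong_quillen_cylinder_def is_left_adjoint_def)
  interpret ends C I e by unfold_locales (use I enat in auto)
  interpret S: endofunctor C S
    by unfold_locales (use nat(2) in \<open>simp add: is_nat_trans_def\<close>)
  have s: "s b X \<in> Hom C X (OMap S X)" and i: "i X \<in> Hom C (OMap S X) (OMap I X)"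
    and p: "p X \<in> Hom C (OMap I X) X" if "X \<in> Obj C" for X b
    using nat(1)[of b] nat(2,3) that by (simp_all add: is_nat_trans_def id_functor_def)
  have pe: "p X \<cdot>\<^bsub>C\<^esub> e b X = Ident C X" if "X \<in> Obj C" for X b
  proof -
    have "p X \<cdot>\<^bsub>C\<^esub> e b X = (p X \<cdot>\<^bsub>C\<^esub> i X) \<cdot>\<^bsub>C\<^esub> s b X"
      using s[OF that, of b] i[OF that] p[OF that] by (simp add: e_def Hom_def assoc)
    also have "\<dots> = Ident C X"
      using cyl that by (cases b) (simp_all add: strong_quillen_cylinder_def s_def)
    finally show ?thesis .
  qed
  \<comment> \<open>The corner maps of \<open>i\<close> and of \<open>i \<cdot> s0\<close> are the end corners for both ends and for one end.\<close>
  have both: "\<exists>P a c w. is_end_corner UNIV v P a c w \<and> is_corner_product C C S I i v w"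
    if v: "v \<in> Arr C" for v
  proof -
    obtain A B where v: "v \<in> Hom C A B" using v by (auto simp: Hom_def)
    have o [simp]: "A \<in> Obj C" "B \<in> Obj C" "Dom C v = A" "Cod C v = B" "v \<in> Arr C"
      using hom_objs[OF v] v by (auto simp: Hom_def)
    have snat: "AMap S v \<cdot>\<^bsub>C\<^esub> s b A = s b B \<cdot>\<^bsub>C\<^esub> v" for b
      using nat(1)[of b] v by (simp add: is_nat_trans_def id_functor_def)
    have inat: "AMap I v \<cdot>\<^bsub>C\<^esub> i A = i B \<cdot>\<^bsub>C\<^esub> AMap S v"
      using nat(2) v by (simp add: is_nat_trans_def)
    note sA = s[OF o(1)] and sB = s[OF o(2)] and iA = i[OF o(1)] and iB = i[OF o(2)]
    obtain a c where p: "is_pushout C (AMap S v) (i A) a c"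
      using po[OF S.I_hom[OF v] iA] by blast
    define P where "P = Cod C a"
    have t: "a \<in> Hom C (OMap S B) P" "c \<in> Hom C (OMap I A) P" "a \<cdot>\<^bsub>C\<^esub> AMap S v = c \<cdot>\<^bsub>C\<^esub> i A"
      using pushout_homs[OF p] iA by (simp_all add: P_def Hom_def)
    have ciA: "Cod C (i A) = OMap I A" using iA by (simp add: Hom_def)
    obtain w where w: "w \<in> Hom C P (OMap I B)" "w \<cdot>\<^bsub>C\<^esub> a = i B" "w \<cdot>\<^bsub>C\<^esub> c = AMap I v"
    proof (rule pushout_ex[OF p, of "i B" "OMap I B" "AMap I v"])
      show "i B \<cdot>\<^bsub>C\<^esub> AMap S v = AMap I v \<cdot>\<^bsub>C\<^esub> i A" by (simp add: inat)
    qed (use iB ciA I_hom[OF v] that in \<open>auto simp: P_def\<close>)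
    have "is_corner_product C C S I i v w"
      unfolding is_corner_product_def using v p w by (auto simp: P_def)
    moreover have "is_end_corner UNIV v P (\<lambda>b. a \<cdot>\<^bsub>C\<^esub> s b B) c w"
      unfolding is_end_corner_def end_compatible_def
    proof (intro conjI ballI allI impI)
      fix b show "a \<cdot>\<^bsub>C\<^esub> s b B \<in> Hom C (Cod C v) P" using comp_hom[OF sB t(1)] by simp
      show "a \<cdot>\<^bsub>C\<^esub> s b B \<cdot>\<^bsub>C\<^esub> v = c \<cdot>\<^bsub>C\<^esub> e b (Dom C v)"
        using t sA[of b] sB[of b] v iA extend[OF t(3), of "s b A"]
        by (simp add: e_def Hom_def assoc snat)
      show "w \<cdot>\<^bsub>C\<^esub> (a \<cdot>\<^bsub>C\<^esub> s b B) = e b (Cod C v)"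
        using w t sB[of b] extend[OF w(2), of "s b B"] by (simp add: e_def Hom_def)
    next
      fix Q g H
      assume gH: "(\<forall>b\<in>UNIV. g b \<in> Hom C (Cod C v) Q) \<and> H \<in> Hom C (OMap I (Dom C v)) Q \<and>
        (\<forall>b\<in>UNIV. g b \<cdot>\<^bsub>C\<^esub> v = H \<cdot>\<^bsub>C\<^esub> e b (Dom C v))"
      then have g: "g b \<in> Hom C B Q" "g b \<cdot>\<^bsub>C\<^esub> v = H \<cdot>\<^bsub>C\<^esub> e b A" for b by simp_all
      from gH have H: "H \<in> Hom C (OMap I A) Q" by simp
      obtain m where m: "m \<in> Hom C (OMap S B) Q" "m \<cdot>\<^bsub>C\<^esub> s False B = g False"
        "m \<cdot>\<^bsub>C\<^esub> s True B = g True"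
        using coproduct_ex[OF cop[OF o(2)] g(1)[of False] g(1)[of True]] .
      have mb: "m \<cdot>\<^bsub>C\<^esub> s b B = g b" for b using m by (cases b) simp_all
      have "(m \<cdot>\<^bsub>C\<^esub> AMap S v) \<cdot>\<^bsub>C\<^esub> s b A = (H \<cdot>\<^bsub>C\<^esub> i A) \<cdot>\<^bsub>C\<^esub> s b A" for b
        using m(1) H iA sA[of b] sB[of b] v extend[OF mb[of b], of v] g(2)[of b]
        by (simp add: Hom_def assoc snat e_def)
      then have "m \<cdot>\<^bsub>C\<^esub> AMap S v = H \<cdot>\<^bsub>C\<^esub> i A"
        by (intro coproduct_eq[OF cop[OF o(1)] comp_hom[OF S.I_hom[OF v] m(1)] comp_hom[OF iA H]])
      then obtain h where h: "h \<in> Hom C P Q" "h \<cdot>\<^bsub>C\<^esub> a = m" "h \<cdot>\<^bsub>C\<^esub> c = H"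
        using pushout_ex[OF p, of m Q H] m(1) H ciA by (auto simp: P_def)
      have "h \<cdot>\<^bsub>C\<^esub> (a \<cdot>\<^bsub>C\<^esub> s b B) = g b" for b
        using h t sB[of b] extend[OF h(2), of "s b B"] mb by (simp add: Hom_def)
      then show "\<exists>h\<in>Hom C P Q. (\<forall>b\<in>UNIV. h \<cdot>\<^bsub>C\<^esub> (a \<cdot>\<^bsub>C\<^esub> s b B) = g b) \<and> h \<cdot>\<^bsub>C\<^esub> c = H"
        using h by blast
    next
      fix Q h k
      assume h: "h \<in> Hom C P Q" and k: "k \<in> Hom C P Q"
        and eq: "\<forall>b\<in>UNIV. h \<cdot>\<^bsub>C\<^esub> (a \<cdot>\<^bsub>C\<^esub> s b B) = k \<cdot>\<^bsub>C\<^esub> (a \<cdot>\<^bsub>C\<^esub> s b B)" "h \<cdot>\<^bsub>C\<^esub> c = k \<cdot>\<^bsub>C\<^esub> c"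
      have eqb: "(h \<cdot>\<^bsub>C\<^esub> a) \<cdot>\<^bsub>C\<^esub> s b B = (k \<cdot>\<^bsub>C\<^esub> a) \<cdot>\<^bsub>C\<^esub> s b B" for b
        using eq(1)[THEN bspec[of _ _ b]] h k t sB[of b] by (simp add: Hom_def assoc)
      have "h \<cdot>\<^bsub>C\<^esub> a = k \<cdot>\<^bsub>C\<^esub> a"
        by (rule coproduct_eq[OF cop[OF o(2)] comp_hom[OF t(1) h] comp_hom[OF t(1) k] eqb eqb])
      then show "h = k" using pushout_eq[OF p _ _ _ eq(2)] h k by (simp add: P_def)
    qed (use t w in simp_all)
    ultimately show ?thesis by blast
  qed
  have one: "\<exists>P a c w. is_end_corner {False} v P a c w \<and>
      is_corner_product C C id_functor I (\<lambda>X. i X \<cdot>\<^bsub>C\<^esub> s0 X) v w" if v: "v \<in> Arr C" for v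
  proof -
    obtain A B where v: "v \<in> Hom C A B" using v by (auto simp: Hom_def)
    have o [simp]: "A \<in> Obj C" "B \<in> Obj C" "Dom C v = A" "Cod C v = B" "v \<in> Arr C"
      using hom_objs[OF v] v by (auto simp: Hom_def)
    obtain a c where p: "is_pushout C v (e False A) a c"
      using po[OF v e_hom[OF o(1), of False]] by blast
    define P where "P = Cod C a"
    have t: "a \<in> Hom C B P" "c \<in> Hom C (OMap I A) P" "a \<cdot>\<^bsub>C\<^esub> v = c \<cdot>\<^bsub>C\<^esub> e False A"
      using pushout_homs[OF p] by (simp_all add: P_def)
    obtain w where w: "w \<in> Hom C P (OMap I B)" "w \<cdot>\<^bsub>C\<^esub> a = e False B" "w \<cdot>\<^bsub>C\<^esub> c = AMap I v"
      using pushout_ex[OF p, of "e False B" "OMap I B" "AMap I v"] e_hom[of B False] I_hom[OF v]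
        e_nat[of v A False] by (auto simp: P_def)
    have e0: "(\<lambda>X. i X \<cdot>\<^bsub>C\<^esub> s0 X) = e False" by (simp add: e_def s_def)
    have "is_corner_product C C id_functor I (\<lambda>X. i X \<cdot>\<^bsub>C\<^esub> s0 X) v w"
      unfolding is_corner_product_def e0 using v p w by (auto simp: P_def id_functor_def)
    moreover have "is_end_corner {False} v P (\<lambda>_. a) c w"
      unfolding is_end_corner_def end_compatible_def
    proof (intro conjI allI impI ballI)
      fix Q g H
      assume "(\<forall>b\<in>{False}. g b \<in> Hom C (Cod C v) Q) \<and> H \<in> Hom C (OMap I (Dom C v)) Q \<and>
        (\<forall>b\<in>{False}. g b \<cdot>\<^bsub>C\<^esub> v = H \<cdot>\<^bsub>C\<^esub> e b (Dom C v))"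
      then show "\<exists>h\<in>Hom C P Q. (\<forall>b\<in>{False}. h \<cdot>\<^bsub>C\<^esub> a = g b) \<and> h \<cdot>\<^bsub>C\<^esub> c = H"
        using pushout_ex[OF p, of "g False" Q H] by (auto simp: P_def)
    next
      fix Q h k
      assume "h \<in> Hom C P Q" "k \<in> Hom C P Q" "\<forall>b\<in>{False}. h \<cdot>\<^bsub>C\<^esub> a = k \<cdot>\<^bsub>C\<^esub> a" "h \<cdot>\<^bsub>C\<^esub> c = k \<cdot>\<^bsub>C\<^esub> c"
      then show "h = k"
        using pushout_eq[OF p, of h Q k] unfolding P_def by blast
    qed (use t w in simp_all)
    ultimately show ?thesis by blast
  qed
  have lifts: "lifts_against C w q \<longleftrightarrow> end_lifts C I e T v q"
    if "is_end_corner T v P a c w" "v \<in> Arr C" "q \<in> Arr C" for T v P a c w q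
    using corner_lifts_iff[OF that(1)] that(2,3) by (simp add: Hom_def)
  have wfs: "weak_factorization_system C (Cof M) (AnFib M)"
    "weak_factorization_system C (AnCof M) (Fib M)"
    using M by (simp_all add: premodel_category_def)
  have "quillen_cylinder C M I G \<phi> e p"
    unfolding quillen_cylinder_def
  proof (intro conjI ballI allI G enat nat(3) pe)
    fix v q assume v: "v \<in> Cof M" and q: "q \<in> AnFib M"
    note a = wfs_arr(1)[OF wfs(1) v] wfs_arr(2)[OF wfs(1) q]
    from both[OF a(1)] obtain P a c w where
      w: "is_end_corner UNIV v P a c w" "is_corner_product C C S I i v w" by blast
    then have "w \<in> Cof M"
      using v cyl by (auto simp: strong_quillen_cylinder_def cofibration_trans_def)
    then show "end_lifts C I e UNIV v q" using lifts[OF w(1) a] wfs_lifts[OF wfs(1) _ q] by simp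
  next
    fix v q assume v: "v \<in> AnCof M" and q: "q \<in> Fib M"
    note a = wfs_arr(1)[OF wfs(2) v] wfs_arr(2)[OF wfs(2) q]
    from both[OF a(1)] obtain P a c w where
      w: "is_end_corner UNIV v P a c w" "is_corner_product C C S I i v w" by blast
    then have "w \<in> AnCof M"
      using v cyl by (auto simp: strong_quillen_cylinder_def cofibration_trans_def)
    then show "end_lifts C I e UNIV v q" using lifts[OF w(1) a] wfs_lifts[OF wfs(2) _ q] by simp
  next
    fix v q assume v: "v \<in> Cof M" and q: "q \<in> Fib M"
    note a = wfs_arr(1)[OF wfs(1) v] wfs_arr(2)[OF wfs(2) q]
    from one[OF a(1)] obtain P a c w where
      w: "is_end_corner {False} v P a c w"
        "is_corner_product C C id_functor I (\<lambda>X. i X \<cdot>\<^bsub>C\<^esub> s0 X) v w" by blast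
    then have "w \<in> AnCof M"
      using v cyl by (auto simp: strong_quillen_cylinder_def anodyne_cofibration_trans_def)
    then show "end_lifts C I e {False} v q" using lifts[OF w(1) a] wfs_lifts[OF wfs(2) _ q] by simp
  qed
  then show ?thesis by blast
qed

section \<open>Acyclic cofibrations and the left core\<close>

context ccat
begin

lemma pushout_sym: "is_pushout C f g a b \<Longrightarrow> is_pushout C g f b a"
proof -
  assume po: "is_pushout C f g a b"
  note t = pushout_homs[OF po]
  show ?thesis
    unfolding is_pushout_def
  proof (intro exI conjI allI ballI impI)
    show "g \<in> Hom C (Dom C f) (Cod C g)" "f \<in> Hom C (Dom C f) (Cod C f)"
      "b \<in> Hom C (Cod C g) (Cod C a)" "a \<in> Hom C (Cod C f) (Cod C a)" "b \<cdot> g = a \<cdot> f"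
      using t by simp_all
    fix T u v assume "u \<in> Hom C (Cod C g) T" "v \<in> Hom C (Cod C f) T" "u \<cdot> g = v \<cdot> f"
    from pushout_univ[OF po this(2,1) this(3)[symmetric]]
    show "\<exists>!h. h \<in> Hom C (Cod C a) T \<and> h \<cdot> b = u \<and> h \<cdot> a = v" by (metis (no_types))
  qed
qed

lemma fibrant_factor:
  assumes wfs: "weak_factorization_system C AK F" and T: "is_terminal C T" and X: "X \<in> Obj C"
  obtains X' k where "k \<in> AK" "k \<in> Hom C X X'" "fibrant C F X'"
proof -
  obtain f where "f \<in> Hom C X T" using T X unfolding is_terminal_def by blast
  then obtain k t X' where "k \<in> AK" "t \<in> F" "k \<in> Hom C X X'" "t \<in> Hom C X' T"
    using wfs_factor[OF wfs] by metis
  then show ?thesis using that T unfolding fibrant_def by blast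
qed

lemma extend_to_fibrant:
  assumes wfs: "weak_factorization_system C AK F" and F: "fibrant C F Z"
    and k: "k \<in> AK" "k \<in> Hom C X Y" and f: "f \<in> Hom C X Z"
  obtains g where "g \<in> Hom C Y Z" "g \<cdot> k = f"
proof -
  obtain T t where t: "is_terminal C T" "t \<in> Hom C Z T" "t \<in> F"
    using F unfolding fibrant_def by blast
  obtain v where v: "v \<in> Hom C Y T" using t k hom_objs unfolding is_terminal_def by blast
  have "t \<cdot> f = v \<cdot> k"
    using terminal_unique[OF t(1)] comp_hom[OF f t(2)] comp_hom[OF k(2) v] by blast
  from liftsE[OF wfs_lifts[OF wfs k(1) t(3)] k(2) t(2) f v this] that show ?thesis by blast
qed

lemma fibrant_total:
  assumes wfs: "weak_factorization_system C AK F" and F: "fibrant C F Z"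
    and p: "p \<in> F" "p \<in> Hom C X Z"
  shows "fibrant C F X"
proof -
  obtain T t where t: "is_terminal C T" "t \<in> Hom C Z T" "t \<in> F"
    using F unfolding fibrant_def by blast
  then show ?thesis
    using wfs_right_comp[OF wfs p(1) t(3) p(2) t(2)] comp_hom[OF p(2) t(2)]
    unfolding fibrant_def by blast
qed

lemma cofibrant_total:
  assumes wfs: "weak_factorization_system C K AF" and F: "cofibrant C K Z"
    and p: "p \<in> K" "p \<in> Hom C Z X"
  shows "cofibrant C K X"
proof -
  interpret op: ccat "opposite C" by (rule ccat_opposite)
  show ?thesis using op.fibrant_total[of AF K Z p X] assms by simp
qed

text \<open>An acyclic cofibration \<open>j\<close> becomes anodyne after composition with an anodyne replacement \<open>k\<close>
  of its target by a fibrant object. Indeed, factor \<open>k \<cdot> j = q \<cdot> d\<close> with \<open>d\<close> anodyne; then \<open>q\<close> is a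
  fibration between fibrant objects, so \<open>j\<close> lifts against it, and extending the lift along \<open>k\<close>
  exhibits \<open>k \<cdot> j\<close> as a retract of \<open>d\<close>. With the converse \<open>acyclic_cofibI\<close> this describes acyclicity by
  anodyne maps alone, so that it can be combined with the conditions on the cylinder.\<close>
lemma acyclic_cofib_extend:
  assumes wfs: "weak_factorization_system C (AnCof M) (Fib M)" and T: "is_terminal C T"
    and j: "j \<in> acyclic_cofibs C M" "j \<in> Hom C A B"
  obtains k B' where "k \<in> AnCof M" "k \<in> Hom C B B'" "k \<cdot> j \<in> AnCof M"
proof -
  have o: "A \<in> Obj C" "B \<in> Obj C" using hom_objs[OF j(2)] by auto
  obtain k B' where k: "k \<in> AnCof M" "k \<in> Hom C B B'" "fibrant C (Fib M) B'"
    using fibrant_factor[OF wfs T o(2)] .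
  obtain d q D where d: "d \<in> AnCof M" "q \<in> Fib M" "d \<in> Hom C A D" "q \<in> Hom C D B'" "k \<cdot> j = q \<cdot> d"
    using wfs_factor[OF wfs comp_hom[OF j(2) k(2)]] .
  have "fibrant C (Fib M) D" using fibrant_total[OF wfs k(3) d(2,4)] .
  then have "lifts_against C j q"
    using j d k unfolding acyclic_cofibs_def by (auto simp: Hom_def)
  from liftsE[OF this j(2) d(4) d(3) k(2) d(5)[symmetric]]
  obtain h where h: "h \<in> Hom C B D" "h \<cdot> j = d" "q \<cdot> h = k" .
  have "B' \<in> Obj C" using hom_objs[OF k(2)] by auto
  from liftsE[OF wfs_lifts[OF wfs k(1) d(2)] k(2) d(4) h(1) ident_hom[OF this]]
  obtain m where m: "m \<in> Hom C B' D" "m \<cdot> k = h" "q \<cdot> m = Ident C B'"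
    using h(3) k(2) by (auto simp: Hom_def)
  \<comment> \<open>\<open>k \<cdot> j\<close> is a retract of \<open>d\<close>, by \<open>m\<close> and \<open>q\<close>.\<close>
  have "is_retract C (k \<cdot> j) d"
    unfolding is_retract_def
  proof (intro bexI conjI)
    show "Ident C A \<in> Hom C (Dom C (k \<cdot> j)) (Dom C d)" "Ident C A \<in> Hom C (Dom C d) (Dom C (k \<cdot> j))"
      "m \<in> Hom C (Cod C (k \<cdot> j)) (Cod C d)" "q \<in> Hom C (Cod C d) (Cod C (k \<cdot> j))"
      using m(1) d(3,4) j(2) k(2) o by (auto simp: Hom_def)
    show "Ident C A \<cdot> Ident C A = Ident C (Dom C (k \<cdot> j))" "q \<cdot> m = Ident C (Cod C (k \<cdot> j))"
      using m(3) j(2) k(2) o by (simp_all add: Hom_def)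
    show "d \<cdot> Ident C A = m \<cdot> (k \<cdot> j)"
      using m d(3) h j(2) k(2) o extend[OF m(2), of j] by (simp add: Hom_def)
    show "k \<cdot> j \<cdot> Ident C A = q \<cdot> d"
      using d(3-5) j(2) k(2) o by (simp add: Hom_def)
  qed
  then have "k \<cdot> j \<in> AnCof M"
    using wfs_retract[OF wfs] d(1) comp_hom[OF j(2) k(2)] unfolding retract_closed_def by blast
  with k that show ?thesis by blast
qed

text \<open>A lifting problem against a fibration with fibrant target extends along \<open>k\<close> to one for
  \<open>k \<cdot> j\<close>.\<close>
lemma acyclic_cofibI:
  assumes wfs: "weak_factorization_system C (AnCof M) (Fib M)"
    and j: "j \<in> Cof M" "j \<in> Hom C A B" and k: "k \<in> AnCof M" "k \<in> Hom C B B'" "k \<cdot> j \<in> AnCof M"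
  shows "j \<in> acyclic_cofibs C M"
  unfolding acyclic_cofibs_def
proof (intro CollectI conjI ballI impI j(1))
  fix q assume q: "q \<in> Fib M" and f: "fibrant C (Fib M) (Dom C q) \<and> fibrant C (Fib M) (Cod C q)"
  have qh: "q \<in> Hom C (Dom C q) (Cod C q)" using wfs_arr(2)[OF wfs q] by (simp add: Hom_def)
  show "lifts_against C j q"
  proof (rule liftsI[OF j(2) qh])
    fix u v assume u: "u \<in> Hom C A (Dom C q)" and v: "v \<in> Hom C B (Cod C q)" and e: "q \<cdot> u = v \<cdot> j"
    obtain v' where v': "v' \<in> Hom C B' (Cod C q)" "v' \<cdot> k = v"
      using extend_to_fibrant[OF wfs _ k(1,2) v] f by blast
    have "q \<cdot> u = v' \<cdot> (k \<cdot> j)"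
      using e v' k(2) j(2) extend[OF v'(2), of j] by (simp add: Hom_def)
    from liftsE[OF wfs_lifts[OF wfs k(3) q] comp_hom[OF j(2) k(2)] qh u v'(1) this]
    obtain h where h: "h \<in> Hom C B' (Dom C q)" "h \<cdot> (k \<cdot> j) = u" "q \<cdot> h = v'" .
    have "h \<cdot> k \<cdot> j = u" "q \<cdot> (h \<cdot> k) = v"
      using h v' k(2) j(2) qh extend[OF h(3), of k] by (simp_all add: Hom_def assoc)
    then show "\<exists>h\<in>Hom C B (Dom C q). h \<cdot> j = u \<and> q \<cdot> h = v"
      using comp_hom[OF k(2) h(1)] by blast
  qed
qed

end

text \<open>\<open>M\<close> is the structure that carries the cylinder and \<open>N\<close> the one to be shown semi-model. What the
  two share is used in the form of \<open>core_cof_iff\<close>, \<open>core_anodyne_transfer\<close> and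
  \<open>core_anodyne_extend\<close>.\<close>
locale same_left_core = cylinder +
  fixes M N :: "'b premodel_structure"
  assumes M_wfs: "weak_factorization_system C (Cof M) (AnFib M)"
      "weak_factorization_system C (AnCof M) (Fib M)" "AnCof M \<subseteq> Cof M"
    and N_wfs: "weak_factorization_system C (Cof N) (AnFib N)"
      "weak_factorization_system C (AnCof N) (Fib N)" "AnCof N \<subseteq> Cof N"
    and cyl_lifts: "v \<in> Cof M \<Longrightarrow> q \<in> AnFib M \<Longrightarrow> end_lifts C I e UNIV v q"
      "v \<in> AnCof M \<Longrightarrow> q \<in> Fib M \<Longrightarrow> end_lifts C I e UNIV v q"
      "v \<in> Cof M \<Longrightarrow> q \<in> Fib M \<Longrightarrow> end_lifts C I e {False} v q"
    and initial: "\<exists>Z. is_initial C Z" and terminal: "\<exists>Z. is_terminal C Z"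
    and pushouts: "f \<in> Hom C X Y \<Longrightarrow> g \<in> Hom C X Z \<Longrightarrow> \<exists>a b. is_pushout C f g a b"
    and core_cofs: "core_cofibs C (Cof N) = core_cofibs C (Cof M)"
    and core_acyclic: "acyclic_cofibs C N \<inter> core_cofibs C (Cof N) =
      acyclic_cofibs C M \<inter> core_cofibs C (Cof M)"
    and left_sat: "core_left_saturated C N" and right_sat: "right_saturated C N"
begin

abbreviation "cofb \<equiv> cofibrant C (Cof N)"
abbreviation "fibr \<equiv> fibrant C (Fib N)"

lemma cofb_obj: "cofibrant C K X \<Longrightarrow> X \<in> Obj C"
  unfolding cofibrant_def using hom_objs by blast

lemma fibr_obj: "fibrant C K X \<Longrightarrow> X \<in> Obj C"
  unfolding fibrant_def using hom_objs by blast

lemma cofb_iff: "cofibrant C (Cof M) X \<longleftrightarrow> cofb X"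
proof -
  have "cofibrant C (Cof M') X \<longleftrightarrow> Ident C X \<in> core_cofibs C (Cof M') \<and> X \<in> Obj C"
    if "weak_factorization_system C (Cof M') (AnFib M')" for M'
    using wfs_ident[OF that, of X] cofb_obj[of "Cof M'" X] by (auto simp: core_cofibs_def)
  from this[OF M_wfs(1)] this[OF N_wfs(1)] core_cofs show ?thesis by simp
qed

lemma cofb_initial: "is_initial C Z \<Longrightarrow> cofb Z"
  using wfs_ident[OF N_wfs(1), of Z] ident_hom[of Z]
  unfolding cofibrant_def by (auto simp: is_initial_def)

lemma cofb_cod: "v \<in> Cof N \<Longrightarrow> v \<in> Hom C A B \<Longrightarrow> cofb A \<Longrightarrow> cofb B"
  using cofibrant_total[OF N_wfs(1)] by blast

lemma core_cof_iff: "v \<in> Hom C A B \<Longrightarrow> cofb A \<Longrightarrow> v \<in> Cof M \<longleftrightarrow> v \<in> Cof N"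
proof -
  assume v: "v \<in> Hom C A B" "cofb A"
  then have "Dom C v = A" by (simp add: Hom_def)
  then have "v \<in> Cof M \<longleftrightarrow> v \<in> core_cofibs C (Cof M)" "v \<in> Cof N \<longleftrightarrow> v \<in> core_cofibs C (Cof N)"
    using v cofb_iff unfolding core_cofibs_def by auto
  then show ?thesis using core_cofs by simp
qed

lemma anodyne_acyclic:
  "weak_factorization_system C (AnCof M') (Fib M') \<Longrightarrow> AnCof M' \<subseteq> Cof M' \<Longrightarrow>
    v \<in> AnCof M' \<Longrightarrow> v \<in> acyclic_cofibs C M'"
  using wfs_lifts[of "AnCof M'" "Fib M'" v] unfolding acyclic_cofibs_def by blast

lemma core_acyclic_anodyne:
  assumes "v \<in> acyclic_cofibs C N" "v \<in> Hom C A B" "cofb A"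
  shows "v \<in> AnCof N"
  using assms left_sat unfolding core_left_saturated_def core_cofibs_def acyclic_cofibs_def
  by (auto simp: Hom_def)

lemma core_anodyne_transfer:
  assumes v: "v \<in> AnCof M" "v \<in> Hom C A B" "cofb A"
  shows "v \<in> AnCof N"
proof (rule core_acyclic_anodyne[OF _ v(2,3)])
  have "Dom C v = A" using v by (simp add: Hom_def)
  then have "v \<in> acyclic_cofibs C M \<inter> core_cofibs C (Cof M)"
    using anodyne_acyclic[OF M_wfs(2,3) v(1)] v M_wfs(3) cofb_iff by (auto simp: core_cofibs_def)
  then show "v \<in> acyclic_cofibs C N" using core_acyclic by blast
qed

text \<open>In the direction from \<open>N\<close> to \<open>M\<close> only acyclicity is preserved, so an anodyne core cofibration
  of \<open>N\<close> is anodyne in \<open>M\<close> only up to composition with some \<open>k\<close>.\<close>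
lemma core_anodyne_extend:
  assumes v: "v \<in> AnCof N" "v \<in> Hom C A B" "cofb A"
  obtains k B' where "k \<in> AnCof M" "k \<in> Hom C B B'" "k \<cdot> v \<in> AnCof M"
proof -
  have "Dom C v = A" using v by (simp add: Hom_def)
  then have "v \<in> acyclic_cofibs C N \<inter> core_cofibs C (Cof N)"
    using anodyne_acyclic[OF N_wfs(2,3) v(1)] v N_wfs(3) by (auto simp: core_cofibs_def)
  then have "v \<in> acyclic_cofibs C M" using core_acyclic by blast
  moreover obtain T where "is_terminal C T" using terminal by blast
  ultimately show ?thesis using acyclic_cofib_extend[OF M_wfs(2) _ _ v(2)] that by blast
qed

lemma AnFib_subset: "AnFib N \<subseteq> Fib N"
  using anodyne_fibs_subset N_wfs by blast

section \<open>Corners of core cofibrations\<close>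

lemma cofb_from_initial:
  assumes "cofb X"
  obtains Z z where "is_initial C Z" "z \<in> Hom C Z X" "z \<in> Cof N" "z \<in> Cof M" "cofb Z"
  using assms cofb_initial core_cof_iff unfolding cofibrant_def by metis

text \<open>The one-ended corner condition for the cofibration \<open>Z \<rightarrow> X\<close> out of an initial object: \<open>I\<close>
  preserves initial objects, so the part of the problem on \<open>I Z\<close> is vacuous.\<close>
lemma end_anodyne:
  assumes "cofb X"
  shows "e False X \<in> AnCof N"
proof -
  have X: "X \<in> Obj C" using cofb_obj[OF assms] .
  obtain Z z where z: "is_initial C Z" "z \<in> Hom C Z X" "z \<in> Cof M"
    using cofb_from_initial[OF assms] .
  have "e False X \<in> AnCof M"
  proof (rule wfs_leftI[OF M_wfs(2)])
    show "e False X \<in> Arr C" using X by simp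
    fix q assume q: "q \<in> Fib M"
    have qh: "q \<in> Hom C (Dom C q) (Cod C q)" using wfs_arr(2)[OF M_wfs(2) q] by (simp add: Hom_def)
    show "lifts_against C (e False X) q"
    proof (rule liftsI[OF e_hom[OF X] qh])
      fix u v assume u: "u \<in> Hom C X (Dom C q)" and v: "v \<in> Hom C (OMap I X) (Cod C q)"
        and eq: "q \<cdot> u = v \<cdot> e False X"
      note IZ = I_initial[OF z(1)]
      obtain H where H: "H \<in> Hom C (OMap I Z) (Dom C q)"
        using IZ hom_objs[OF qh] unfolding is_initial_def by blast
      obtain L where L: "L \<in> Hom C (OMap I X) (Dom C q)" "\<forall>b \<in> {False}. L \<cdot> e b X = u"
        "L \<cdot> AMap I z = H" "q \<cdot> L = v"
      proof (rule end_liftsE[OF cyl_lifts(3)[OF z(3) q] z(2) qh _ H v, of "\<lambda>_. u"])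
        show "u \<cdot> z = H \<cdot> e b Z" for b
          using initial_unique[OF z(1) comp_hom[OF z(2) u]] e_hom[of Z b] H z(1)
          by (auto simp: is_initial_def)
        show "q \<cdot> H = v \<cdot> AMap I z"
          using initial_unique[OF IZ comp_hom[OF H qh] comp_hom[OF I_hom[OF z(2)] v]] .
      qed (use u eq that in auto)
      then show "\<exists>h\<in>Hom C (OMap I X) (Dom C q). h \<cdot> e False X = u \<and> q \<cdot> h = v" by blast
    qed
  qed
  then show ?thesis using core_anodyne_transfer[OF _ e_hom[OF X] assms] by blast
qed

lemma cofb_cylinder: "cofb X \<Longrightarrow> cofb (OMap I X)"
  using cofb_cod[OF _ e_hom[of X False]] end_anodyne[of X] N_wfs(3) cofb_obj[of "Cof N" X] by blast

lemma core_corner: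
  assumes v: "v \<in> Cof N" "v \<in> Hom C A B" "cofb A" and T: "T = {False} \<or> T = UNIV"
  obtains P a c w where "is_end_corner T v P a c w" "cofb P"
proof -
  have vM: "v \<in> Cof M" using core_cof_iff v by blast
  obtain P a c w where cor: "is_end_corner T v P a c w" "c \<in> Cof N"
    using corner_exists[OF N_wfs(1) pushouts T v(1,2)] .
  have "cofb P" using cofb_cod[OF cor(2) corner_homs(2)[OF cor(1) v(2)] cofb_cylinder[OF v(3)]] .
  then show ?thesis using that cor by blast
qed

lemma corner_left:
  assumes wfs: "weak_factorization_system C L R" and cor: "is_end_corner T v P a c w"
    and v: "v \<in> Hom C A B" and l: "\<And>q. q \<in> R \<Longrightarrow> end_lifts C I e T v q"
  shows "w \<in> L"
proof (rule wfs_leftI[OF wfs])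
  show "w \<in> Arr C" using corner_homs(4)[OF cor v] by blast
  fix q assume q: "q \<in> R"
  then have "q \<in> Hom C (Dom C q) (Cod C q)" using wfs_arr(2)[OF wfs q] by (simp add: Hom_def)
  from corner_lifts_iff[OF cor v this] l[OF q] show "lifts_against C w q" by simp
qed

lemma core_corner_cof:
  assumes v: "v \<in> Cof N" "v \<in> Hom C A B" "cofb A" and cor: "is_end_corner UNIV v P a c w" "cofb P"
  shows "w \<in> Cof N"
proof -
  have "v \<in> Cof M" using core_cof_iff v by blast
  then have "w \<in> Cof M" using corner_left[OF M_wfs(1) cor(1) v(2) cyl_lifts(1)] by blast
  then show ?thesis using core_cof_iff[OF corner_homs(4)[OF cor(1) v(2)] cor(2)] by blast
qed

text \<open>The corner map of a core cofibration starts at a cofibrant object, so it belongs to the left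
  core and its class can be carried over from \<open>M\<close> to \<open>N\<close>; then it lifts against the fibrations,
  or anodyne fibrations, of \<open>N\<close>.\<close>
lemma end_lifts_core:
  assumes v: "v \<in> Hom C A B" "cofb A"
  shows end_lifts_one: "v \<in> Cof N \<Longrightarrow> q \<in> Fib N \<Longrightarrow> end_lifts C I e {False} v q"
    and end_lifts_both: "v \<in> Cof N \<Longrightarrow> q \<in> AnFib N \<Longrightarrow> end_lifts C I e UNIV v q"
    and end_lifts_anodyne: "v \<in> AnCof M \<Longrightarrow> q \<in> Fib N \<Longrightarrow> end_lifts C I e UNIV v q"
proof -
  have hom: "q \<in> Fib N \<or> q \<in> AnFib N \<Longrightarrow> q \<in> Hom C (Dom C q) (Cod C q)" for q
    using wfs_arr(2)[OF N_wfs(2), of q] AnFib_subset by (auto simp: Hom_def)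
  show "end_lifts C I e {False} v q" if vN: "v \<in> Cof N" and q: "q \<in> Fib N"
  proof -
    have vM: "v \<in> Cof M" using core_cof_iff v vN by blast
    obtain P a c w where cor: "is_end_corner {False} v P a c w" "cofb P"
      using core_corner[OF vN v] by blast
    have "w \<in> AnCof M" using corner_left[OF M_wfs(2) cor(1) v(1) cyl_lifts(3)[OF vM]] .
    then have "w \<in> AnCof N" using core_anodyne_transfer[OF _ corner_homs(4)[OF cor(1) v(1)] cor(2)] by blast
    then show ?thesis
      using corner_lifts_iff[OF cor(1) v(1) hom] q wfs_lifts[OF N_wfs(2)] by blast
  qed
  show "end_lifts C I e UNIV v q" if vN: "v \<in> Cof N" and q: "q \<in> AnFib N"
  proof -
    obtain P a c w where cor: "is_end_corner UNIV v P a c w" "cofb P"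
      using core_corner[OF vN v] by blast
    then have "w \<in> Cof N" using core_corner_cof[OF vN v] by blast
    then show ?thesis
      using corner_lifts_iff[OF cor(1) v(1) hom] q wfs_lifts[OF N_wfs(1)] by blast
  qed
  show "end_lifts C I e UNIV v q" if vM: "v \<in> AnCof M" and q: "q \<in> Fib N"
  proof -
    have vN: "v \<in> Cof N" using core_cof_iff v vM M_wfs(3) by blast
    obtain P a c w where cor: "is_end_corner UNIV v P a c w" "cofb P"
      using core_corner[OF vN v] by blast
    have "w \<in> AnCof M" using corner_left[OF M_wfs(2) cor(1) v(1) cyl_lifts(2)[OF vM]] .
    then have "w \<in> AnCof N" using core_anodyne_transfer[OF _ corner_homs(4)[OF cor(1) v(1)] cor(2)] by blast
    then show ?thesis
      using corner_lifts_iff[OF cor(1) v(1) hom] q wfs_lifts[OF N_wfs(2)] by blast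
  qed
qed

section \<open>Homotopies\<close>

definition homotopic :: "'a \<Rightarrow> 'a \<Rightarrow> 'b \<Rightarrow> 'b \<Rightarrow> bool" where
  "homotopic X Y f g \<longleftrightarrow> (\<exists>H \<in> Hom C (OMap I X) Y. H \<cdot> e False X = f \<and> H \<cdot> e True X = g)"

lemma end_lift_fibrant:
  assumes l: "\<And>q. q \<in> Fib N \<Longrightarrow> end_lifts C I e T v q" and v: "v \<in> Hom C A B" and Z: "fibr Z"
    and g: "\<And>b. b \<in> T \<Longrightarrow> g b \<in> Hom C B Z" and H: "H \<in> Hom C (OMap I A) Z"
    and eq: "\<And>b. b \<in> T \<Longrightarrow> g b \<cdot> v = H \<cdot> e b A"
  obtains L where "L \<in> Hom C (OMap I B) Z" "\<forall>b \<in> T. L \<cdot> e b B = g b" "L \<cdot> AMap I v = H"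
proof -
  obtain t U where t: "is_terminal C U" "t \<in> Hom C Z U" "t \<in> Fib N"
    using Z unfolding fibrant_def by blast
  have B: "B \<in> Obj C" using hom_objs[OF v] by simp
  obtain K where K: "K \<in> Hom C (OMap I B) U" using t(1) I_obj[OF B] unfolding is_terminal_def by blast
  obtain L where "L \<in> Hom C (OMap I B) Z" "\<forall>b \<in> T. L \<cdot> e b B = g b" "L \<cdot> AMap I v = H" "t \<cdot> L = K"
  proof (rule end_liftsE[OF l[OF t(3)] v t(2) g H K eq])
    show "t \<cdot> g b = K \<cdot> e b B" if "b \<in> T" for b
      using terminal_unique[OF t(1) comp_hom[OF g[OF that] t(2)] comp_hom[OF e_hom[OF B] K]] .
    show "t \<cdot> H = K \<cdot> AMap I v"
      using terminal_unique[OF t(1) comp_hom[OF H t(2)] comp_hom[OF I_hom[OF v] K]] .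
  qed (use that in auto)
  then show ?thesis using that by blast
qed

lemma homotopic_refl: "f \<in> Hom C X Y \<Longrightarrow> homotopic X Y f f"
proof -
  assume f: "f \<in> Hom C X Y"
  then have X: "X \<in> Obj C" using hom_objs by blast
  have "(f \<cdot> r X) \<cdot> e b X = f" for b
    using f r_hom[OF X] X re[OF X, of b] by (simp add: Hom_def assoc)
  then show ?thesis unfolding homotopic_def using comp_hom[OF r_hom[OF X] f] by blast
qed

text \<open>Maps that agree after an anodyne fibration \<open>q\<close> are homotopic: lift the constant
  homotopy of their common composite along \<open>q\<close>, relative to an initial object.\<close>
lemma anfib_homotopic:
  assumes A: "cofb A" and q: "q \<in> AnFib N" "q \<in> Hom C X Y"
    and f: "f \<in> Hom C A X" "g \<in> Hom C A X" "q \<cdot> f = q \<cdot> g"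
  shows "homotopic A X f g"
proof -
  obtain Z z where z: "is_initial C Z" "z \<in> Hom C Z A" "z \<in> Cof N" "cofb Z"
    using cofb_from_initial[OF A] .
  have o: "A \<in> Obj C" "Z \<in> Obj C" "X \<in> Obj C" using hom_objs z(2) q(2) by blast+
  note IZ = I_initial[OF z(1)]
  obtain H where H: "H \<in> Hom C (OMap I Z) X" using IZ o unfolding is_initial_def by blast
  define m where "m b = (if b then g else f)" for b
  have m: "m b \<in> Hom C A X" "q \<cdot> m b = q \<cdot> f" for b using f by (auto simp: m_def)
  note K = comp_hom[OF r_hom[OF o(1)] comp_hom[OF f(1) q(2)]]
  obtain L where L: "L \<in> Hom C (OMap I A) X" "\<forall>b \<in> UNIV. L \<cdot> e b A = m b"
    "L \<cdot> AMap I z = H" "q \<cdot> L = q \<cdot> f \<cdot> r A"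
  proof (rule end_liftsE[OF end_lifts_both[OF z(2,4,3) q(1)] z(2) q(2) m(1) H K])
    show "m b \<cdot> z = H \<cdot> e b Z" for b
      using initial_unique[OF z(1) comp_hom[OF z(2) m(1)] comp_hom[OF e_hom[OF o(2)] H]] .
    show "q \<cdot> m b = q \<cdot> f \<cdot> r A \<cdot> e b A" for b
      using m[of b] q(2) f(1) r_hom[OF o(1)] re[OF o(1), of b] o by (simp add: Hom_def assoc)
    show "q \<cdot> H = q \<cdot> f \<cdot> r A \<cdot> AMap I z"
      using initial_unique[OF IZ comp_hom[OF H q(2)] comp_hom[OF I_hom[OF z(2)] K]] .
  qed (use that in auto)
  from L(1,2) show ?thesis
    unfolding homotopic_def by (intro bexI[of _ L]) (simp_all add: m_def)
qed

text \<open>Three sides of a box over \<open>B\<close> (the base \<open>K\<close> and the walls \<open>H b\<close>), together with a filled box \<open>S\<close>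
  over \<open>A\<close>, admit a fourth side that agrees with the one of \<open>S\<close> over \<open>A\<close>. The walls and \<open>S\<close> form a map on \<open>I P\<close>, where \<open>P\<close> is the two-ended corner
  object of \<open>v\<close>; it is assembled on the transposed side, as a map \<open>P \<rightarrow> G Z\<close>. The base is
  compatible with it, so the one-ended filling property of the core cofibration \<open>w : P \<rightarrow> I B\<close> gives
  a map on \<open>I (I B)\<close>, whose restriction to the other end is the fourth side.\<close>
lemma box_filling:
  assumes v: "v \<in> Cof N" "v \<in> Hom C A B" "cofb A" and Z: "fibr Z"
    and K: "K \<in> Hom C (OMap I B) Z" and H: "\<And>b. H b \<in> Hom C (OMap I B) Z"
    and G: "S \<in> Hom C (OMap I (OMap I A)) Z"
    and base: "\<And>b. K \<cdot> e b B = H b \<cdot> e False B"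
    and S: "S \<cdot> e False (OMap I A) = K \<cdot> AMap I v" "\<And>b. S \<cdot> AMap I (e b A) = H b \<cdot> AMap I v"
  obtains L where "L \<in> Hom C (OMap I B) Z" "\<forall>b. L \<cdot> e b B = H b \<cdot> e True B"
    "L \<cdot> AMap I v = S \<cdot> e True (OMap I A)"
proof -
  have o: "A \<in> Obj C" "B \<in> Obj C" "Z \<in> Obj C" using hom_objs v(2) K by blast+
  obtain P a c w where cor: "is_end_corner UNIV v P a c w" "cofb P"
    using core_corner[OF v] by blast
  note t = corner_homs[OF cor(1) v(2), simplified]
  have P: "P \<in> Obj C" using hom_objs[OF t(2)] by simp
  have wN: "w \<in> Cof N" using core_corner_cof[OF v cor] .
  obtain h where h: "h \<in> Hom C P (OMap G Z)" "\<forall>b \<in> UNIV. h \<cdot> a b = \<phi> B Z (H b)"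
    "h \<cdot> c = \<phi> (OMap I A) Z S"
  proof (rule corner_ex[OF cor(1) v(2)])
    show "\<phi> B Z (H b) \<in> Hom C B (OMap G Z)" for b using phi_hom[OF H o(2)] .
    show "\<phi> (OMap I A) Z S \<in> Hom C (OMap I A) (OMap G Z)" using phi_hom[OF G] o by simp
    show "\<phi> B Z (H b) \<cdot> v = \<phi> (OMap I A) Z S \<cdot> e b A" for b
      using phi_pre[OF v(2) H[of b]] phi_pre[OF e_hom[OF o(1), of b] G] S(2)[of b] by simp
  qed (use that in auto)
  define J where "J = psi P Z h"
  have J: "J \<in> Hom C (OMap I P) Z" "\<phi> P Z J = h" using psi[OF h(1) o(3)] by (simp_all add: J_def)
  have Ja: "J \<cdot> AMap I (a b) = H b" for b
    using phi_inj[OF _ comp_hom[OF I_hom[OF t(1)] J(1)] H o(2)] phi_pre[OF t(1) J(1), of b] J(2) h(2)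
    by simp
  have Jc: "J \<cdot> AMap I c = S"
    using phi_inj[OF _ comp_hom[OF I_hom[OF t(2)] J(1)] G] phi_pre[OF t(2) J(1)] J(2) h(3) o by simp
  obtain L where L: "L \<in> Hom C (OMap I (OMap I B)) Z" "\<forall>b \<in> {False}. L \<cdot> e b (OMap I B) = K"
    "L \<cdot> AMap I w = J"
  proof (rule end_lift_fibrant[OF end_lifts_one[OF t(4) cor(2) wN] t(4) Z, of "\<lambda>_. K" J])
    have "K \<cdot> w = J \<cdot> e False P"
    proof (rule corner_eq[OF cor(1) comp_hom[OF t(4) K] comp_hom[OF e_hom[OF P] J(1)]])
      show "K \<cdot> w \<cdot> a b = J \<cdot> e False P \<cdot> a b" for b
        using t(1)[of b] t(4,5) K J(1) base[of b] P o extend[OF Ja[of b], of "e False B"]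
        by (simp add: Hom_def assoc e_nat)
      show "K \<cdot> w \<cdot> c = J \<cdot> e False P \<cdot> c"
        using t(2,4,6) K J(1) S(1) P o extend[OF Jc, of "e False (OMap I A)"]
        by (simp add: Hom_def assoc e_nat)
    qed
    then show "K \<cdot> w = J \<cdot> e b P" if "b \<in> {False}" for b using that by simp
  qed (use K J that in auto)
  define D where "D = L \<cdot> e True (OMap I B)"
  have D: "D \<in> Hom C (OMap I B) Z" unfolding D_def using comp_hom[OF e_hom L(1)] o by simp
  have Dw: "D \<cdot> w = J \<cdot> e True P"
    using L(1) t(4) P o extend[OF L(3), of "e True P"] by (simp add: D_def Hom_def assoc e_nat)
  have "D \<cdot> e b B = H b \<cdot> e True B" for b
  proof -
    have "D \<cdot> e b B = (D \<cdot> w) \<cdot> a b"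
      using D t(1)[of b] t(4,5) by (simp add: Hom_def assoc)
    also have "\<dots> = H b \<cdot> e True B"
      unfolding Dw using t(1)[of b] J(1) P o extend[OF Ja[of b], of "e True B"]
      by (simp add: Hom_def assoc e_nat)
    finally show ?thesis .
  qed
  moreover have "D \<cdot> AMap I v = S \<cdot> e True (OMap I A)"
  proof -
    have "D \<cdot> AMap I v = (D \<cdot> w) \<cdot> c"
      using D t(2,4,6) by (simp add: Hom_def assoc)
    also have "\<dots> = S \<cdot> e True (OMap I A)"
      unfolding Dw using t(2) J(1) P o extend[OF Jc, of "e True (OMap I A)"]
      by (simp add: Hom_def assoc e_nat)
    finally show ?thesis .
  qed
  ultimately show ?thesis using that D by blast
qed

text \<open>The box over an initial object has no condition on \<open>A\<close>. Together with constant homotopies it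
  gives symmetry and transitivity.\<close>
lemma homotopic_box:
  assumes X: "cofb X" and Z: "fibr Z" and "homotopic X Z f f'" "homotopic X Z g g'" "homotopic X Z f g"
  shows "homotopic X Z f' g'"
proof -
  obtain O' z where z: "is_initial C O'" "z \<in> Hom C O' X" "z \<in> Cof N" "cofb O'"
    using cofb_from_initial[OF X] .
  obtain F where F: "F \<in> Hom C (OMap I X) Z" "F \<cdot> e False X = f" "F \<cdot> e True X = f'"
    using assms(3) unfolding homotopic_def by blast
  obtain G' where G': "G' \<in> Hom C (OMap I X) Z" "G' \<cdot> e False X = g" "G' \<cdot> e True X = g'"
    using assms(4) unfolding homotopic_def by blast
  obtain K where K: "K \<in> Hom C (OMap I X) Z" "K \<cdot> e False X = f" "K \<cdot> e True X = g"
    using assms(5) unfolding homotopic_def by blast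
  define H where "H b = (if b then G' else F)" for b
  have H: "H b \<in> Hom C (OMap I X) Z" for b using F G' by (simp add: H_def)
  note IO = I_initial[OF z(1)] and IIO = I_initial[OF I_initial[OF z(1)]]
  have o: "O' \<in> Obj C" "Z \<in> Obj C" using hom_objs z(2) K by blast+
  obtain S where S: "S \<in> Hom C (OMap I (OMap I O')) Z" using IIO o unfolding is_initial_def by blast
  obtain L where L: "L \<in> Hom C (OMap I X) Z" "\<forall>b. L \<cdot> e b X = H b \<cdot> e True X"
    "L \<cdot> AMap I z = S \<cdot> e True (OMap I O')"
  proof (rule box_filling[OF z(3,2,4) Z K(1) H S])
    show "K \<cdot> e b X = H b \<cdot> e False X" for b using F G' K by (cases b) (simp_all add: H_def)
    show "S \<cdot> e False (OMap I O') = K \<cdot> AMap I z"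
      using initial_unique[OF IO comp_hom[OF e_hom S] comp_hom[OF I_hom[OF z(2)] K(1)]] o by simp
    show "S \<cdot> AMap I (e b O') = H b \<cdot> AMap I z" for b
      using initial_unique[OF IO comp_hom[OF I_hom[OF e_hom] S] comp_hom[OF I_hom[OF z(2)] H]] o by simp
  qed
  then show ?thesis
    unfolding homotopic_def using F G' by (intro bexI[of _ L]) (simp_all add: H_def)
qed

lemma homotopic_dom: "homotopic X Z f g \<Longrightarrow> X \<in> Obj C \<Longrightarrow> f \<in> Hom C X Z \<and> g \<in> Hom C X Z"
  unfolding homotopic_def using comp_hom[OF e_hom] by blast

lemma homotopic_sym: "cofb X \<Longrightarrow> fibr Z \<Longrightarrow> homotopic X Z f g \<Longrightarrow> homotopic X Z g f"
  using homotopic_box[of X Z f g f f] homotopic_refl[of f X Z] homotopic_dom[of X Z f g]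
    cofb_obj by blast

lemma homotopic_trans:
  "cofb X \<Longrightarrow> fibr Z \<Longrightarrow> homotopic X Z f g \<Longrightarrow> homotopic X Z g h \<Longrightarrow> homotopic X Z f h"
  using homotopic_box[of X Z f f g h] homotopic_refl[of f X Z] homotopic_dom[of X Z f g]
    cofb_obj by blast

lemma homotopic_pre:
  assumes "homotopic X Z f g" "k \<in> Hom C X' X"
  shows "homotopic X' Z (f \<cdot> k) (g \<cdot> k)"
proof -
  have o: "X' \<in> Obj C" "X \<in> Obj C" using hom_objs[OF assms(2)] by auto
  obtain H where H: "H \<in> Hom C (OMap I X) Z" "H \<cdot> e False X = f" "H \<cdot> e True X = g"
    using assms(1) unfolding homotopic_def by blast
  have "(H \<cdot> AMap I k) \<cdot> e b X' = (H \<cdot> e b X) \<cdot> k" for b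
    using H(1) assms(2) o by (simp add: Hom_def assoc e_nat)
  then show ?thesis
    unfolding homotopic_def using H comp_hom[OF I_hom[OF assms(2)] H(1)]
    by (intro bexI[of _ "H \<cdot> AMap I k"]) simp_all
qed

lemma homotopic_post:
  assumes "homotopic X Z f g" "k \<in> Hom C Z Z'" "X \<in> Obj C"
  shows "homotopic X Z' (k \<cdot> f) (k \<cdot> g)"
proof -
  obtain H where H: "H \<in> Hom C (OMap I X) Z" "H \<cdot> e False X = f" "H \<cdot> e True X = g"
    using assms(1) unfolding homotopic_def by blast
  have "(k \<cdot> H) \<cdot> e b X = k \<cdot> (H \<cdot> e b X)" for b
    using H(1) assms(2,3) by (simp add: Hom_def assoc)
  then show ?thesis
    unfolding homotopic_def using H comp_hom[OF H(1) assms(2)]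
    by (intro bexI[of _ "k \<cdot> H"]) simp_all
qed

section \<open>Homotopy equivalences\<close>
text \<open>On maps from a cofibrant object, homotopy is in general an equivalence relation only if the
  target is fibrant. Testing it after all maps into fibrant objects gives an equivalence relation
  for every target, which agrees with homotopy when the target is fibrant.\<close>
definition sim :: "'a \<Rightarrow> 'a \<Rightarrow> 'b \<Rightarrow> 'b \<Rightarrow> bool" where
  "sim X Y f g \<longleftrightarrow> f \<in> Hom C X Y \<and> g \<in> Hom C X Y \<and>
     (\<forall>Z. fibr Z \<longrightarrow> (\<forall>h \<in> Hom C Y Z. homotopic X Z (h \<cdot> f) (h \<cdot> g)))"

lemma sim_hom: "sim X Y f g \<Longrightarrow> f \<in> Hom C X Y" "sim X Y f g \<Longrightarrow> g \<in> Hom C X Y"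
  by (simp_all add: sim_def)

lemma homotopic_sim: "homotopic X Y f g \<Longrightarrow> X \<in> Obj C \<Longrightarrow> sim X Y f g"
  unfolding sim_def using homotopic_dom[of X Y f g] homotopic_post[of X Y f g] by blast

lemma sim_homotopic:
  assumes "sim X Y f g" "fibr Y" shows "homotopic X Y f g"
proof -
  have "homotopic X Y (Ident C Y \<cdot> f) (Ident C Y \<cdot> g)"
    using assms ident_hom[OF fibr_obj[OF assms(2)]] unfolding sim_def by blast
  then show ?thesis using sim_hom[OF assms(1)] by (simp add: Hom_def)
qed

lemma sim_refl: "f \<in> Hom C X Y \<Longrightarrow> sim X Y f f"
  using homotopic_sim[OF homotopic_refl] hom_objs by blast

lemma sim_sym: "cofb X \<Longrightarrow> sim X Y f g \<Longrightarrow> sim X Y g f"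
  unfolding sim_def using homotopic_sym by blast

lemma sim_trans: "cofb X \<Longrightarrow> sim X Y f g \<Longrightarrow> sim X Y g h \<Longrightarrow> sim X Y f h"
  unfolding sim_def using homotopic_trans by blast

lemma sim_pre:
  assumes "sim X Y f g" "k \<in> Hom C X' X" shows "sim X' Y (f \<cdot> k) (g \<cdot> k)"
  unfolding sim_def
proof (intro conjI allI impI ballI)
  note t = sim_hom[OF assms(1)]
  show "f \<cdot> k \<in> Hom C X' Y" "g \<cdot> k \<in> Hom C X' Y" using t assms(2) by auto
  fix Z h assume Z: "fibr Z" and h: "h \<in> Hom C Y Z"
  then have "homotopic X Z (h \<cdot> f) (h \<cdot> g)" using assms(1) unfolding sim_def by blast
  from homotopic_pre[OF this assms(2)] show "homotopic X' Z (h \<cdot> (f \<cdot> k)) (h \<cdot> (g \<cdot> k))"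
    using t assms(2) h by (simp add: Hom_def assoc)
qed

lemma sim_post:
  assumes "sim X Y f g" "k \<in> Hom C Y Y'" shows "sim X Y' (k \<cdot> f) (k \<cdot> g)"
  unfolding sim_def
proof (intro conjI allI impI ballI)
  note t = sim_hom[OF assms(1)]
  show "k \<cdot> f \<in> Hom C X Y'" "k \<cdot> g \<in> Hom C X Y'" using t assms(2) by auto
  fix Z h assume Z: "fibr Z" and h: "h \<in> Hom C Y' Z"
  then have "homotopic X Z ((h \<cdot> k) \<cdot> f) ((h \<cdot> k) \<cdot> g)"
    using assms comp_hom[OF assms(2) h] unfolding sim_def by blast
  then show "homotopic X Z (h \<cdot> (k \<cdot> f)) (h \<cdot> (k \<cdot> g))"
    using t assms(2) h by (simp add: Hom_def assoc)
qed

text \<open>The map becomes invertible in the homotopy category of cofibrant objects, phrased by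
  homotopy classes of maps into fibrant objects.\<close>
definition hequiv :: "'a \<Rightarrow> 'a \<Rightarrow> 'b \<Rightarrow> bool" where
  "hequiv X Y f \<longleftrightarrow> cofb X \<and> cofb Y \<and> f \<in> Hom C X Y \<and> (\<forall>Z. fibr Z \<longrightarrow>
     (\<forall>g \<in> Hom C X Z. \<exists>h \<in> Hom C Y Z. sim X Z (h \<cdot> f) g) \<and>
     (\<forall>h \<in> Hom C Y Z. \<forall>h' \<in> Hom C Y Z. sim X Z (h \<cdot> f) (h' \<cdot> f) \<longrightarrow> sim Y Z h h'))"

lemma hequivI:
  assumes "cofb X" "cofb Y" "f \<in> Hom C X Y"
    and "\<And>Z g. fibr Z \<Longrightarrow> g \<in> Hom C X Z \<Longrightarrow> \<exists>h \<in> Hom C Y Z. sim X Z (h \<cdot> f) g"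
    and "\<And>Z h h'. fibr Z \<Longrightarrow> h \<in> Hom C Y Z \<Longrightarrow> h' \<in> Hom C Y Z \<Longrightarrow> sim X Z (h \<cdot> f) (h' \<cdot> f) \<Longrightarrow>
           sim Y Z h h'"
  shows "hequiv X Y f"
  using assms unfolding hequiv_def by blast

lemma hequivD:
  assumes "hequiv X Y f"
  shows "cofb X" "cofb Y" "f \<in> Hom C X Y" "X \<in> Obj C" "Y \<in> Obj C"
  using assms cofb_obj unfolding hequiv_def by blast+

lemma hequiv_surj:
  assumes "hequiv X Y f" "fibr Z" "g \<in> Hom C X Z"
  obtains h where "h \<in> Hom C Y Z" "sim X Z (h \<cdot> f) g"
  using assms unfolding hequiv_def by blast

lemma hequiv_inj:
  assumes "hequiv X Y f" "fibr Z" "h \<in> Hom C Y Z" "h' \<in> Hom C Y Z" "sim X Z (h \<cdot> f) (h' \<cdot> f)"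
  shows "sim Y Z h h'"
  using assms unfolding hequiv_def by blast

lemma hequiv_comp:
  assumes f: "hequiv X Y f" and g: "hequiv Y Z g"
  shows "hequiv X Z (g \<cdot> f)"
proof (rule hequivI[OF hequivD(1)[OF f] hequivD(2)[OF g] comp_hom[OF hequivD(3)[OF f] hequivD(3)[OF g]]])
  note fh = hequivD(3)[OF f] and gh = hequivD(3)[OF g]
  fix W u assume W: "fibr W" and u: "u \<in> Hom C X W"
  obtain h where h: "h \<in> Hom C Y W" "sim X W (h \<cdot> f) u" using hequiv_surj[OF f W u] .
  obtain k where k: "k \<in> Hom C Z W" "sim Y W (k \<cdot> g) h" using hequiv_surj[OF g W h(1)] .
  have "sim X W (k \<cdot> (g \<cdot> f)) u"
    using sim_trans[OF hequivD(1)[OF f] sim_pre[OF k(2) fh] h(2)] k(1) fh gh by (simp add: Hom_def assoc)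
  then show "\<exists>h\<in>Hom C Z W. sim X W (h \<cdot> (g \<cdot> f)) u" using k by blast
next
  note fh = hequivD(3)[OF f] and gh = hequivD(3)[OF g]
  fix W h h' assume W: "fibr W" and h: "h \<in> Hom C Z W" "h' \<in> Hom C Z W"
    and s: "sim X W (h \<cdot> (g \<cdot> f)) (h' \<cdot> (g \<cdot> f))"
  have "sim X W (h \<cdot> g \<cdot> f) (h' \<cdot> g \<cdot> f)" using s h fh gh by (simp add: Hom_def assoc)
  then have "sim Y W (h \<cdot> g) (h' \<cdot> g)"
    by (rule hequiv_inj[OF f W comp_hom[OF gh h(1)] comp_hom[OF gh h(2)]])
  then show "sim Z W h h'" by (rule hequiv_inj[OF g W h])
qed

lemma hequiv_cancel_right:
  assumes f: "hequiv X Y f" and gf: "hequiv X Z (g \<cdot> f)" and g: "g \<in> Hom C Y Z"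
  shows "hequiv Y Z g"
proof (rule hequivI[OF hequivD(2)[OF f] hequivD(2)[OF gf] g])
  note fh = hequivD(3)[OF f]
  fix W u assume W: "fibr W" and u: "u \<in> Hom C Y W"
  obtain k where k: "k \<in> Hom C Z W" "sim X W (k \<cdot> (g \<cdot> f)) (u \<cdot> f)"
    using hequiv_surj[OF gf W comp_hom[OF fh u]] .
  have "sim X W (k \<cdot> g \<cdot> f) (u \<cdot> f)" using k fh g by (simp add: Hom_def assoc)
  then have "sim Y W (k \<cdot> g) u" by (rule hequiv_inj[OF f W comp_hom[OF g k(1)] u])
  then show "\<exists>h\<in>Hom C Z W. sim Y W (h \<cdot> g) u" using k by blast
next
  note fh = hequivD(3)[OF f]
  fix W h h' assume W: "fibr W" and h: "h \<in> Hom C Z W" "h' \<in> Hom C Z W"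
    and s: "sim Y W (h \<cdot> g) (h' \<cdot> g)"
  have "sim X W (h \<cdot> (g \<cdot> f)) (h' \<cdot> (g \<cdot> f))" using sim_pre[OF s fh] h fh g by (simp add: Hom_def assoc)
  then show "sim Z W h h'" by (rule hequiv_inj[OF gf W h])
qed

lemma hequiv_cancel_left:
  assumes g: "hequiv Y Z g" and gf: "hequiv X Z (g \<cdot> f)" and f: "f \<in> Hom C X Y"
  shows "hequiv X Y f"
proof (rule hequivI[OF hequivD(1)[OF gf] hequivD(1)[OF g] f])
  note gh = hequivD(3)[OF g]
  fix W u assume W: "fibr W" and u: "u \<in> Hom C X W"
  obtain k where k: "k \<in> Hom C Z W" "sim X W (k \<cdot> (g \<cdot> f)) u" using hequiv_surj[OF gf W u] .
  have "sim X W (k \<cdot> g \<cdot> f) u" using k f gh by (simp add: Hom_def assoc)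
  then show "\<exists>h\<in>Hom C Y W. sim X W (h \<cdot> f) u" using comp_hom[OF gh k(1)] by blast
next
  note gh = hequivD(3)[OF g] and cX = hequivD(1)[OF gf] and cY = hequivD(1)[OF g]
  fix W h h' assume W: "fibr W" and h: "h \<in> Hom C Y W" "h' \<in> Hom C Y W"
    and s: "sim X W (h \<cdot> f) (h' \<cdot> f)"
  obtain k where k: "k \<in> Hom C Z W" "sim Y W (k \<cdot> g) h" using hequiv_surj[OF g W h(1)] .
  obtain k' where k': "k' \<in> Hom C Z W" "sim Y W (k' \<cdot> g) h'" using hequiv_surj[OF g W h(2)] .
  have "sim X W (k \<cdot> g \<cdot> f) (k' \<cdot> g \<cdot> f)"
    using sim_trans[OF cX sim_pre[OF k(2) f] sim_trans[OF cX s sim_sym[OF cX sim_pre[OF k'(2) f]]]] .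
  then have "sim X W (k \<cdot> (g \<cdot> f)) (k' \<cdot> (g \<cdot> f))" using k k' f gh by (simp add: Hom_def assoc)
  then have "sim Z W k k'" by (rule hequiv_inj[OF gf W k(1) k'(1)])
  from sim_pre[OF this gh] show "sim Y W h h'"
    using sim_trans[OF cY sim_sym[OF cY k(2)]] sim_trans[OF cY _ k'(2)] by blast
qed

lemma hequiv_sim:
  assumes f: "hequiv X Y f" and s: "sim X Y f g"
  shows "hequiv X Y g"
proof (rule hequivI[OF hequivD(1,2)[OF f] sim_hom(2)[OF s]])
  note cX = hequivD(1)[OF f]
  fix W u assume W: "fibr W" and u: "u \<in> Hom C X W"
  obtain h where h: "h \<in> Hom C Y W" "sim X W (h \<cdot> f) u" using hequiv_surj[OF f W u] .
  then show "\<exists>h\<in>Hom C Y W. sim X W (h \<cdot> g) u"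
    using sim_trans[OF cX sim_sym[OF cX sim_post[OF s h(1)]] h(2)] by blast
next
  note cX = hequivD(1)[OF f]
  fix W h h' assume W: "fibr W" and h: "h \<in> Hom C Y W" "h' \<in> Hom C Y W"
    and s': "sim X W (h \<cdot> g) (h' \<cdot> g)"
  have "sim X W (h \<cdot> f) (h' \<cdot> f)"
    using sim_trans[OF cX sim_post[OF s h(1)] sim_trans[OF cX s' sim_sym[OF cX sim_post[OF s h(2)]]]] .
  then show "sim Y W h h'" by (rule hequiv_inj[OF f W h])
qed

lemma hequiv_retract:
  assumes g: "hequiv U V g" and cX: "cofb X" and cY: "cofb Y" and f: "f \<in> Hom C X Y"
    and s: "s \<in> Hom C X U" "t \<in> Hom C U X" "sim X X (t \<cdot> s) (Ident C X)"
    and s': "s' \<in> Hom C Y V" "t' \<in> Hom C V Y" "sim Y Y (t' \<cdot> s') (Ident C Y)"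
    and sq: "sim X V (g \<cdot> s) (s' \<cdot> f)" "sim U Y (f \<cdot> t) (t' \<cdot> g)"
  shows "hequiv X Y f"
proof (rule hequivI[OF cX cY f])
  note gh = hequivD(3)[OF g]
  fix W u assume W: "fibr W" and u: "u \<in> Hom C X W"
  obtain k where k: "k \<in> Hom C V W" "sim U W (k \<cdot> g) (u \<cdot> t)"
    using hequiv_surj[OF g W comp_hom[OF s(2) u]] .
  have 1: "sim X W (k \<cdot> s' \<cdot> f) (k \<cdot> g \<cdot> s)"
    using sim_sym[OF cX sim_post[OF sq(1) k(1)]] k(1) f s s' gh by (simp add: Hom_def assoc)
  have 2: "sim X W (u \<cdot> t \<cdot> s) u"
    using sim_post[OF s(3) u] u s by (simp add: Hom_def assoc)
  have "sim X W (k \<cdot> s' \<cdot> f) u"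
    using sim_trans[OF cX 1 sim_trans[OF cX sim_pre[OF k(2) s(1)] 2]] .
  then show "\<exists>h\<in>Hom C Y W. sim X W (h \<cdot> f) u" using comp_hom[OF s'(1) k(1)] by blast
next
  note gh = hequivD(3)[OF g] and cU = hequivD(1)[OF g]
  fix W h h' assume W: "fibr W" and h: "h \<in> Hom C Y W" "h' \<in> Hom C Y W"
    and hf: "sim X W (h \<cdot> f) (h' \<cdot> f)"
  have 1: "sim U W (m \<cdot> f \<cdot> t) (m \<cdot> t' \<cdot> g)" if "m \<in> Hom C Y W" for m
    using sim_post[OF sq(2) that] that f s s' gh by (simp add: Hom_def assoc)
  have "sim U W (h \<cdot> t' \<cdot> g) (h' \<cdot> t' \<cdot> g)"
    using sim_trans[OF cU sim_sym[OF cU 1[OF h(1)]] sim_trans[OF cU sim_pre[OF hf s(2)] 1[OF h(2)]]] .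
  then have 2: "sim V W (h \<cdot> t') (h' \<cdot> t')"
    by (rule hequiv_inj[OF g W comp_hom[OF s'(2) h(1)] comp_hom[OF s'(2) h(2)]])
  have 3: "sim Y W (m \<cdot> t' \<cdot> s') m" if "m \<in> Hom C Y W" for m
    using sim_post[OF s'(3) that] that s' by (simp add: Hom_def assoc)
  show "sim Y W h h'"
    using sim_trans[OF cY sim_sym[OF cY 3[OF h(1)]] sim_trans[OF cY sim_pre[OF 2 s'(1)] 3[OF h(2)]]] .
qed

lemma hequiv_inverse:
  assumes cX: "cofb X" and cY: "cofb Y" and f: "f \<in> Hom C X Y" and g: "g \<in> Hom C Y X"
    and s: "sim X X (g \<cdot> f) (Ident C X)" "sim Y Y (f \<cdot> g) (Ident C Y)"
  shows "hequiv X Y f"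
proof (rule hequivI[OF cX cY f])
  fix W u assume W: "fibr W" and u: "u \<in> Hom C X W"
  have "sim X W (u \<cdot> g \<cdot> f) u" using sim_post[OF s(1) u] u f g by (simp add: Hom_def assoc)
  then show "\<exists>h\<in>Hom C Y W. sim X W (h \<cdot> f) u" using comp_hom[OF g u] by blast
next
  fix W h h' assume W: "fibr W" and h: "h \<in> Hom C Y W" "h' \<in> Hom C Y W"
    and hf: "sim X W (h \<cdot> f) (h' \<cdot> f)"
  have 3: "sim Y W (m \<cdot> f \<cdot> g) m" if "m \<in> Hom C Y W" for m
    using sim_post[OF s(2) that] that f g by (simp add: Hom_def assoc)
  show "sim Y W h h'"
    using sim_trans[OF cY sim_sym[OF cY 3[OF h(1)]] sim_trans[OF cY sim_pre[OF hf g] 3[OF h(2)]]] .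
qed

lemma hequiv_ident: "cofb X \<Longrightarrow> hequiv X X (Ident C X)"
proof -
  assume X: "cofb X"
  have o: "X \<in> Obj C" using cofb_obj[OF X] .
  show ?thesis
    using hequiv_inverse[OF X X ident_hom[OF o] ident_hom[OF o]] sim_refl[OF ident_hom[OF o]] o by simp
qed

section \<open>Anodyne core cofibrations and homotopy equivalences\<close>

text \<open>Maps into a fibrant object extend along \<open>j\<close>, which gives surjectivity, and homotopies extend
  from \<open>A\<close> to \<open>B\<close> relative to given ends by the two-ended corner condition for anodyne maps, which
  gives injectivity.\<close>
lemma core_anodyne_M_hequiv:
  assumes j: "j \<in> AnCof M" "j \<in> Hom C A B" and A: "cofb A"
  shows "hequiv A B j"
proof -
  have jN: "j \<in> AnCof N" using core_anodyne_transfer[OF j A] .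
  have B: "cofb B" using cofb_cod[OF _ j(2) A] jN N_wfs(3) by blast
  have o: "A \<in> Obj C" "B \<in> Obj C" using hom_objs[OF j(2)] by auto
  show ?thesis
  proof (rule hequivI[OF A B j(2)])
    fix Z g assume Z: "fibr Z" and g: "g \<in> Hom C A Z"
    obtain h where "h \<in> Hom C B Z" "h \<cdot> j = g"
      using extend_to_fibrant[OF N_wfs(2) Z jN j(2) g] .
    then show "\<exists>h\<in>Hom C B Z. sim A Z (h \<cdot> j) g" using sim_refl[OF g] by metis
  next
    fix Z h h' assume Z: "fibr Z" and h: "h \<in> Hom C B Z" "h' \<in> Hom C B Z"
      and s: "sim A Z (h \<cdot> j) (h' \<cdot> j)"
    obtain H where H: "H \<in> Hom C (OMap I A) Z" "H \<cdot> e False A = h \<cdot> j" "H \<cdot> e True A = h' \<cdot> j"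
      using sim_homotopic[OF s Z] unfolding homotopic_def by blast
    obtain L where L: "L \<in> Hom C (OMap I B) Z" "\<forall>b \<in> UNIV. L \<cdot> e b B = (if b then h' else h)"
      "L \<cdot> AMap I j = H"
    proof (rule end_lift_fibrant[OF end_lifts_anodyne[OF j(2) A j(1)] j(2) Z _ H(1),
          of "\<lambda>b. if b then h' else h"])
      show "(if b then h' else h) \<in> Hom C B Z" for b using h by simp
      show "(if b then h' else h) \<cdot> j = H \<cdot> e b A" for b using H by (cases b) simp_all
    qed (use that in auto)
    then have "homotopic B Z h h'"
      unfolding homotopic_def by (intro bexI[of _ L]) simp_all
    then show "sim B Z h h'" using homotopic_sim o by blast
  qed
qed

text \<open>The two-ended corner condition is available for the anodyne maps of \<open>M\<close> only. Both \<open>k\<close> and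
  \<open>k \<cdot> j\<close> are of that kind for a suitable \<open>k\<close>, and two-out-of-three gives the result for \<open>j\<close>.\<close>
lemma core_anodyne_hequiv:
  assumes j: "j \<in> AnCof N" "j \<in> Hom C A B" and A: "cofb A"
  shows "hequiv A B j"
proof -
  have B: "cofb B" using cofb_cod[OF _ j(2) A] j N_wfs(3) by blast
  obtain k B' where k: "k \<in> AnCof M" "k \<in> Hom C B B'" "k \<cdot> j \<in> AnCof M"
    using core_anodyne_extend[OF j A] .
  show ?thesis
    using hequiv_cancel_left[OF core_anodyne_M_hequiv[OF k(1,2) B]
        core_anodyne_M_hequiv[OF k(3) comp_hom[OF j(2) k(2)] A] j(2)] .
qed

text \<open>Dold's argument. Since \<open>A\<close> and \<open>B\<close> are fibrant, \<open>j\<close> has a strict retraction \<open>s\<close> and there is a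
  homotopy \<open>H\<close> from \<open>j \<cdot> s\<close> to the identity. It need not be constant on \<open>A\<close>; filling a box whose walls
  are \<open>H\<close> and \<open>H\<close> precomposed with \<open>j \<cdot> s\<close> replaces it by a homotopy \<open>D\<close> that is. A lifting problem
  \<open>u, k\<close> against a fibration then has the approximate solution \<open>u \<cdot> s\<close>, which covers \<open>k \<cdot> j \<cdot> s\<close>,
  and lifting the homotopy \<open>k \<cdot> D\<close> from \<open>k \<cdot> j \<cdot> s\<close> to \<open>k\<close>, constantly on \<open>A\<close>, ends in a solution.\<close>
lemma hequiv_fibrant_anodyne:
  assumes j: "j \<in> Cof N" "hequiv A B j" and A: "fibr A" and B: "fibr B"
  shows "j \<in> AnCof N"
proof -
  note cA = hequivD(1)[OF j(2)] and cB = hequivD(2)[OF j(2)] and jh = hequivD(3)[OF j(2)]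
  note o = hequivD(4,5)[OF j(2)]
  have lifts: "end_lifts C I e {False} j q" if "q \<in> Fib N" for q
    using end_lifts_one[OF jh cA j(1) that] .
  \<comment> \<open>A strict retraction: a homotopy retraction, corrected along the homotopy extension property.\<close>
  obtain h where h: "h \<in> Hom C B A" "sim A A (h \<cdot> j) (Ident C A)"
    using hequiv_surj[OF j(2) A ident_hom[OF o(1)]] .
  obtain H0 where H0: "H0 \<in> Hom C (OMap I A) A" "H0 \<cdot> e False A = h \<cdot> j" "H0 \<cdot> e True A = Ident C A"
    using sim_homotopic[OF h(2) A] unfolding homotopic_def by blast
  obtain L0 where L0: "L0 \<in> Hom C (OMap I B) A" "L0 \<cdot> AMap I j = H0"
    using end_lift_fibrant[OF lifts jh A, of "\<lambda>_. h" H0] h(1) H0 by auto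
  define s where "s = L0 \<cdot> e True B"
  have s: "s \<in> Hom C B A" unfolding s_def using comp_hom[OF e_hom[OF o(2)] L0(1)] .
  have sj: "s \<cdot> j = Ident C A"
    using L0(1) jh o H0(3) extend[OF L0(2), of "e True A"] by (simp add: s_def Hom_def assoc e_nat)
  have js: "j \<cdot> s \<in> Hom C B B" using comp_hom[OF s jh] .
  have jsj: "j \<cdot> (s \<cdot> j) = j" using sj jh by (simp add: Hom_def)
  have "sim A B (j \<cdot> s \<cdot> j) (Ident C B \<cdot> j)"
    using sim_refl[OF jh] jsj s jh o by (simp add: Hom_def assoc)
  then have "sim B B (j \<cdot> s) (Ident C B)"
    by (rule hequiv_inj[OF j(2) B js ident_hom[OF o(2)]])
  then obtain H where H: "H \<in> Hom C (OMap I B) B" "H \<cdot> e False B = j \<cdot> s" "H \<cdot> e True B = Ident C B"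
    using sim_homotopic[OF _ B] unfolding homotopic_def by blast
  \<comment> \<open>On \<open>A\<close> the two sides \<open>H \<cdot> I (j \<cdot> s)\<close> and \<open>H\<close> of the box agree, so the box can be
    filled with a top that is constant on \<open>A\<close>.\<close>
  define side where "side b = (if b then H else H \<cdot> AMap I (j \<cdot> s))" for b
  have side: "side b \<in> Hom C (OMap I B) B" for b
    using H(1) comp_hom[OF I_hom[OF js] H(1)] by (simp add: side_def)
  note rA = r_hom[OF o(1)] and rB = r_hom[OF o(2)]
  have rn: "r B \<cdot> AMap I j = j \<cdot> r A" using r_nat[OF jh] .
  have HIj: "H \<cdot> AMap I j \<in> Hom C (OMap I A) B" using comp_hom[OF I_hom[OF jh] H(1)] .
  have HIje: "H \<cdot> AMap I j \<cdot> e False A = j" "H \<cdot> AMap I j \<cdot> e True A = j"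
  proof -
    have "H \<cdot> AMap I j \<cdot> e b A = (H \<cdot> e b B) \<cdot> j" for b
      using H(1) jh o by (simp add: Hom_def assoc e_nat)
    then show "H \<cdot> AMap I j \<cdot> e False A = j" "H \<cdot> AMap I j \<cdot> e True A = j"
      using H(2,3) jsj s jh o by (simp_all add: Hom_def assoc)
  qed
  define S where "S = H \<cdot> AMap I j \<cdot> AMap I (r A)"
  have S: "S \<in> Hom C (OMap I (OMap I A)) B"
    unfolding S_def using comp_hom[OF I_hom[OF rA] HIj] .
  have Se: "S \<cdot> e b (OMap I A) = j \<cdot> r A" for b
  proof -
    have "S \<cdot> e b (OMap I A) = (H \<cdot> AMap I j \<cdot> e b A) \<cdot> r A"
      unfolding S_def using H(1) jh rA o by (simp add: Hom_def assoc e_nat e_nat_extend)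
    then show ?thesis using HIje by (cases b) simp_all
  qed
  define K where "K = j \<cdot> s \<cdot> r B"
  have K: "K \<in> Hom C (OMap I B) B" unfolding K_def using comp_hom[OF rB js] .
  obtain D where D: "D \<in> Hom C (OMap I B) B" "\<forall>b. D \<cdot> e b B = side b \<cdot> e True B"
    "D \<cdot> AMap I j = S \<cdot> e True (OMap I A)"
  proof (rule box_filling[OF j(1) jh cA B K side S])
    fix b
    have "K \<cdot> e b B = j \<cdot> s"
      using js rB re[OF o(2), of b] o by (simp add: K_def Hom_def assoc)
    moreover have "side b \<cdot> e False B = j \<cdot> s"
    proof (cases b)
      case False
      have "side b \<cdot> e False B = (H \<cdot> e False B) \<cdot> (j \<cdot> s)"
        using False H(1) js o by (simp add: side_def Hom_def assoc e_nat)
      also have "\<dots> = j \<cdot> s"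
        unfolding H(2) using s jh sj o extend[OF sj, of s] by (simp add: Hom_def assoc)
      finally show ?thesis .
    qed (simp add: side_def H)
    ultimately show "K \<cdot> e b B = side b \<cdot> e False B" by simp
    have "K \<cdot> AMap I j = (j \<cdot> s) \<cdot> (r B \<cdot> AMap I j)"
      unfolding K_def using js rB jh o by (simp add: Hom_def assoc)
    also have "\<dots> = j \<cdot> r A"
      unfolding rn using s jh rA o extend[OF sj, of "r A"] by (simp add: Hom_def assoc)
    finally show "S \<cdot> e False (OMap I A) = K \<cdot> AMap I j" using Se by simp
    have "S \<cdot> AMap I (e b A) = H \<cdot> AMap I j \<cdot> AMap I (r A \<cdot> e b A)"
      unfolding S_def using H(1) jh rA o by (simp add: Hom_def assoc I_comp)
    also have "\<dots> = H \<cdot> AMap I j" using re[OF o(1), of b] HIj o by (simp add: Hom_def)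
    also have "\<dots> = side b \<cdot> AMap I j"
    proof (cases b)
      case False
      have "side b \<cdot> AMap I j = H \<cdot> AMap I ((j \<cdot> s) \<cdot> j)"
        using False H(1) js jh o I_comp[of j "j \<cdot> s"] by (simp add: side_def Hom_def assoc)
      then show ?thesis using jsj s jh by (simp add: Hom_def assoc)
    qed (simp add: side_def)
    finally show "S \<cdot> AMap I (e b A) = side b \<cdot> AMap I j" .
  qed
  have D0: "D \<cdot> e False B = j \<cdot> s"
  proof -
    have "D \<cdot> e False B = (H \<cdot> e True B) \<cdot> (j \<cdot> s)"
      using D(2)[THEN spec[of _ False]] H(1) js o by (simp add: side_def Hom_def assoc e_nat)
    then show ?thesis unfolding H(3) using js by (simp add: Hom_def)
  qed
  have D1: "D \<cdot> e True B = Ident C B"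
    using D(2)[THEN spec[of _ True]] H(3) by (simp add: side_def)
  have Dj: "D \<cdot> AMap I j = j \<cdot> r A" using D(3) Se by simp
  show ?thesis
  proof (rule wfs_leftI[OF N_wfs(2)])
    show "j \<in> Arr C" using jh by blast
    fix q assume q: "q \<in> Fib N"
    have qh: "q \<in> Hom C (Dom C q) (Cod C q)" using wfs_arr(2)[OF N_wfs(2) q] by (simp add: Hom_def)
    show "lifts_against C j q"
    proof (rule liftsI[OF jh qh])
      fix u k assume u: "u \<in> Hom C A (Dom C q)" and k: "k \<in> Hom C B (Cod C q)" and eq: "q \<cdot> u = k \<cdot> j"
      obtain L where L: "L \<in> Hom C (OMap I B) (Dom C q)" "\<forall>b\<in>{False}. L \<cdot> e b B = u \<cdot> s"
        "L \<cdot> AMap I j = u \<cdot> r A" "q \<cdot> L = k \<cdot> D"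
      proof (rule end_liftsE[OF lifts[OF q] jh qh _ comp_hom[OF rA u] comp_hom[OF D(1) k], of "\<lambda>_. u \<cdot> s"])
        show "u \<cdot> s \<in> Hom C B (Dom C q)" using comp_hom[OF s u] .
        show "u \<cdot> s \<cdot> j = u \<cdot> r A \<cdot> e b A" for b
          using u s jh rA sj re[OF o(1), of b] o by (simp add: Hom_def assoc)
        show "q \<cdot> (u \<cdot> s) = k \<cdot> D \<cdot> e b B" if "b \<in> {False}" for b
          using that u s jh D(1) D0 k qh o extend[OF eq, of s] by (simp add: Hom_def assoc)
        show "q \<cdot> (u \<cdot> r A) = k \<cdot> D \<cdot> AMap I j"
          using u jh D(1) Dj k qh rA o extend[OF eq, of "r A"] by (simp add: Hom_def assoc)
      qed (use that in auto)
      have "L \<cdot> e True B \<cdot> j = (L \<cdot> AMap I j) \<cdot> e True A"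
        using L(1) jh o by (simp add: Hom_def assoc e_nat)
      also have "\<dots> = u"
        unfolding L(3) using u rA re[OF o(1), of True] o by (simp add: Hom_def assoc)
      finally have 1: "L \<cdot> e True B \<cdot> j = u" .
      have "q \<cdot> (L \<cdot> e True B) = k"
        using L(1) qh k D(1) D1 o extend[OF L(4), of "e True B"] by (simp add: Hom_def assoc)
      with 1 show "\<exists>h\<in>Hom C B (Dom C q). h \<cdot> j = u \<and> q \<cdot> h = k"
        using comp_hom[OF e_hom[OF o(2)] L(1)] by blast
    qed
  qed
qed

text \<open>Replace \<open>A\<close> by a fibrant \<open>A'\<close>, push \<open>j\<close> out along \<open>A \<rightarrow> A'\<close>, and replace the pushout by a
  fibrant object \<open>B'\<close>. The resulting cofibration \<open>A' \<rightarrow> B'\<close> is a homotopy equivalence by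
  two-out-of-three, hence anodyne by Dold's argument. So \<open>j\<close> followed by the anodyne map \<open>B \<rightarrow> B'\<close> is
  anodyne, that is, \<open>j\<close> is acyclic.\<close>
lemma hequiv_anodyne:
  assumes j: "j \<in> Cof N" "hequiv A B j"
  shows "j \<in> AnCof N"
proof -
  note cA = hequivD(1)[OF j(2)] and cB = hequivD(2)[OF j(2)] and jh = hequivD(3)[OF j(2)]
  note o = hequivD(4,5)[OF j(2)]
  obtain T where T: "is_terminal C T" using terminal by blast
  obtain f A' where f: "f \<in> AnCof N" "f \<in> Hom C A A'" "fibr A'"
    using fibrant_factor[OF N_wfs(2) T o(1)] .
  have cA': "cofb A'" using cofb_cod[OF _ f(2) cA] f(1) N_wfs(3) by blast
  obtain a b where po: "is_pushout C f j a b" using pushouts[OF f(2) jh] by blast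
  define P where "P = Cod C a"
  have t: "a \<in> Hom C A' P" "b \<in> Hom C B P" "a \<cdot> f = b \<cdot> j"
    using pushout_homs[OF po] f(2) jh by (simp_all add: P_def Hom_def)
  have bN: "b \<in> AnCof N" using wfs_pushout[OF N_wfs(2) f(1) po] .
  have aN: "a \<in> Cof N" using wfs_pushout[OF N_wfs(1) j(1) pushout_sym[OF po]] .
  have P: "P \<in> Obj C" using hom_objs[OF t(1)] by simp
  obtain g B' where g: "g \<in> AnCof N" "g \<in> Hom C P B'" "fibr B'"
    using fibrant_factor[OF N_wfs(2) T P] .
  have gb: "g \<cdot> b \<in> AnCof N" "g \<cdot> b \<in> Hom C B B'"
    using wfs_comp[OF N_wfs(2) bN g(1) t(2) g(2)] comp_hom[OF t(2) g(2)] .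
  have ga: "g \<cdot> a \<in> Cof N" "g \<cdot> a \<in> Hom C A' B'"
    using wfs_comp[OF N_wfs(1) aN _ t(1) g(2)] g(1) N_wfs(3) comp_hom[OF t(1) g(2)] by blast+
  have eq: "(g \<cdot> a) \<cdot> f = (g \<cdot> b) \<cdot> j" using t g(2) f(2) jh by (simp add: Hom_def assoc)
  have "hequiv A' B' (g \<cdot> a)"
  proof (rule hequiv_cancel_right[OF core_anodyne_hequiv[OF f(1,2) cA] _ ga(2)])
    show "hequiv A B' (g \<cdot> a \<cdot> f)"
      unfolding eq using hequiv_comp[OF j(2) core_anodyne_hequiv[OF gb cB]] .
  qed
  then have "g \<cdot> a \<in> AnCof N" using hequiv_fibrant_anodyne[OF ga(1) _ f(3) g(3)] by blast
  then have "(g \<cdot> b) \<cdot> j \<in> AnCof N"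
    using wfs_comp[OF N_wfs(2) f(1) _ f(2) ga(2)] eq by simp
  then have "j \<in> acyclic_cofibs C N" using acyclic_cofibI[OF N_wfs(2) j(1) jh gb] by blast
  then show ?thesis using core_acyclic_anodyne[OF _ jh cA] by blast
qed

section \<open>Weak equivalences\<close>

definition resolution :: "'a \<Rightarrow> 'b \<Rightarrow> 'a \<Rightarrow> bool" where
  "resolution X' q X \<longleftrightarrow> cofb X' \<and> q \<in> AnFib N \<and> q \<in> Hom C X' X"

text \<open>By \<open>hequiv_cover_independent\<close> a single choice of resolutions and covering map decides.\<close>
definition weq :: "'b \<Rightarrow> bool" where
  "weq f \<longleftrightarrow> f \<in> Arr C \<and> (\<forall>X' q Y' q' f'. resolution X' q (Dom C f) \<longrightarrow> resolution Y' q' (Cod C f) \<longrightarrow>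
     f' \<in> Hom C X' Y' \<longrightarrow> q' \<cdot> f' = f \<cdot> q \<longrightarrow> hequiv X' Y' f')"

lemma cofb_lift:
  assumes A: "cofb A" and q: "q \<in> AnFib N" "q \<in> Hom C X Y" and v: "v \<in> Hom C A Y"
  obtains u where "u \<in> Hom C A X" "q \<cdot> u = v"
proof -
  obtain Z z where z: "is_initial C Z" "z \<in> Hom C Z A" "z \<in> Cof N"
    using A unfolding cofibrant_def by blast
  obtain w where w: "w \<in> Hom C Z X" using z(1) hom_objs[OF q(2)] unfolding is_initial_def by blast
  have "q \<cdot> w = v \<cdot> z" using initial_unique[OF z(1) comp_hom[OF w q(2)] comp_hom[OF z(2) v]] .
  from liftsE[OF wfs_lifts[OF N_wfs(1) z(3) q(1)] z(2) q(2) w v this] that show ?thesis by blast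
qed

lemma resolution_exists:
  assumes "X \<in> Obj C"
  obtains X' q where "resolution X' q X"
proof -
  obtain Z where Z: "is_initial C Z" using initial by blast
  then obtain z where "z \<in> Hom C Z X" using assms unfolding is_initial_def by blast
  then obtain l q X' where "l \<in> Cof N" "q \<in> AnFib N" "l \<in> Hom C Z X'" "q \<in> Hom C X' X"
    using wfs_factor[OF N_wfs(1)] by metis
  then show ?thesis using that cofb_cod[OF _ _ cofb_initial[OF Z]] unfolding resolution_def by blast
qed

lemma resolution_cover:
  assumes f: "f \<in> Hom C X Y" and q: "resolution X' q X" "resolution Y' q' Y"
  obtains f' where "f' \<in> Hom C X' Y'" "q' \<cdot> f' = f \<cdot> q"
proof -
  have h: "cofb X'" "q \<in> Hom C X' X" "q' \<in> AnFib N" "q' \<in> Hom C Y' Y"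
    using q unfolding resolution_def by auto
  show ?thesis using cofb_lift[OF h(1,3,4) comp_hom[OF h(2) f]] that .
qed

lemma resolution_sim:
  assumes A: "cofb A" and q: "resolution Y' q Y" and f: "f \<in> Hom C A Y'" "g \<in> Hom C A Y'" "q \<cdot> f = q \<cdot> g"
  shows "sim A Y' f g"
  using anfib_homotopic[OF A _ _ f] q homotopic_sim cofb_obj[OF A] unfolding resolution_def by blast

lemma comparison_hequiv:
  assumes p: "resolution X' p X" and q: "resolution X'' q X" and a: "a \<in> Hom C X' X''" "q \<cdot> a = p"
  shows "hequiv X' X'' a"
proof -
  have h: "cofb X'" "p \<in> Hom C X' X" "cofb X''" "q \<in> Hom C X'' X" "p \<in> AnFib N"
    using p q unfolding resolution_def by auto
  have o: "X' \<in> Obj C" "X'' \<in> Obj C" using hom_objs[OF a(1)] by auto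
  obtain b where b: "b \<in> Hom C X'' X'" "p \<cdot> b = q" using cofb_lift[OF h(3,5,2,4)] .
  have "sim X' X' (b \<cdot> a) (Ident C X')"
  proof (rule resolution_sim[OF h(1) p comp_hom[OF a(1) b(1)] ident_hom[OF o(1)]])
    show "p \<cdot> (b \<cdot> a) = p \<cdot> Ident C X'"
      using h a b o extend[OF b(2), of a] by (simp add: Hom_def)
  qed
  moreover have "sim X'' X'' (a \<cdot> b) (Ident C X'')"
  proof (rule resolution_sim[OF h(3) q comp_hom[OF b(1) a(1)] ident_hom[OF o(2)]])
    show "q \<cdot> (a \<cdot> b) = q \<cdot> Ident C X''"
      using h a b o extend[OF a(2), of b] by (simp add: Hom_def)
  qed
  ultimately show ?thesis by (rule hequiv_inverse[OF h(1,3) a(1) b(1)])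
qed

text \<open>Comparison maps between two resolutions of the same object are homotopy equivalences, and two
  maps covering the same map are homotopic because the target resolution is an anodyne fibration.\<close>
lemma hequiv_cover_independent:
  assumes f: "f \<in> Hom C X Y"
    and p: "resolution X1 p X" "resolution Y1 p' Y" "f1 \<in> Hom C X1 Y1" "p' \<cdot> f1 = f \<cdot> p"
    and q: "resolution X2 q X" "resolution Y2 q' Y" "f2 \<in> Hom C X2 Y2" "q' \<cdot> f2 = f \<cdot> q"
    and e: "hequiv X1 Y1 f1"
  shows "hequiv X2 Y2 f2"
proof -
  have h: "cofb X1" "p \<in> Hom C X1 X" "p' \<in> Hom C Y1 Y" "cofb X2" "q \<in> Hom C X2 X" "q' \<in> Hom C Y2 Y"
    using p q unfolding resolution_def by auto
  have o: "X \<in> Obj C" "Y \<in> Obj C" using hom_objs[OF f] by auto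
  obtain a where a: "a \<in> Hom C X1 X2" "q \<cdot> a = p"
    using resolution_cover[OF ident_hom[OF o(1)] p(1) q(1)] h by (auto simp: Hom_def)
  obtain b where b: "b \<in> Hom C Y1 Y2" "q' \<cdot> b = p'"
    using resolution_cover[OF ident_hom[OF o(2)] p(2) q(2)] h by (auto simp: Hom_def)
  have s: "sim X1 Y2 (b \<cdot> f1) (f2 \<cdot> a)"
  proof (rule resolution_sim[OF h(1) q(2) comp_hom[OF p(3) b(1)] comp_hom[OF a(1) q(3)]])
    show "q' \<cdot> (b \<cdot> f1) = q' \<cdot> (f2 \<cdot> a)"
      using h a b p(3,4) q(3) f extend[OF b(2), of f1] extend[OF q(4), of a]
      by (simp add: Hom_def assoc)
  qed
  have "hequiv X1 Y2 (f2 \<cdot> a)"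
    using hequiv_sim[OF hequiv_comp[OF e comparison_hequiv[OF p(2) q(2) b]] s] .
  then show ?thesis
    using hequiv_cancel_right[OF comparison_hequiv[OF p(1) q(1) a] _ q(3)] by blast
qed

lemma weq_iff:
  assumes f: "f \<in> Hom C X Y"
    and p: "resolution X1 p X" "resolution Y1 p' Y" "f1 \<in> Hom C X1 Y1" "p' \<cdot> f1 = f \<cdot> p"
  shows "weq f \<longleftrightarrow> hequiv X1 Y1 f1"
proof
  have o: "Dom C f = X" "Cod C f = Y" "f \<in> Arr C" using f by (auto simp: Hom_def)
  show "hequiv X1 Y1 f1" if "weq f" using that p unfolding weq_def o by blast
  show "weq f" if "hequiv X1 Y1 f1"
    unfolding weq_def o using hequiv_cover_independent[OF f p _ _ _ _ that] o(3) by blast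
qed

lemma weq_two_out_of_three: "two_out_of_three C {f. weq f}"
  unfolding two_out_of_three_def
proof (intro allI ballI)
  fix X Y Z f g assume f: "f \<in> Hom C X Y" and g: "g \<in> Hom C Y Z"
  have o: "X \<in> Obj C" "Y \<in> Obj C" "Z \<in> Obj C" using hom_objs f g by blast+
  obtain X' p where p: "resolution X' p X" using resolution_exists[OF o(1)] .
  obtain Y' q where q: "resolution Y' q Y" using resolution_exists[OF o(2)] .
  obtain Z' s where s: "resolution Z' s Z" using resolution_exists[OF o(3)] .
  have h: "p \<in> Hom C X' X" "q \<in> Hom C Y' Y" "s \<in> Hom C Z' Z"
    using p q s unfolding resolution_def by auto
  obtain f' where f': "f' \<in> Hom C X' Y'" "q \<cdot> f' = f \<cdot> p" using resolution_cover[OF f p q] .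
  obtain g' where g': "g' \<in> Hom C Y' Z'" "s \<cdot> g' = g \<cdot> q" using resolution_cover[OF g q s] .
  have gf: "s \<cdot> (g' \<cdot> f') = g \<cdot> f \<cdot> p"
    using h f g f' g' extend[OF g'(2), of f'] by (simp add: Hom_def assoc)
  note iffs = weq_iff[OF f p q f'] weq_iff[OF g q s g']
    weq_iff[OF comp_hom[OF f g] p s comp_hom[OF f'(1) g'(1)] gf]
  show "(f \<in> {f. weq f} \<and> g \<in> {f. weq f} \<longrightarrow> g \<cdot> f \<in> {f. weq f}) \<and>
      (f \<in> {f. weq f} \<and> g \<cdot> f \<in> {f. weq f} \<longrightarrow> g \<in> {f. weq f}) \<and>
      (g \<in> {f. weq f} \<and> g \<cdot> f \<in> {f. weq f} \<longrightarrow> f \<in> {f. weq f})"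
    unfolding mem_Collect_eq iffs
    using hequiv_comp hequiv_cancel_right[OF _ _ g'(1)] hequiv_cancel_left[OF _ _ f'(1)] by blast
qed

lemma weq_retract_closed: "retract_closed C {f. weq f}"
  unfolding retract_closed_def mem_Collect_eq
proof (intro ballI impI, unfold mem_Collect_eq)
  fix f g assume f: "f \<in> Arr C" and g: "weq g" and ret: "is_retract C f g"
  define X Y U V where "X = Dom C f" and "Y = Cod C f" and "U = Dom C g" and "V = Cod C g"
  have fh: "f \<in> Hom C X Y" and gh: "g \<in> Hom C U V"
    using f g by (simp_all add: X_def Y_def U_def V_def Hom_def weq_def)
  from ret obtain a b c d where h: "a \<in> Hom C X U" "b \<in> Hom C U X" "c \<in> Hom C Y V" "d \<in> Hom C V Y"
    and eq: "b \<cdot> a = Ident C X" "d \<cdot> c = Ident C Y" "g \<cdot> a = c \<cdot> f" "f \<cdot> b = d \<cdot> g"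
    unfolding is_retract_def X_def Y_def U_def V_def by blast
  have o: "X \<in> Obj C" "Y \<in> Obj C" "U \<in> Obj C" "V \<in> Obj C" using hom_objs h by blast+
  obtain X' x where x: "resolution X' x X" using resolution_exists[OF o(1)] .
  obtain Y' y where y: "resolution Y' y Y" using resolution_exists[OF o(2)] .
  obtain U' u where u: "resolution U' u U" using resolution_exists[OF o(3)] .
  obtain V' v where v: "resolution V' v V" using resolution_exists[OF o(4)] .
  have r: "x \<in> Hom C X' X" "y \<in> Hom C Y' Y" "u \<in> Hom C U' U" "v \<in> Hom C V' V"
    "cofb X'" "cofb Y'" "cofb U'" "cofb V'"
    using x y u v unfolding resolution_def by auto
  have o': "X' \<in> Obj C" "Y' \<in> Obj C" using hom_objs r by blast+
  obtain f' where f': "f' \<in> Hom C X' Y'" "y \<cdot> f' = f \<cdot> x" using resolution_cover[OF fh x y] .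
  obtain g' where g': "g' \<in> Hom C U' V'" "v \<cdot> g' = g \<cdot> u" using resolution_cover[OF gh u v] .
  obtain a' where a': "a' \<in> Hom C X' U'" "u \<cdot> a' = a \<cdot> x" using resolution_cover[OF h(1) x u] .
  obtain b' where b': "b' \<in> Hom C U' X'" "x \<cdot> b' = b \<cdot> u" using resolution_cover[OF h(2) u x] .
  obtain c' where c': "c' \<in> Hom C Y' V'" "v \<cdot> c' = c \<cdot> y" using resolution_cover[OF h(3) y v] .
  obtain d' where d': "d' \<in> Hom C V' Y'" "y \<cdot> d' = d \<cdot> v" using resolution_cover[OF h(4) v y] .
  have "hequiv X' Y' f'"
  proof (rule hequiv_retract[OF _ r(5,6) f'(1) a'(1) b'(1) _ c'(1) d'(1)])
    show "hequiv U' V' g'" using weq_iff[OF gh u v g'] g by simp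
    show "sim X' X' (b' \<cdot> a') (Ident C X')"
    proof (rule resolution_sim[OF r(5) x comp_hom[OF a'(1) b'(1)] ident_hom[OF o'(1)]])
      show "x \<cdot> (b' \<cdot> a') = x \<cdot> Ident C X'"
        using r h a' b' o extend[OF b'(2), of a'] extend[OF eq(1), of x] by (simp add: Hom_def assoc)
    qed
    show "sim Y' Y' (d' \<cdot> c') (Ident C Y')"
    proof (rule resolution_sim[OF r(6) y comp_hom[OF c'(1) d'(1)] ident_hom[OF o'(2)]])
      show "y \<cdot> (d' \<cdot> c') = y \<cdot> Ident C Y'"
        using r h c' d' o extend[OF d'(2), of c'] extend[OF eq(2), of y] by (simp add: Hom_def assoc)
    qed
    show "sim X' V' (g' \<cdot> a') (c' \<cdot> f')"
    proof (rule resolution_sim[OF r(5) v comp_hom[OF a'(1) g'(1)] comp_hom[OF f'(1) c'(1)]])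
      show "v \<cdot> (g' \<cdot> a') = v \<cdot> (c' \<cdot> f')"
        using r h fh gh a' c' g' f' o extend[OF g'(2), of a'] extend[OF c'(2), of f'] extend[OF eq(3), of x]
        by (simp add: Hom_def assoc)
    qed
    show "sim U' Y' (f' \<cdot> b') (d' \<cdot> g')"
    proof (rule resolution_sim[OF r(7) y comp_hom[OF b'(1) f'(1)] comp_hom[OF g'(1) d'(1)]])
      show "y \<cdot> (f' \<cdot> b') = y \<cdot> (d' \<cdot> g')"
        using r h fh gh b' d' g' f' o extend[OF f'(2), of b'] extend[OF d'(2), of g'] extend[OF eq(4), of u]
        by (simp add: Hom_def assoc)
    qed
  qed
  then show "weq f" using weq_iff[OF fh x y f'] by simp
qed

lemma weq_core_iff:
  assumes "cofb A" "cofb B" "j \<in> Hom C A B"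
  shows "weq j \<longleftrightarrow> hequiv A B j"
proof -
  have res: "resolution X (Ident C X) X" if "cofb X" for X
    using that wfs_right_ident[OF N_wfs(1)] ident_hom cofb_obj[OF that] unfolding resolution_def by simp
  show ?thesis
    by (rule weq_iff[OF assms(3) res[OF assms(1)] res[OF assms(2)] assms(3)])
      (use assms(3) in \<open>simp add: Hom_def\<close>)
qed

lemma core_weq_iff_anodyne:
  assumes j: "j \<in> Cof N" "j \<in> Hom C A B" "cofb A"
  shows "weq j \<longleftrightarrow> j \<in> AnCof N"
  using weq_core_iff[OF j(3) cofb_cod[OF j] j(2)] hequiv_anodyne[OF j(1)] core_anodyne_hequiv[OF _ j(2,3)]
  by blast

text \<open>If \<open>x\<close> resolves the source of \<open>q\<close>, then \<open>q \<cdot> x\<close> resolves its target, and \<open>q\<close> is covered by an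
  identity.\<close>
lemma anfib_weq:
  assumes p: "q \<in> AnFib N" "q \<in> Hom C X Y"
  shows "weq q"
proof -
  have o: "X \<in> Obj C" using hom_objs[OF p(2)] by simp
  obtain X' x where x: "resolution X' x X" using resolution_exists[OF o] .
  then have h: "cofb X'" "x \<in> AnFib N" "x \<in> Hom C X' X" unfolding resolution_def by auto
  have y: "resolution X' (q \<cdot> x) Y"
    using h wfs_right_comp[OF N_wfs(1) h(2) p(1) h(3) p(2)] comp_hom[OF h(3) p(2)]
    unfolding resolution_def by blast
  have "hequiv X' X' (Ident C X')" using hequiv_ident[OF h(1)] .
  then show ?thesis
    using weq_iff[OF p(2) x y ident_hom] h p hom_objs[OF h(3)] by (simp add: Hom_def)
qed

text \<open>Given a lifting problem \<open>u, v\<close> for a core cofibration, factor \<open>u\<close> through an anodyne fibration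
  \<open>q : X' \<rightarrow> X\<close> with \<open>X'\<close> cofibrant, and \<open>f \<cdot> q\<close> as a cofibration \<open>k\<close> followed by an anodyne fibration
  \<open>q'\<close>. Then \<open>k\<close> is a core cofibration and a weak equivalence, hence anodyne, which yields a map \<open>s\<close> with
  \<open>s \<cdot> k = q\<close> and \<open>f \<cdot> s = q'\<close>. The problem transported to \<open>q'\<close> is solvable, and \<open>s\<close> carries its solution
  back to \<open>f\<close>.\<close>
lemma fib_weq_anodyne:
  assumes p: "f \<in> Fib N" "f \<in> Hom C X Y" "weq f"
  shows "f \<in> AnFib N"
proof -
  have "f \<in> acyclic_fibs C N"
    unfolding acyclic_fibs_def
  proof (intro CollectI conjI ballI impI p(1))
    fix i assume i: "i \<in> Cof N" "cofb (Dom C i) \<and> cofb (Cod C i)"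
    define A B where "A = Dom C i" and "B = Cod C i"
    have ih: "i \<in> Hom C A B" using wfs_arr(1)[OF N_wfs(1) i(1)] by (simp add: A_def B_def Hom_def)
    have A: "cofb A" using i by (simp add: A_def)
    show "lifts_against C i f"
    proof (rule liftsI[OF ih p(2)])
      fix u v assume u: "u \<in> Hom C A X" and v: "v \<in> Hom C B Y" and eq: "f \<cdot> u = v \<cdot> i"
      obtain m q X' where m: "m \<in> Cof N" "q \<in> AnFib N" "m \<in> Hom C A X'" "q \<in> Hom C X' X" "u = q \<cdot> m"
        using wfs_factor[OF N_wfs(1) u] .
      obtain k q' Y' where k: "k \<in> Cof N" "q' \<in> AnFib N" "k \<in> Hom C X' Y'" "q' \<in> Hom C Y' Y"
          "f \<cdot> q = q' \<cdot> k"
        using wfs_factor[OF N_wfs(1) comp_hom[OF m(4) p(2)]] .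
      have X': "cofb X'" using cofb_cod[OF m(1,3) A] .
      have "weq (q' \<cdot> k)"
        using weq_two_out_of_three[unfolded two_out_of_three_def, THEN spec, THEN spec, THEN spec,
            THEN bspec, OF m(4), THEN bspec, OF p(2)] anfib_weq[OF m(2,4)] p(3) k(5) by simp
      then have "weq k"
        using weq_two_out_of_three[unfolded two_out_of_three_def, THEN spec, THEN spec, THEN spec,
            THEN bspec, OF k(3), THEN bspec, OF k(4)] anfib_weq[OF k(2,4)] by simp
      then have kN: "k \<in> AnCof N" using core_weq_iff_anodyne[OF k(1,3) X'] by blast
      obtain s where s: "s \<in> Hom C Y' X" "s \<cdot> k = q" "f \<cdot> s = q'"
        using liftsE[OF wfs_lifts[OF N_wfs(2) kN p(1)] k(3) p(2) m(4) k(4,5)] .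
      have "q' \<cdot> (k \<cdot> m) = v \<cdot> i"
        using eq m p(2) k(3,4) extend[OF k(5), of m] by (simp add: Hom_def assoc)
      from liftsE[OF wfs_lifts[OF N_wfs(1) i(1) k(2)] ih k(4) comp_hom[OF m(3) k(3)] v this]
      obtain w where w: "w \<in> Hom C B Y'" "w \<cdot> i = k \<cdot> m" "q' \<cdot> w = v" .
      have "(s \<cdot> w) \<cdot> i = u"
        using s(1) w(1,2) ih m k(3) extend[OF s(2), of m] by (simp add: Hom_def assoc)
      moreover have "f \<cdot> (s \<cdot> w) = v"
        using s(1) w(1,3) p(2) extend[OF s(3), of w] by (simp add: Hom_def assoc)
      ultimately show "\<exists>h\<in>Hom C B X. h \<cdot> i = u \<and> f \<cdot> h = v"
        using comp_hom[OF w(1) s(1)] by blast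
    qed
  qed
  then show ?thesis using right_sat unfolding right_saturated_def by blast
qed

lemma fib_weq_eq: "Fib N \<inter> {f. weq f} = AnFib N"
proof -
  have "f \<in> Hom C (Dom C f) (Cod C f)" if "f \<in> Fib N" for f
    using wfs_arr(2)[OF N_wfs(2) that] by (simp add: Hom_def)
  then show ?thesis using fib_weq_anodyne anfib_weq AnFib_subset by blast
qed

lemma left_semi_model:
  assumes "complete_category \<kappa> C" "cocomplete_category \<kappa> C"
  shows "left_semi_model_category \<kappa> C {f. weq f} (Cof N) (Fib N)"
  unfolding left_semi_model_category_def fib_weq_eq
proof (intro conjI ballI allI impI cat assms weq_two_out_of_three weq_retract_closed N_wfs(1))
  show "{f. weq f} \<subseteq> Arr C" unfolding weq_def by blast
  show "Cof N \<subseteq> Arr C" "Fib N \<subseteq> Arr C" using wfs_arr[OF N_wfs(1)] wfs_arr[OF N_wfs(2)] by blast+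
  show "retract_closed C (Cof N)" using wfs_retract[OF N_wfs(1)] .
  show "retract_closed C (Fib N)" using wfs_right_retract[OF N_wfs(2)] .
  fix f assume f: "f \<in> Arr C" and c: "cofb (Dom C f)"
  have fh: "f \<in> Hom C (Dom C f) (Cod C f)" using f by (simp add: Hom_def)
  show "factors_as C f (Cof N) (AnFib N)"
    using wfs_factor[OF N_wfs(1) fh] unfolding factors_as_def by metis
  obtain l q Z where l: "l \<in> AnCof N" "q \<in> Fib N" "l \<in> Hom C (Dom C f) Z" "q \<in> Hom C Z (Cod C f)"
    "f = q \<cdot> l" using wfs_factor[OF N_wfs(2) fh] .
  have lC: "l \<in> Cof N" using l(1) N_wfs(3) by blast
  then have "l \<in> Cof N \<inter> {f. weq f}" using core_weq_iff_anodyne[OF lC l(3) c] l(1) by blast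
  then show "factors_as C f (Cof N \<inter> {f. weq f}) (Fib N)"
    using l(2-5) unfolding factors_as_def by blast
next
  fix i q assume i: "i \<in> core_cofibs C (Cof N)" and q: "q \<in> Fib N" and w: "i \<in> {f. weq f} \<or> q \<in> {f. weq f}"
  have i': "i \<in> Cof N" "cofb (Dom C i)" "i \<in> Hom C (Dom C i) (Cod C i)"
    using i wfs_arr(1)[OF N_wfs(1)] by (auto simp: core_cofibs_def Hom_def)
  show "lifts_against C i q"
  proof (cases "weq i")
    case True
    then have "i \<in> AnCof N" using core_weq_iff_anodyne[OF i'(1,3,2)] by blast
    then show ?thesis using wfs_lifts[OF N_wfs(2) _ q] by blast
  next
    case False
    then have "q \<in> AnFib N" using w q fib_weq_eq by blast
    then show ?thesis using wfs_lifts[OF N_wfs(1) i'(1)] by blast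
  qed
next
  fix q g a b assume "q \<in> Fib N \<and> is_pullback C q g a b"
  then show "b \<in> Fib N" using wfs_right_pullback[OF N_wfs(2)] by blast
next
  fix Z assume "is_initial C Z" then show "cofb Z" by (rule cofb_initial)
qed

end

section \<open>The two semi-model structures\<close>
lemma left_semi_model_of_cylinder:
  fixes \<kappa> :: "'k rel" and C :: "('o, 'm) category"
  assumes inf: "Cinfinite \<kappa>" and M: "premodel_category \<kappa> C M" and N: "premodel_category \<kappa> C N"
    and cyl: "quillen_cylinder C M I G \<phi> e r"
    and core: "core_cofibs C (Cof N) = core_cofibs C (Cof M)"
      "acyclic_cofibs C N \<inter> core_cofibs C (Cof N) = acyclic_cofibs C M \<inter> core_cofibs C (Cof M)"
    and sat: "core_left_saturated C N" "right_saturated C N"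
  shows "\<exists>W. left_semi_model_category \<kappa> C W (Cof N) (Fib N)"
proof -
  have cat: "is_category C" and comp: "complete_category \<kappa> C" "cocomplete_category \<kappa> C"
    using M by (auto simp: premodel_category_def)
  have "\<exists>Z. is_terminal C Z"
    using cocomplete_initial[OF inf is_category_opposite[OF cat] cocomplete_opposite[OF comp(1)]] by simp
  then interpret same_left_core C I e G \<phi> r M N
    using cat M N cyl core sat cocomplete_initial[OF inf cat comp(2)] cocomplete_pushout[OF inf cat comp(2)]
    by unfold_locales (auto simp: premodel_category_def quillen_cylinder_def is_adjunction_def)
  show ?thesis using left_semi_model[OF comp] by blast
qed

theorem theorem6p12:
  fixes \<kappa> :: "'k rel"
    and C :: "('o, 'm) category"
    and M :: "'m premodel_structure"
    and S I :: "('o, 'm, 'o, 'm) functr"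
    and s\<^sub>0 s\<^sub>1 i p :: "'o \<Rightarrow> 'm"
  assumes "Cinfinite \<kappa>"
    and "premodel_category \<kappa> C M"
    and "strong_quillen_cylinder C M S s\<^sub>0 s\<^sub>1 I i p"
  shows "(\<forall>N. premodel_category \<kappa> C N \<and> core_left_saturated C N \<and> right_saturated C N \<and>
              left_core C N = left_core C M
              \<longrightarrow> (\<exists>W. left_semi_model_category \<kappa> C W (Cof N) (Fib N))) \<and>
         (\<forall>N. premodel_category \<kappa> C N \<and> core_right_saturated C N \<and> left_saturated C N \<and>
              right_core C N = right_core C M
              \<longrightarrow> (\<exists>W. right_semi_model_category \<kappa> C W (Cof N) (Fib N)))"
proof -
  have cat: "is_category C" and comp: "cocomplete_category \<kappa> C"
    using assms(2) by (auto simp: premodel_category_def)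
  obtain G \<phi> e where cyl: "quillen_cylinder C M I G \<phi> e p"
    using strong_quillen_cylinder_lifts[OF cat assms(2) _ assms(3)]
      cocomplete_pushout[OF assms(1) cat comp] by blast
  obtain \<phi>' e' r' where cyl': "quillen_cylinder (opposite C) (opposite_structure M) G I \<phi>' e' r'"
    using quillen_cylinder_opposite[OF cat assms(2) cyl] by blast
  show ?thesis
  proof (intro conjI allI impI)
    fix N
    assume "premodel_category \<kappa> C N \<and> core_left_saturated C N \<and> right_saturated C N \<and>
              left_core C N = left_core C M"
    then show "\<exists>W. left_semi_model_category \<kappa> C W (Cof N) (Fib N)"
      using left_semi_model_of_cylinder[OF assms(1,2) _ cyl] unfolding left_core_def prod.inject
      by blast
  next
    fix N
    assume N: "premodel_category \<kappa> C N \<and> core_right_saturated C N \<and> left_saturated C N \<and>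
              right_core C N = right_core C M"
    have "core_left_saturated (opposite C) (opposite_structure N)"
      "right_saturated (opposite C) (opposite_structure N)"
      using N by (simp_all add: core_left_saturated_def core_right_saturated_def
          left_saturated_def right_saturated_def)
    moreover have "core_fibs C (Fib N) = core_fibs C (Fib M)"
      "acyclic_fibs C N \<inter> core_fibs C (Fib N) = acyclic_fibs C M \<inter> core_fibs C (Fib M)"
      using N unfolding right_core_def prod.inject by blast+
    ultimately obtain W where
      "left_semi_model_category \<kappa> (opposite C) W (Cof (opposite_structure N)) (Fib (opposite_structure N))"
      using left_semi_model_of_cylinder[OF assms(1) premodel_opposite[OF assms(2)]
          premodel_opposite[of \<kappa> C N] cyl'] N by (simp; blast)
    then show "\<exists>W. right_semi_model_category \<kappa> C W (Cof N) (Fib N)"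
      using right_semi_model_opposite[of \<kappa> C W "Fib N" "Cof N"] by auto
  qed
qed

end
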